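(* Let $N=3$, and let $\varrho$ be the regular representation of $\mathcal{K}_{\Gamma_0(3)}$ over $\mathcal{K}$ with respect to the basis $\{1,x_P,x_P^2,x_P^3\}$. Then $\varrho(a')$ and $\varrho(b')$ are respectively $$\begin{pmatrix}-9a&0&-10a^2&0\\0&-9a&120b&-10a^2\\-30&0&51a&120b\\0&-30&0&51a\end{pmatrix}\quad\text{and}\quad\begin{pmatrix}-27b&-70a^2/3&0&98a^3/3\\-42a&253b&-70a^2/3&-392ab\\0&98a&253b&-658a^2/3\\-70&0&98a&253b\end{pmatrix}.$$
   Context: $q=e^{2\pi i\tau}$; $\mathcal{M}_\kappa(\Gamma)$ is the space of weight $\kappa$ modular forms for $\Gamma$, $\mathcal{R}_\Gamma=\bigoplus_{\kappa\ge0}\mathcal{M}_\kappa(\Gamma)$, and $\mathcal{K}_\Gamma$ is the field of fractions of the integral domain $\mathcal{R}_\Gamma$; $\mathcal{R}=\mathcal{R}_{SL(2,\mathbf{Z})}$, $\mathcal{K}=\mathcal{K}_{SL(2,\mathbf{Z})}$. One has $\mathcal{R}=\mathbf{C}[a,b]$, a polynomial ring, where $$a(\tau)=-\tfrac13\Bigl(1+240\sum_{n\ge1}\sigma_3(n)q^n\Bigr)\ (\text{weight }4),\qquad b(\tau)=\tfrac{2}{27}\Bigl(1-504\sum_{n\ge1}\sigma_5(n)q^n\Bigr)\ (\text{weight }6).$$ Let $x_P(\tau)=-\pi^{-2}\wp(1/3;\mathbf{Z}+\mathbf{Z}\tau)\in\mathcal{M}_2(\Gamma_0(3))$; it is the $x$-coordinate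 of a point of order $3$ on $y^2=x^3+ax+b$ and is a root of the $3$-division polynomial $3x^4+6ax^2+12bx-a^2$. The powers $1,x_P,x_P^2,x_P^3$ form a basis of $\mathcal{K}_{\Gamma_0(3)}$ over $\mathcal{K}$. The regular representation $\varrho$ with respect to an ordered basis $\{v_1,\dots,v_n\}$ sends $f$ to the matrix $(\varrho(f)_{ij})$ over $\mathcal{K}$ with $f v_j=\sum_i\varrho(f)_{ij}v_i$ (columns are the coordinates of $fv_j$). Here $a'(\tau)=3^4a(3\tau)$ and $b'(\tau)=3^6b(3\tau)$, elements of $\mathcal{R}_{\Gamma_0(3)}$. *)

theory Defs
  imports
    "HOL-Complex_Analysis.Complex_Analysis"
    "HOL-Computational_Algebra.Computational_Algebra"
begin

section \<open>Holomorphic functions on the upper half-plane\<close>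

definition uhp :: "complex set" where
  "uhp = {\<tau>. Im \<tau> > 0}"

lemma open_uhp: "open uhp"
  and connected_uhp: "connected uhp"
  and ii_in_uhp: "\<i> \<in> uhp"
  by (auto simp: uhp_def open_halfspace_Im_gt connected_halfspace_Im_gt)

text \<open>
  Functions are total, so a holomorphic function on the upper half-plane is represented by its
  extension by 0; two elements of the type are then equal iff they agree on the half-plane.
\<close>

typedef uhp_hol = "{f :: complex \<Rightarrow> complex. f holomorphic_on uhp \<and> (\<forall>\<tau>. \<tau> \<notin> uhp \<longrightarrow> f \<tau> = 0)}"
  morphisms hol_fun Abs_uhp_hol
  by (rule exI[of _ "\<lambda>_. 0"]) auto

setup_lifting type_definition_uhp_hol

lemma hol_fun_holomorphic: "hol_fun f holomorphic_on uhp"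
  using hol_fun[of f] by auto

lemma uhp_hol_eqI:
  assumes "\<And>\<tau>. \<tau> \<in> uhp \<Longrightarrow> hol_fun f \<tau> = hol_fun g \<tau>"
  shows "f = g"
proof -
  have "hol_fun f \<tau> = hol_fun g \<tau>" for \<tau>
    using assms[of \<tau>] hol_fun[of f] hol_fun[of g] by (cases "\<tau> \<in> uhp") auto
  then show ?thesis
    by (auto simp: hol_fun_inject[symmetric])
qed

instantiation uhp_hol :: comm_ring_1
begin

lift_definition zero_uhp_hol :: uhp_hol is "\<lambda>_. 0" by auto

lift_definition one_uhp_hol :: uhp_hol is "\<lambda>\<tau>. if \<tau> \<in> uhp then 1 else 0"
  by (auto cong: holomorphic_cong)

lift_definition plus_uhp_hol :: "uhp_hol \<Rightarrow> uhp_hol \<Rightarrow> uhp_hol" is "\<lambda>f g \<tau>. f \<tau> + g \<tau>"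
  by (auto intro: holomorphic_intros)

lift_definition minus_uhp_hol :: "uhp_hol \<Rightarrow> uhp_hol \<Rightarrow> uhp_hol" is "\<lambda>f g \<tau>. f \<tau> - g \<tau>"
  by (auto intro: holomorphic_intros)

lift_definition uminus_uhp_hol :: "uhp_hol \<Rightarrow> uhp_hol" is "\<lambda>f \<tau>. - f \<tau>"
  by (auto intro: holomorphic_intros)

lift_definition times_uhp_hol :: "uhp_hol \<Rightarrow> uhp_hol \<Rightarrow> uhp_hol" is "\<lambda>f g \<tau>. f \<tau> * g \<tau>"
  by (auto intro: holomorphic_intros)

instance
proof
  show "(0 :: uhp_hol) \<noteq> 1"
    by transfer (use ii_in_uhp in \<open>auto simp: fun_eq_iff\<close>)
qed (transfer; auto simp: fun_eq_iff algebra_simps)+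

end

instance uhp_hol :: idom
proof
  fix f g :: uhp_hol
  assume f: "f \<noteq> 0" and g: "g \<noteq> 0"
  show "f * g \<noteq> 0"
  proof
    assume "f * g = 0"
    then have prod0: "hol_fun f \<tau> * hol_fun g \<tau> = 0" for \<tau>
      by (metis times_uhp_hol.rep_eq zero_uhp_hol.rep_eq)
    obtain \<tau>0 where \<tau>0: "\<tau>0 \<in> uhp" "hol_fun f \<tau>0 \<noteq> 0"
      using f uhp_hol_eqI[of f 0] by (auto simp: zero_uhp_hol.rep_eq)
    have "continuous_on uhp (hol_fun f)"
      by (rule holomorphic_on_imp_continuous_on[OF hol_fun_holomorphic])
    then have op: "open (hol_fun f -` (- {0}) \<inter> uhp)"
      using continuous_on_open_vimage[OF open_uhp] by blast
    have "\<tau>0 islimpt (hol_fun f -` (- {0}) \<inter> uhp)"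
      using \<tau>0 interior_open[OF op] by (intro interior_limit_point) blast
    then have "hol_fun g \<tau> = 0" if "\<tau> \<in> uhp" for \<tau>
      using \<tau>0(1) prod0 that
      by (intro analytic_continuation[OF hol_fun_holomorphic[of g] open_uhp connected_uhp,
            where U = "hol_fun f -` (- {0}) \<inter> uhp" and \<xi> = \<tau>0 and w = \<tau>]) auto
    then have "g = 0"
      by (intro uhp_hol_eqI) (simp add: zero_uhp_hol.rep_eq)
    with g show False ..
  qed
qed

text \<open>The restriction of \<open>f\<close> to the upper half-plane; meaningful only for \<open>f\<close> holomorphic there.\<close>

definition hol_of :: "(complex \<Rightarrow> complex) \<Rightarrow> uhp_hol" where
  "hol_of f = Abs_uhp_hol (\<lambda>\<tau>. if \<tau> \<in> uhp then f \<tau> else 0)"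

lemma hol_fun_hol_of:
  assumes "f holomorphic_on uhp"
  shows "hol_fun (hol_of f) \<tau> = (if \<tau> \<in> uhp then f \<tau> else 0)"
  using assms unfolding hol_of_def
  by (subst Abs_uhp_hol_inverse) (auto cong: holomorphic_cong)


section \<open>Modular forms, their graded ring, and its field of fractions\<close>

definition SL2Z :: "(int^2^2) set" where
  "SL2Z = {\<gamma>. det \<gamma> = 1}"

definition Gamma0 :: "nat \<Rightarrow> (int^2^2) set" where
  "Gamma0 N = {\<gamma> \<in> SL2Z. int N dvd \<gamma>$2$1}"

definition aut_factor :: "int^2^2 \<Rightarrow> complex \<Rightarrow> complex" where
  "aut_factor \<gamma> \<tau> = of_int (\<gamma>$2$1) * \<tau> + of_int (\<gamma>$2$2)"

definition moebius_act :: "int^2^2 \<Rightarrow> complex \<Rightarrow> complex" where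
  "moebius_act \<gamma> \<tau> = (of_int (\<gamma>$1$1) * \<tau> + of_int (\<gamma>$1$2)) / aut_factor \<gamma> \<tau>"

definition slash :: "nat \<Rightarrow> (complex \<Rightarrow> complex) \<Rightarrow> int^2^2 \<Rightarrow> complex \<Rightarrow> complex" where
  "slash \<kappa> f \<gamma> \<tau> = f (moebius_act \<gamma> \<tau>) / aut_factor \<gamma> \<tau> ^ \<kappa>"

definition bounded_at_infinity :: "(complex \<Rightarrow> complex) \<Rightarrow> bool" where
  "bounded_at_infinity f \<longleftrightarrow> (\<exists>B>0. \<exists>C. \<forall>\<tau>. Im \<tau> \<ge> B \<longrightarrow> norm (f \<tau>) \<le> C)"

text \<open>
  The cusps of \<open>\<Gamma>\<close> are the translates of infinity by elements of SL(2,Z), so holomorphy at the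
  cusps is a condition on all \<open>slash \<kappa> f \<gamma>\<close>. For \<open>\<Gamma>\<close> of finite index these functions are periodic,
  and being bounded near infinity means having no negative exponents in the Fourier expansion.
\<close>

definition modular_forms :: "(int^2^2) set \<Rightarrow> nat \<Rightarrow> uhp_hol set" where
  "modular_forms \<Gamma> \<kappa> =
     {f. (\<forall>\<gamma>\<in>\<Gamma>. \<forall>\<tau>\<in>uhp. slash \<kappa> (hol_fun f) \<gamma> \<tau> = hol_fun f \<tau>) \<and>
         (\<forall>\<gamma>\<in>SL2Z. bounded_at_infinity (slash \<kappa> (hol_fun f) \<gamma>))}"

text \<open>
  The external direct sum over all weights: the element with components \<open>f\<^sub>\<kappa>\<close> is the polynomial
  whose coefficient of degree \<open>\<kappa>\<close> is \<open>f\<^sub>\<kappa>\<close>, and polynomial multiplication is the graded product.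
\<close>

definition modular_ring :: "(int^2^2) set \<Rightarrow> uhp_hol poly set" where
  "modular_ring \<Gamma> = {p. \<forall>\<kappa>. coeff p \<kappa> \<in> modular_forms \<Gamma> \<kappa>}"

text \<open>
  All these rings lie in the integral domain \<open>uhp_hol poly\<close>, so their fields of fractions are
  realised as subfields of its field of fractions.
\<close>

definition modular_field :: "(int^2^2) set \<Rightarrow> uhp_hol poly fract set" where
  "modular_field \<Gamma> = {Fract p q | p q. p \<in> modular_ring \<Gamma> \<and> q \<in> modular_ring \<Gamma> \<and> q \<noteq> 0}"

definition form :: "nat \<Rightarrow> (complex \<Rightarrow> complex) \<Rightarrow> uhp_hol poly fract" where
  "form \<kappa> f = to_fract (monom (hol_of f) \<kappa>)"


section \<open>The regular representation\<close>

text \<open>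
  \<open>L\<close> is an extension of the field \<open>K\<close> (both inside an ambient field) and the entries of the
  vector \<open>v\<close> are a basis of \<open>L\<close> over \<open>K\<close>. Column \<open>j\<close> of the matrix of \<open>f\<close> consists of the
  coordinates of \<open>f * v$j\<close>. Outside \<open>L\<close> the representation is \<open>undefined\<close>.
\<close>

definition coordinates :: "'a::field set \<Rightarrow> 'a^'n \<Rightarrow> 'a \<Rightarrow> 'a^'n" where
  "coordinates K v w = (THE c. (\<forall>i. c$i \<in> K) \<and> w = (\<Sum>i\<in>UNIV. c$i * v$i))"

definition regular_rep :: "'a::field set \<Rightarrow> 'a set \<Rightarrow> 'a^'n \<Rightarrow> 'a \<Rightarrow> 'a^'n^'n" where
  "regular_rep L K v = (\<lambda>f\<in>L. \<chi> i j. coordinates K v (f * v$j) $ i)"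


section \<open>The forms \<open>a\<close>, \<open>b\<close>, \<open>x\<^sub>P\<close>, \<open>a'\<close>, \<open>b'\<close>\<close>

definition sigma :: "nat \<Rightarrow> nat \<Rightarrow> nat" where
  "sigma k n = (\<Sum>d | d dvd n. d ^ k)"

definition nome :: "complex \<Rightarrow> complex" where
  "nome \<tau> = exp (2 * of_real pi * \<i> * \<tau>)"

definition a_fun :: "complex \<Rightarrow> complex" where
  "a_fun \<tau> = - (1/3) * (1 + 240 * (\<Sum>n. of_nat (sigma 3 (Suc n)) * nome \<tau> ^ Suc n))"

definition b_fun :: "complex \<Rightarrow> complex" where
  "b_fun \<tau> = (2/27) * (1 - 504 * (\<Sum>n. of_nat (sigma 5 (Suc n)) * nome \<tau> ^ Suc n))"

definition period_lattice :: "complex \<Rightarrow> complex set" where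
  "period_lattice \<tau> = {of_int m + of_int n * \<tau> | m n. True}"

definition weierstrass_p :: "complex \<Rightarrow> complex set \<Rightarrow> complex" where
  "weierstrass_p z \<Lambda> = 1 / z\<^sup>2 + (\<Sum>\<^sub>\<infinity>\<omega>\<in>\<Lambda> - {0}. 1 / (z - \<omega>)\<^sup>2 - 1 / \<omega>\<^sup>2)"

definition mf_a :: "uhp_hol poly fract" where
  "mf_a = form 4 a_fun"

definition mf_b :: "uhp_hol poly fract" where
  "mf_b = form 6 b_fun"

definition mf_xP :: "uhp_hol poly fract" where
  "mf_xP = form 2 (\<lambda>\<tau>. - weierstrass_p (1/3) (period_lattice \<tau>) / of_real pi ^ 2)"

definition mf_a' :: "uhp_hol poly fract" where
  "mf_a' = form 4 (\<lambda>\<tau>. 3 ^ 4 * a_fun (3 * \<tau>))"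

definition mf_b' :: "uhp_hol poly fract" where
  "mf_b' = form 6 (\<lambda>\<tau>. 3 ^ 6 * b_fun (3 * \<tau>))"

end

theory Submission
  imports Defs "HOL-Real_Asymp.Real_Asymp"
begin

text \<open>
  Let \<open>L = \<int> + \<int>\<tau>\<close>, \<open>u = 1/3\<close>, \<open>p = \<wp>(u; L)\<close>, and let \<open>G\<^sub>k(L)\<close> be the sum of \<open>\<omega>\<^bsup>-k\<^esup>\<close> over the
  non-zero lattice points. Then \<open>a = -15 G\<^sub>4(L)/\<pi>\<^sup>4\<close>, \<open>b = 35 G\<^sub>6(L)/\<pi>\<^sup>6\<close> and \<open>x\<^sub>P = -p/\<pi>\<^sup>2\<close>.
  
  The lattice \<open>M = L + \<int>u = (\<int> + 3\<tau>\<int>)/3\<close> consists of the three cosets of \<open>0\<close>, \<open>u\<close>, \<open>-u\<close>, so for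
  even \<open>k\<close> one has \<open>G\<^sub>k(M) = G\<^sub>k(L) + 2 \<Sum>\<^sub>\<omega> (u - \<omega>)\<^bsup>-k\<^esup>\<close> (\<open>eisenstein_isogeny\<close>). The last sum is, up to
  a constant factor, a derivative of \<open>\<wp>\<close> at \<open>u\<close>, and the differential equations of \<open>\<wp>\<close> turn it into a
  polynomial in \<open>p\<close>, \<open>G\<^sub>4(L)\<close> and \<open>G\<^sub>6(L)\<close>. For \<open>k = 4\<close> and \<open>k = 6\<close> this gives
  \<open>a' = -9a - 30x\<^sup>2\<close> and \<open>b' = -27b - 42ax - 70x\<^sup>3\<close> with \<open>x = x\<^sub>P\<close>. For \<open>k = 8\<close> it gives the quartic equation
  of \<open>x\<close>, because \<open>7 G\<^sub>8 = 3 G\<^sub>4\<^sup>2\<close> holds for \<open>L\<close> and for \<open>M\<close> (\<open>three_division_polynomial\<close>). All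
  columns of the two matrices follow from these three relations by reducing powers of \<open>x\<close>.
  
  Reading off a matrix also needs the coordinates to be unique, that is, the independence of \<open>1, x, x\<^sup>2, x\<^sup>3\<close>
  over \<open>\<K>\<close> (\<open>power_basis_independent\<close>). Clearing denominators and separating weights turns a linear
  relation into relations \<open>\<Sum>\<^sub>i f\<^sub>i x\<^sup>i = 0\<close> whose coefficients are modular forms for \<open>SL\<^sub>2(\<int>)\<close>. Such a
  relation remains true when \<open>x\<close> is replaced by one of its conjugates under \<open>SL\<^sub>2(\<int>)\<close>. There are four
  different conjugates, since the relation for \<open>k = 4\<close> recovers \<open>81 a(3\<tau>)\<close> or \<open>a((\<tau> + j)/3)\<close> from
  them, and these functions have different expansions at infinity. A polynomial of degree at most three with
  four roots in an integral domain is zero.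
  
  Two analytic points remain. The forms \<open>a\<close> and \<open>b\<close> are power series in the nome; their identification
  with Eisenstein series is Lipschitz's formula, which comes from differentiating
  \<open>\<Sum>\<^sub>n (z + n)\<^bsup>-2\<^esup> = \<pi>\<^sup>2/sin\<^sup>2 \<pi>z\<close>. The boundedness of \<open>x\<close> at all cusps follows from its quartic
  equation, whose coefficients are bounded.
\<close>

(* "$" denotes vector components below *)
no_notation fps_nth (infixl "$" 75)

section \<open>Termwise differentiation of infinite sums\<close>

text \<open>
  Weierstrass' theorem: local domination by a summable family makes the finite partial sums converge
  locally uniformly, and then their derivatives converge too.
\<close>

lemma infsum_holomorphic:
  fixes f :: "'i \<Rightarrow> complex \<Rightarrow> complex"
  assumes S: "open S" and hol: "\<And>i. i \<in> I \<Longrightarrow> f i holomorphic_on S"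
    and bnd: "\<And>z. z \<in> S \<Longrightarrow> \<exists>d>0. \<exists>M. cball z d \<subseteq> S \<and> M summable_on I \<and>
                 (\<forall>i\<in>I. \<forall>w\<in>cball z d. norm (f i w) \<le> M i)"
  shows "(\<lambda>z. \<Sum>\<^sub>\<infinity>i\<in>I. f i z) holomorphic_on S"
    and "z \<in> S \<Longrightarrow> ((\<lambda>i. deriv (f i) z) has_sum deriv (\<lambda>z. \<Sum>\<^sub>\<infinity>i\<in>I. f i z) z) I"
proof -
  have key: "\<exists>g'. ((\<lambda>z. \<Sum>\<^sub>\<infinity>i\<in>I. f i z) has_field_derivative g') (at z) \<and>
                 ((\<lambda>i. deriv (f i) z) has_sum g') I" if z: "z \<in> S" for z
  proof -
    obtain d M where d: "d > 0" and sub: "cball z d \<subseteq> S" and M: "M summable_on I"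
      and le: "\<And>i w. i \<in> I \<Longrightarrow> w \<in> cball z d \<Longrightarrow> norm (f i w) \<le> M i"
      using bnd[OF z] by blast
    have ul: "uniform_limit (cball z d) (\<lambda>X y. \<Sum>x\<in>X. f x y) (\<lambda>y. \<Sum>\<^sub>\<infinity>x\<in>I. f x y)
                (finite_subsets_at_top I)"
      by (rule Weierstrass_m_test_general[OF le M]) auto
    have ev: "\<forall>\<^sub>F X in finite_subsets_at_top I. continuous_on (cball z d) (\<lambda>y. \<Sum>x\<in>X. f x y) \<and>
        (\<forall>w\<in>ball z d. ((\<lambda>y. \<Sum>x\<in>X. f x y) has_field_derivative (\<Sum>x\<in>X. deriv (f x) w)) (at w))"
    proof (rule eventually_finite_subsets_at_top_weakI, intro conjI ballI)
      fix X assume X: "finite X" "X \<subseteq> I"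
      have *: "f i holomorphic_on S" if "i \<in> X" for i using hol X that by auto
      show "continuous_on (cball z d) (\<lambda>y. \<Sum>x\<in>X. f x y)"
        by (intro continuous_on_sum continuous_on_subset[OF _ sub]
            holomorphic_on_imp_continuous_on *)
      fix w assume "w \<in> ball z d"
      then have "w \<in> S" using sub by (auto intro!: subsetD[OF sub])
      then show "((\<lambda>y. \<Sum>x\<in>X. f x y) has_field_derivative (\<Sum>x\<in>X. deriv (f x) w)) (at w)"
        by (intro DERIV_sum holomorphic_derivI[OF *] S)
    qed
    obtain g' where g': "\<And>w. w \<in> ball z d \<Longrightarrow>
        ((\<lambda>y. \<Sum>\<^sub>\<infinity>x\<in>I. f x y) has_field_derivative g' w) (at w) \<and>
        ((\<lambda>X. \<Sum>x\<in>X. deriv (f x) w) \<longlongrightarrow> g' w) (finite_subsets_at_top I)"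
      using has_complex_derivative_uniform_limit[OF ev ul _ d] by auto
    show ?thesis using g'[of z] d by (auto simp: has_sum_def)
  qed
  show "(\<lambda>z. \<Sum>\<^sub>\<infinity>i\<in>I. f i z) holomorphic_on S"
    using key S by (auto simp: holomorphic_on_open)
  show "((\<lambda>i. deriv (f i) z) has_sum deriv (\<lambda>z. \<Sum>\<^sub>\<infinity>i\<in>I. f i z) z) I" if "z \<in> S"
    using key[OF that] by (auto simp: DERIV_imp_deriv)
qed

section \<open>Lattice sums\<close>

text \<open>
  Convergence of the sum of the inverse cubes is what makes all the series below converge, and it forces
  \<open>L\<close> to be discrete. The integers are an instance as well as the lattices of rank two, so the same
  termwise differentiation yields the Fourier expansions and the theory of the Weierstrass function.
\<close>

locale discrete_subgroup =
  fixes L :: "complex set"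
  assumes zero_mem [simp]: "0 \<in> L"
    and diff_mem: "\<And>x y. x \<in> L \<Longrightarrow> y \<in> L \<Longrightarrow> x - y \<in> L"
    and summable_cube: "(\<lambda>\<omega>. 1 / (1 + norm \<omega>) ^ 3) summable_on L"

text \<open>
  The index set \<open>A\<close> is all of a lattice \<open>L\<close>, or \<open>L - {0}\<close> for the regular part at the origin.
\<close>

definition eis_sum :: "complex set \<Rightarrow> nat \<Rightarrow> complex \<Rightarrow> complex" where
  "eis_sum A k z = (\<Sum>\<^sub>\<infinity>\<omega>\<in>A. 1 / (z - \<omega>) ^ k)"

text \<open>
  As \<open>1 / 0 = 0\<close>, the term of \<open>\<omega> = 0\<close> is \<open>1 / z\<^sup>2\<close>, so \<open>wp_sum L\<close> is the Weierstrass function of \<open>L\<close>.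
\<close>

definition wp_sum :: "complex set \<Rightarrow> complex \<Rightarrow> complex" where
  "wp_sum A z = (\<Sum>\<^sub>\<infinity>\<omega>\<in>A. 1 / (z - \<omega>)\<^sup>2 - 1 / \<omega>\<^sup>2)"

text \<open>
  For \<open>k > 0\<close> the term of \<open>\<omega> = 0\<close> vanishes because \<open>1 / 0 = 0\<close>.
\<close>

definition eisenstein :: "complex set \<Rightarrow> nat \<Rightarrow> complex" where
  "eisenstein L k = (\<Sum>\<^sub>\<infinity>\<omega>\<in>L. 1 / \<omega> ^ k)"

text \<open>
  The two squares differ by a factor of size \<open>z\<close>, which improves quadratic decay to cubic decay.
\<close>

lemma wp_term_bound:
  fixes z \<omega> :: complex
  assumes c: "c > 0" and s: "s > 0" and zw: "norm (z - \<omega>) \<ge> c * s" and w: "norm \<omega> \<ge> c * s"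
  shows "norm (1 / (z - \<omega>)\<^sup>2 - 1 / \<omega>\<^sup>2) \<le> 2 * norm z / c ^ 3 / s ^ 3"
proof -
  define x y where "x = norm (z - \<omega>)" and "y = norm \<omega>"
  have cs: "c * s > 0" using c s by simp
  have xy: "x > 0" "y > 0" "x \<ge> c * s" "y \<ge> c * s" using cs zw w by (auto simp: x_def y_def)
  then have nz: "z \<noteq> \<omega>" "\<omega> \<noteq> 0" by (auto simp: x_def y_def)
  have "1 / (z - \<omega>)\<^sup>2 - 1 / \<omega>\<^sup>2 = z * (\<omega> - (z - \<omega>)) / ((z - \<omega>)\<^sup>2 * \<omega>\<^sup>2)"
  proof -
    have "1 / u\<^sup>2 - 1 / \<omega>\<^sup>2 = (u + \<omega>) * (\<omega> - u) / (u\<^sup>2 * \<omega>\<^sup>2)" if "u \<noteq> 0" for u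
      using that nz(2) by (simp add: field_simps power2_eq_square)
    from this[of "z - \<omega>"] show ?thesis using nz(1) by simp
  qed
  then have "norm (1 / (z - \<omega>)\<^sup>2 - 1 / \<omega>\<^sup>2) = norm z * norm (\<omega> - (z - \<omega>)) / (x\<^sup>2 * y\<^sup>2)"
    by (simp add: norm_mult norm_divide norm_power x_def y_def)
  also have "\<dots> \<le> norm z * (y + x) / (x\<^sup>2 * y\<^sup>2)"
    by (intro divide_right_mono mult_left_mono)
       (use norm_triangle_ineq4[of \<omega> "z - \<omega>"] in \<open>auto simp: x_def y_def\<close>)
  also have "\<dots> = norm z * (1 / (x\<^sup>2 * y) + 1 / (x * y\<^sup>2))"
    using xy by (simp add: field_simps power2_eq_square)
  also have "\<dots> \<le> norm z * (1 / ((c * s)\<^sup>2 * (c * s)) + 1 / ((c * s) * (c * s)\<^sup>2))"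
  proof -
    have "(c * s)\<^sup>2 * (c * s) \<le> x\<^sup>2 * y" "(c * s) * (c * s)\<^sup>2 \<le> x * y\<^sup>2"
      using xy cs by (auto intro!: mult_mono power_mono)
    moreover have "(c * s)\<^sup>2 * (c * s) > 0" "(c * s) * (c * s)\<^sup>2 > 0" "x\<^sup>2 * y > 0" "x * y\<^sup>2 > 0"
      using cs xy(1,2) by (simp_all only: zero_less_mult_iff zero_less_power) auto
    ultimately show ?thesis
      by (intro mult_left_mono add_mono divide_left_mono) auto
  qed
  also have "\<dots> = 2 * norm z / c ^ 3 / s ^ 3"
    using c s by (simp add: field_simps power2_eq_square power3_eq_cube)
  finally show ?thesis .
qed

lemma inverse_power_has_field_derivative:
  fixes z \<omega> :: complex
  assumes "z \<noteq> \<omega>"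
  shows "((\<lambda>z. 1 / (z - \<omega>) ^ k) has_field_derivative - of_nat k / (z - \<omega>) ^ Suc k) (at z)"
proof (cases k)
  case (Suc j)
  define u where "u = z - \<omega>"
  have u: "u \<noteq> 0" using assms by (simp add: u_def)
  have "((\<lambda>z. (z - \<omega>) ^ k) has_field_derivative of_nat k * u ^ j) (at z)"
    using DERIV_power[OF DERIV_diff[OF DERIV_ident DERIV_const], of _ k] Suc by (simp add: u_def)
  from DERIV_divide[OF DERIV_const this, of 1] u
  have "((\<lambda>z. 1 / (z - \<omega>) ^ k) has_field_derivative - (of_nat k * u ^ j) / (u ^ k * u ^ k)) (at z)"
    by (simp add: u_def)
  also have "- (of_nat k * u ^ j) / (u ^ k * u ^ k) = - of_nat k / u ^ Suc k"
    using u Suc by (simp add: field_simps)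
  finally show ?thesis by (simp only: u_def)
qed auto

context discrete_subgroup
begin

lemma uminus_mem: "x \<in> L \<Longrightarrow> - x \<in> L"
  using diff_mem[of 0 x] by simp

lemma add_mem: "x \<in> L \<Longrightarrow> y \<in> L \<Longrightarrow> x + y \<in> L"
  using diff_mem[of x "- y"] uminus_mem by simp

lemma uminus_mem_iff [simp]: "- x \<in> L \<longleftrightarrow> x \<in> L"
  using uminus_mem by force

lemma add_mem_iff: "y \<in> L \<Longrightarrow> x + y \<in> L \<longleftrightarrow> x \<in> L"
  using diff_mem[of "x + y" y] add_mem by auto

lemma diff_mem_iff: "y \<in> L \<Longrightarrow> x - y \<in> L \<longleftrightarrow> x \<in> L"
  using add_mem_iff[of "- y" x] by simp

lemma summable_cube_subset: "A \<subseteq> L \<Longrightarrow> (\<lambda>\<omega>. C / (1 + norm \<omega>) ^ 3) summable_on A"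
  using summable_on_cmult_right[OF summable_on_subset[OF summable_cube], of A C] by simp

text \<open>
  Infinitely many points of a ball would contribute infinitely many terms bounded away from zero.
\<close>

lemma finite_in_cball: "finite (L \<inter> cball 0 R)"
proof (rule ccontr)
  assume inf: "infinite (L \<inter> cball 0 R)"
  then have "R \<ge> 0" by (metis cball_empty finite.emptyI inf_bot_right linorder_not_less)
  have "(\<lambda>_. 1 / (1 + R) ^ 3) summable_on (L \<inter> cball 0 R)"
  proof (rule summable_on_comparison_test[OF summable_cube_subset[of "L \<inter> cball 0 R" 1]])
    show "1 / (1 + R) ^ 3 \<le> 1 / (1 + norm \<omega>) ^ 3" if "\<omega> \<in> L \<inter> cball 0 R" for \<omega>
      using that \<open>R \<ge> 0\<close>
      by (intro divide_left_mono power_mono mult_pos_pos zero_less_power) (auto simp: add_pos_nonneg)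
  qed (use \<open>R \<ge> 0\<close> in auto)
  then show False
    using infsum_diverge_constant[OF inf, of "1 / (1 + R) ^ 3"] \<open>R \<ge> 0\<close> by simp
qed

lemma finite_in_cball': "A \<subseteq> L \<Longrightarrow> finite (A \<inter> cball z R)"
proof (rule finite_subset[OF _ finite_in_cball[of "norm z + R"]])
  show "A \<inter> cball z R \<subseteq> L \<inter> cball 0 (norm z + R)" if "A \<subseteq> L"
  proof
    fix x assume "x \<in> A \<inter> cball z R"
    then show "x \<in> L \<inter> cball 0 (norm z + R)"
      using that norm_triangle_sub[of x z] by (auto simp: dist_norm norm_minus_commute)
  qed
qed

lemma closed_subset: assumes "A \<subseteq> L" shows "closed A"
  unfolding closed_limpt
proof (intro allI impI)
  fix x assume "x islimpt A"
  then have "infinite (A \<inter> cball x 1)"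
    by (auto simp: islimpt_eq_infinite_cball)
  with finite_in_cball'[OF assms] show "x \<in> A" by blast
qed

text \<open>
  One constant serves for the points of \<open>A\<close> near \<open>z\<^sub>0\<close>, where the distance to the closed set \<open>A\<close> is used,
  and for the distant ones, where \<open>norm (w - \<omega>)\<close> is comparable to \<open>norm \<omega>\<close>. It dominates all the series
  by multiples of the one in the definition of the locale.
\<close>

lemma separation:
  assumes A: "A \<subseteq> L" and z: "z0 \<notin> A"
  shows "\<exists>d>0. \<exists>c>0. cball z0 d \<subseteq> - A \<and>
    (\<forall>w\<in>cball z0 d. \<forall>\<omega>\<in>A. norm (w - \<omega>) \<ge> c * (1 + norm \<omega>))"
proof -
  have "open (- A)" using closed_subset[OF A] by auto
  then obtain e where e: "e > 0" "cball z0 e \<subseteq> - A" using z open_contains_cball by blast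
  define d R where "d = e / 2" and "R = norm z0 + d"
  define c where "c = min (1 / 2) (d / (2 * R + 2))"
  have d: "d > 0" and R: "R > 0" using e by (auto simp: d_def R_def add_nonneg_pos)
  have c: "c > 0" "c \<le> 1 / 2" "c \<le> d / (2 * R + 2)" using d R by (simp add: c_def, simp only: c_def min.cobounded1, simp only: c_def min.cobounded2)
  have "norm (w - \<omega>) \<ge> c * (1 + norm \<omega>)" if w: "w \<in> cball z0 d" and \<omega>: "\<omega> \<in> A" for w \<omega>
  proof (cases "norm \<omega> \<ge> 2 * R + 1")
    case True
    have "norm w \<le> R" using w norm_triangle_sub[of w z0] by (auto simp: R_def dist_norm norm_minus_commute)
    then have "norm (w - \<omega>) \<ge> norm \<omega> - R"
      using norm_triangle_ineq2[of \<omega> w] by (simp add: norm_minus_commute)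
    also have "norm \<omega> - R \<ge> 1 / 2 * (1 + norm \<omega>)" using True by simp
    also have "1 / 2 * (1 + norm \<omega>) \<ge> c * (1 + norm \<omega>)" using c by (intro mult_right_mono) auto
    finally show ?thesis by simp
  next
    case False
    have "dist z0 \<omega> > e" using \<omega> e(2) by (meson ComplD linorder_not_less mem_cball subsetD)
    then have "norm (w - \<omega>) \<ge> d"
      using w dist_triangle[of z0 \<omega> w] by (simp add: d_def dist_norm)
    also have "d = d / (2 * R + 2) * (2 * R + 2)" using R by simp
    also have "\<dots> \<ge> c * (1 + norm \<omega>)" using False c R d by (intro mult_mono) auto
    finally show ?thesis by simp
  qed
  moreover have "cball z0 d \<subseteq> - A"
    using e by (intro order_trans[OF subset_cball[of d e z0] e(2)]) (simp add: d_def)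
  ultimately show ?thesis using d c(1) by blast
qed

lemma eis_term_bound:
  fixes w \<omega> :: complex
  assumes "k \<ge> 3" "c > 0" "norm (w - \<omega>) \<ge> c * (1 + norm \<omega>)"
  shows "norm (1 / (w - \<omega>) ^ k) \<le> (1 / c ^ k) / (1 + norm \<omega>) ^ 3"
proof -
  have "norm (1 / (w - \<omega>) ^ k) = 1 / norm (w - \<omega>) ^ k"
    by (simp add: norm_divide norm_power)
  also have "\<dots> \<le> 1 / (c * (1 + norm \<omega>)) ^ k"
  proof -
    have "c * (1 + norm \<omega>) > 0" using assms(2) by (simp add: add_pos_nonneg)
    then show ?thesis
      using assms(3) by (intro divide_left_mono power_mono mult_pos_pos[of "norm _ ^ k" "_ ^ k"] zero_less_power) linarith+
  qed
  also have "\<dots> = (1 / c ^ k) / (1 + norm \<omega>) ^ k" by (simp add: power_mult_distrib)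
  also have "\<dots> \<le> (1 / c ^ k) / (1 + norm \<omega>) ^ 3"
    using assms by (intro divide_left_mono power_increasing mult_pos_pos zero_less_power)
      (auto simp: add_pos_nonneg)
  finally show ?thesis .
qed

lemma eis_sum_norm_summable:
  assumes "A \<subseteq> L" "k \<ge> 3" "z \<notin> A"
  shows "(\<lambda>\<omega>. norm (1 / (z - \<omega>) ^ k)) summable_on A"
proof -
  obtain d c where *: "d > 0" "c > 0" "cball z d \<subseteq> - A"
      "\<And>w \<omega>. w \<in> cball z d \<Longrightarrow> \<omega> \<in> A \<Longrightarrow> norm (w - \<omega>) \<ge> c * (1 + norm \<omega>)"
    using separation[OF assms(1,3)] by blast
  then show ?thesis
    by (intro summable_on_comparison_test[OF summable_cube_subset[OF assms(1), of "1 / c ^ k"]]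
        eis_term_bound assms) auto
qed

lemma eis_sum_summable:
  assumes "A \<subseteq> L" "k \<ge> 3" "z \<notin> A"
  shows "(\<lambda>\<omega>. 1 / (z - \<omega>) ^ k) summable_on A"
  by (rule abs_summable_summable[OF eis_sum_norm_summable[OF assms]])

lemma eisenstein_summable:
  assumes "k \<ge> 3"
  shows "(\<lambda>\<omega>. 1 / \<omega> ^ k) summable_on L"
proof -
  have "(\<lambda>\<omega>. norm (1 / (0 - \<omega>) ^ k)) summable_on L - {0}"
    using assms by (intro eis_sum_norm_summable) auto
  also have "?this \<longleftrightarrow> (\<lambda>\<omega>. norm (1 / \<omega> ^ k)) summable_on L"
    using assms by (intro summable_on_cong_neutral) (auto simp: norm_divide norm_power)
  finally show ?thesis by (rule abs_summable_summable)
qed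

lemma eis_sum_has_field_derivative:
  assumes A: "A \<subseteq> L" and k: "k \<ge> 3" and z: "z \<notin> A"
  shows "(eis_sum A k has_field_derivative - of_nat k * eis_sum A (Suc k) z) (at z)"
proof -
  have op: "open (- A)" using closed_subset[OF A] by auto
  have hol: "(\<lambda>z. 1 / (z - \<omega>) ^ k) holomorphic_on - A" if "\<omega> \<in> A" for \<omega>
    using that by (intro holomorphic_intros) auto
  have bnd: "\<exists>d>0. \<exists>M. cball z d \<subseteq> - A \<and> M summable_on A \<and>
      (\<forall>\<omega>\<in>A. \<forall>w\<in>cball z d. norm (1 / (w - \<omega>) ^ k) \<le> M \<omega>)" if zA: "z \<in> - A" for z
  proof -
    obtain d c where *: "d > 0" "c > 0" "cball z d \<subseteq> - A"
        "\<And>w \<omega>. w \<in> cball z d \<Longrightarrow> \<omega> \<in> A \<Longrightarrow> norm (w - \<omega>) \<ge> c * (1 + norm \<omega>)"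
      using separation[OF A ComplD[OF zA]] by blast
    then show ?thesis
      by (intro exI[of _ d] conjI exI[of _ "\<lambda>\<omega>. (1 / c ^ k) / (1 + norm \<omega>) ^ 3"]
          summable_cube_subset A ballI eis_term_bound k) auto
  qed
  have deriv: "deriv (\<lambda>z. 1 / (z - \<omega>) ^ k) z = - of_nat k * (1 / (z - \<omega>) ^ Suc k)" if "\<omega> \<in> A" for \<omega>
  proof -
    have "z \<noteq> \<omega>" using that z by auto
    from DERIV_imp_deriv[OF inverse_power_has_field_derivative[OF this]] show ?thesis by simp
  qed
  have "((\<lambda>\<omega>. deriv (\<lambda>z. 1 / (z - \<omega>) ^ k) z) has_sum deriv (eis_sum A k) z) A"
    using infsum_holomorphic(2)[OF op hol bnd] z unfolding eis_sum_def[abs_def] by simp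
  then have "((\<lambda>\<omega>. - of_nat k * (1 / (z - \<omega>) ^ Suc k)) has_sum deriv (eis_sum A k) z) A"
    by (subst has_sum_cong[OF deriv, symmetric])
  moreover have "((\<lambda>\<omega>. - of_nat k * (1 / (z - \<omega>) ^ Suc k)) has_sum - of_nat k * eis_sum A (Suc k) z) A"
    unfolding eis_sum_def using A k z
    by (intro has_sum_cmult_right has_sum_infsum eis_sum_summable) auto
  ultimately have "deriv (eis_sum A k) z = - of_nat k * eis_sum A (Suc k) z"
    by (rule has_sum_unique)
  moreover have h: "eis_sum A k holomorphic_on - A"
    using infsum_holomorphic(1)[OF op hol bnd] unfolding eis_sum_def[abs_def] by simp
  ultimately show ?thesis using holomorphic_derivI[OF h op, of z] z by simp
qed

lemma wp_sum_bound:
  assumes A: "A \<subseteq> L" and z: "z \<notin> A"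
  shows "\<exists>d>0. \<exists>M. cball z d \<subseteq> - A \<and> M summable_on A \<and>
    (\<forall>\<omega>\<in>A. \<forall>w\<in>cball z d. norm (1 / (w - \<omega>)\<^sup>2 - 1 / \<omega>\<^sup>2) \<le> M \<omega>)"
proof -
  obtain d c where d: "d > 0" "c > 0" "cball z d \<subseteq> - A"
      "\<And>w \<omega>. w \<in> cball z d \<Longrightarrow> \<omega> \<in> A \<Longrightarrow> norm (w - \<omega>) \<ge> c * (1 + norm \<omega>)"
    using separation[OF A z] by blast
  obtain d' c' where d': "d' > 0" "c' > 0" "cball 0 d' \<subseteq> - (L - {0})"
      "\<And>w \<omega>. w \<in> cball 0 d' \<Longrightarrow> \<omega> \<in> L - {0} \<Longrightarrow> norm (w - \<omega>) \<ge> c' * (1 + norm \<omega>)"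
    using separation[of "L - {0}" 0] by blast
  define c'' where "c'' = min c c'"
  have c'': "c'' > 0" "c'' \<le> c" "c'' \<le> c'" using d d' by (auto simp: c''_def)
  define C where "C = 2 * (norm z + d) / c'' ^ 3 + 1 / c ^ 2"
  have "norm (1 / (w - \<omega>)\<^sup>2 - 1 / \<omega>\<^sup>2) \<le> C / (1 + norm \<omega>) ^ 3"
    if w: "w \<in> cball z d" and \<omega>: "\<omega> \<in> A" for w \<omega>
  proof (cases "\<omega> = 0")
    case True
    have "norm w \<ge> c" using d(4)[OF w \<omega>] True by simp
    then have "1 / norm w ^ 2 \<le> 1 / c ^ 2"
      using d(2) by (intro divide_left_mono power_mono mult_pos_pos zero_less_power) auto
    moreover have "2 * (norm z + d) / c'' ^ 3 \<ge> 0" using c'' d by simp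
    ultimately show ?thesis using True by (simp add: C_def norm_divide norm_power)
  next
    case False
    have nz: "norm (w - \<omega>) \<ge> c'' * (1 + norm \<omega>)"
      using d(4)[OF w \<omega>] mult_right_mono[OF c''(2), of "1 + norm \<omega>"] by simp
    have no: "norm \<omega> \<ge> c'' * (1 + norm \<omega>)"
      using d'(4)[of 0 \<omega>] A \<omega> False d'(1) mult_right_mono[OF c''(3), of "1 + norm \<omega>"] by auto
    have "norm (1 / (w - \<omega>)\<^sup>2 - 1 / \<omega>\<^sup>2) \<le> 2 * norm w / c'' ^ 3 / (1 + norm \<omega>) ^ 3"
      by (intro wp_term_bound c'' nz no) (auto simp: add_pos_nonneg)
    also have "\<dots> \<le> C / (1 + norm \<omega>) ^ 3"
    proof -
      have "norm w \<le> norm z + d"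
        using w norm_triangle_sub[of w z] by (auto simp: dist_norm norm_minus_commute)
      then have "2 * norm w / c'' ^ 3 \<le> 2 * (norm z + d) / c'' ^ 3"
        using c'' by (intro divide_right_mono) auto
      then have "2 * norm w / c'' ^ 3 \<le> C" by (simp add: C_def add_increasing2)
      then show ?thesis by (rule divide_right_mono) (simp add: add_nonneg_nonneg)
    qed
    finally show ?thesis .
  qed
  then show ?thesis by (intro exI[of _ d] exI[of _ "\<lambda>\<omega>. C / (1 + norm \<omega>) ^ 3"] conjI ballI d(1,3) summable_cube_subset[OF A])
qed

lemma wp_sum_summable:
  assumes A: "A \<subseteq> L" and z: "z \<notin> A"
  shows "(\<lambda>\<omega>. 1 / (z - \<omega>)\<^sup>2 - 1 / \<omega>\<^sup>2) summable_on A"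
proof -
  obtain d M where "d > 0" "cball z d \<subseteq> - A" "M summable_on A"
    "\<And>w \<omega>. w \<in> cball z d \<Longrightarrow> \<omega> \<in> A \<Longrightarrow> norm (1 / (w - \<omega>)\<^sup>2 - 1 / \<omega>\<^sup>2) \<le> M \<omega>"
    using wp_sum_bound[OF A z] by blast
  then show ?thesis
    by (intro abs_summable_summable[OF summable_on_comparison_test[OF \<open>M summable_on A\<close>]]) auto
qed

lemma wp_sum_has_field_derivative:
  assumes A: "A \<subseteq> L" and z: "z \<notin> A"
  shows "(wp_sum A has_field_derivative - 2 * eis_sum A 3 z) (at z)"
proof -
  have op: "open (- A)" using closed_subset[OF A] by auto
  have hol: "(\<lambda>z. 1 / (z - \<omega>)\<^sup>2 - 1 / \<omega>\<^sup>2) holomorphic_on - A" if "\<omega> \<in> A" for \<omega>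
    using that by (intro holomorphic_intros) auto
  have bnd: "\<exists>d>0. \<exists>M. cball z d \<subseteq> - A \<and> M summable_on A \<and>
      (\<forall>\<omega>\<in>A. \<forall>w\<in>cball z d. norm (1 / (w - \<omega>)\<^sup>2 - 1 / \<omega>\<^sup>2) \<le> M \<omega>)" if zA: "z \<in> - A" for z
    by (rule wp_sum_bound[OF A ComplD[OF zA]])
  have deriv: "deriv (\<lambda>z. 1 / (z - \<omega>)\<^sup>2 - 1 / \<omega>\<^sup>2) z = - 2 * (1 / (z - \<omega>) ^ 3)" if "\<omega> \<in> A" for \<omega>
  proof -
    have "z \<noteq> \<omega>" using that z by auto
    from DERIV_diff[OF inverse_power_has_field_derivative[OF this, of 2] DERIV_const]
    show ?thesis by (simp add: DERIV_imp_deriv numeral_3_eq_3)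
  qed
  have "((\<lambda>\<omega>. deriv (\<lambda>z. 1 / (z - \<omega>)\<^sup>2 - 1 / \<omega>\<^sup>2) z) has_sum deriv (wp_sum A) z) A"
    using infsum_holomorphic(2)[OF op hol bnd] z unfolding wp_sum_def[abs_def] by simp
  then have "((\<lambda>\<omega>. - 2 * (1 / (z - \<omega>) ^ 3)) has_sum deriv (wp_sum A) z) A"
    by (subst has_sum_cong[OF deriv, symmetric])
  moreover have "((\<lambda>\<omega>. - 2 * (1 / (z - \<omega>) ^ 3)) has_sum - 2 * eis_sum A 3 z) A"
    unfolding eis_sum_def using A z
    by (intro has_sum_cmult_right has_sum_infsum eis_sum_summable) auto
  ultimately have "deriv (wp_sum A) z = - 2 * eis_sum A 3 z"
    by (rule has_sum_unique)
  moreover have h: "wp_sum A holomorphic_on - A"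
    using infsum_holomorphic(1)[OF op hol bnd] unfolding wp_sum_def[abs_def] by simp
  ultimately show ?thesis using holomorphic_derivI[OF h op, of z] z by simp
qed

end

lemma inverse_power_minus: "1 / (- u) ^ k = (- 1) ^ k * (1 / u ^ k)" for u :: complex
  by (cases "even k") auto

section \<open>Periodicity and Taylor expansion\<close>

context discrete_subgroup
begin

lemma wp_sum_singular_part:
  assumes "z \<notin> L"
  shows "wp_sum L z = 1 / z\<^sup>2 + wp_sum (L - {0}) z"
proof -
  have "wp_sum L z = wp_sum (insert 0 (L - {0})) z" by (simp add: insert_absorb)
  also have "\<dots> = (1 / (z - 0)\<^sup>2 - 1 / 0\<^sup>2) + wp_sum (L - {0}) z"
    unfolding wp_sum_def using assms by (intro infsum_insert wp_sum_summable) auto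
  finally show ?thesis by simp
qed

lemma weierstrass_p_eq: "z \<notin> L \<Longrightarrow> weierstrass_p z L = wp_sum L z"
  by (subst wp_sum_singular_part) (simp_all add: weierstrass_p_def wp_sum_def)

lemma eis_sum_singular_part:
  assumes "z \<notin> L" "k \<ge> 3"
  shows "eis_sum L k z = 1 / z ^ k + eis_sum (L - {0}) k z"
proof -
  have "eis_sum L k z = eis_sum (insert 0 (L - {0})) k z" by (simp add: insert_absorb)
  also have "\<dots> = 1 / (z - 0) ^ k + eis_sum (L - {0}) k z"
    unfolding eis_sum_def using assms by (intro infsum_insert eis_sum_summable) auto
  finally show ?thesis by simp
qed

lemma eis_sum_periodic: "\<omega> \<in> L \<Longrightarrow> eis_sum L k (z + \<omega>) = eis_sum L k z"
  unfolding eis_sum_def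
  by (rule infsum_reindex_bij_witness[of _ "\<lambda>\<eta>. \<eta> + \<omega>" "\<lambda>\<eta>. \<eta> - \<omega>"])
     (auto simp: diff_mem_iff add_mem_iff algebra_simps)

lemma eis_sum_minus: "eis_sum L k (- z) = (- 1) ^ k * eis_sum L k z"
proof -
  have "eis_sum L k (- z) = (\<Sum>\<^sub>\<infinity>\<omega>\<in>L. (- 1) ^ k * (1 / (z - \<omega>) ^ k))"
    unfolding eis_sum_def
  proof (rule infsum_reindex_bij_witness[of _ uminus uminus])
    show "(- 1) ^ k * (1 / (z - - \<omega>) ^ k) = 1 / (- z - \<omega>) ^ k" for \<omega>
      using inverse_power_minus[of "z + \<omega>" k] by simp
  qed (auto simp: uminus_mem)
  also have "\<dots> = (- 1) ^ k * eis_sum L k z"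
    unfolding eis_sum_def by (rule infsum_cmult_right')
  finally show ?thesis .
qed

lemma wp_sum_minus: "wp_sum L (- z) = wp_sum L z"
  unfolding wp_sum_def
  by (rule infsum_reindex_bij_witness[of _ uminus uminus])
     (auto simp: uminus_mem power2_commute add.commute)

lemma eisenstein_odd: "odd k \<Longrightarrow> eisenstein L k = 0"
  using eis_sum_minus[of k 0] by (simp add: eis_sum_def eisenstein_def infsum_uminus)

lemma countable_L: "countable L"
proof -
  have "L = (\<Union>n::nat. L \<inter> cball 0 (of_nat n))"
    by (auto simp: real_arch_simple)
  then show ?thesis
    by (metis countable_UN countableI_type countable_finite finite_in_cball)
qed

lemma connected_compl: "connected (- L)" and open_compl: "open (- L)"
proof -
  have "connected (UNIV - L)"
    by (rule connected_open_diff_countable) (auto simp: countable_L)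
  then show "connected (- L)" by (simp add: Compl_eq_Diff_UNIV)
  show "open (- L)" using closed_subset[of L] by auto
qed

text \<open>
  The squares \<open>1/(z - \<omega>)\<^sup>2\<close> alone need not be summable, so the translation is not carried out termwise.
  As the derivative is periodic, translation by \<open>\<omega>\<close> adds a constant, and parity makes that constant vanish.
\<close>

lemma wp_sum_periodic:
  assumes \<omega>: "\<omega> \<in> L" and z: "z \<notin> L"
  shows "wp_sum L (z + \<omega>) = wp_sum L z"
proof -
  have *: "\<exists>c. \<forall>z\<in>-L. wp_sum L (z + \<eta>) - wp_sum L z = c" if "\<eta> \<in> L" for \<eta>
  proof -
    have "((\<lambda>z. wp_sum L (z + \<eta>) - wp_sum L z) has_field_derivative 0) (at z)" if "z \<in> - L" for z
    proof -
      have "((\<lambda>z. wp_sum L (z + \<eta>) - wp_sum L z) has_field_derivative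
              - 2 * eis_sum L 3 (z + \<eta>) - (- 2 * eis_sum L 3 z)) (at z)"
        using that wp_sum_has_field_derivative[of L "z + \<eta>"] \<open>\<eta> \<in> L\<close>
        by (intro DERIV_diff wp_sum_has_field_derivative)
           (simp_all only: DERIV_shift[symmetric] add_mem_iff order_refl Compl_iff simp_thms)
      then show ?thesis using \<open>\<eta> \<in> L\<close> by (simp add: eis_sum_periodic)
    qed
    then have "(\<lambda>z. wp_sum L (z + \<eta>) - wp_sum L z) constant_on - L"
      by (rule has_field_derivative_0_imp_constant_on) (auto intro: connected_compl open_compl)
    then show ?thesis by (auto simp: constant_on_def)
  qed
  obtain c where c: "\<And>z. z \<notin> L \<Longrightarrow> wp_sum L (z + \<omega>) - wp_sum L z = c"
    using *[OF \<omega>] by auto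
  \<comment> \<open>the translation constant of \<open>- \<omega>\<close> is both \<open>- c\<close> and, as the sum is even, \<open>c\<close>\<close>
  have "wp_sum L (z - \<omega>) - wp_sum L z = c"
    using c[of "- z"] z wp_sum_minus[of z] wp_sum_minus[of "z - \<omega>"] by (simp add: add.commute)
  moreover have "wp_sum L z - wp_sum L (z - \<omega>) = c"
    using c[of "z - \<omega>"] z \<omega> by (simp add: diff_mem_iff)
  ultimately have "c = 0" by (simp add: algebra_simps eq_neg_iff_add_eq_0)
  then show ?thesis using c[OF z] by simp
qed

lemma higher_deriv_wp_sum:
  assumes A: "A \<subseteq> L" and z: "z \<notin> A"
  shows "(deriv ^^ Suc n) (wp_sum A) z = (- 1) ^ Suc n * fact (n + 2) * eis_sum A (n + 3) z"
  using z
proof (induction n arbitrary: z)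
  case 0
  then show ?case
    using DERIV_imp_deriv[OF wp_sum_has_field_derivative[OF A]] by simp
next
  case (Suc n)
  have "open (- A)" using closed_subset[OF A] by auto
  then have "\<forall>\<^sub>F w in nhds z. w \<in> - A" using Suc.prems by (intro eventually_nhds_in_open) auto
  then have ev: "\<forall>\<^sub>F w in nhds z. (deriv ^^ Suc n) (wp_sum A) w =
      (- 1) ^ Suc n * fact (n + 2) * eis_sum A (n + 3) w"
    by eventually_elim (use Suc.IH in auto)
  have "(deriv ^^ Suc (Suc n)) (wp_sum A) z =
      deriv (\<lambda>w. (- 1) ^ Suc n * fact (n + 2) * eis_sum A (n + 3) w) z"
    using deriv_cong_ev[OF ev refl] by simp
  also have "\<dots> = (- 1) ^ Suc n * fact (n + 2) * (- of_nat (n + 3) * eis_sum A (Suc (n + 3)) z)"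
    by (intro DERIV_imp_deriv DERIV_cmult eis_sum_has_field_derivative A) (use Suc.prems in auto)
  also have "\<dots> = (- 1) ^ Suc (Suc n) * fact (Suc n + 2) * eis_sum A (Suc n + 3) z"
    by (simp add: fact_reduce algebra_simps)
  finally show ?case .
qed

text \<open>
  The Taylor series \<open>\<Sum>\<^sub>n (n + 1) G\<^bsub>n+2\<^esub> z\<^sup>n\<close> of \<open>\<wp>(z) - 1/z\<^sup>2\<close>; its constant term is zero because of the
  terms \<open>1/\<omega>\<^sup>2\<close> subtracted in the definition of \<open>\<wp>\<close>.
\<close>

definition wp_fps :: "complex fps" where
  "wp_fps = Abs_fps (\<lambda>n. if n = 0 then 0 else of_nat (n + 1) * eisenstein L (n + 2))"

lemma wp_sum_has_fps_expansion: "wp_sum (L - {0}) has_fps_expansion wp_fps"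
proof -
  let ?R = "wp_sum (L - {0})"
  have op: "open (- (L - {0}))" by (intro open_Compl closed_subset) auto
  have "?R holomorphic_on - (L - {0})"
    using wp_sum_has_field_derivative[of "L - {0}"] op
    by (auto simp: holomorphic_on_open)
  then have "?R analytic_on {0}"
    using op by (auto simp: analytic_at)
  then have "?R has_fps_expansion fps_expansion ?R 0"
    by (rule analytic_at_imp_has_fps_expansion_0)
  also have "fps_expansion ?R 0 = wp_fps"
  proof (rule fps_ext)
    fix n
    show "fps_nth (fps_expansion ?R 0) n = fps_nth wp_fps n"
    proof (cases n)
      case 0
      then show ?thesis by (simp add: fps_expansion_def wp_fps_def wp_sum_def)
    next
      case (Suc m)
      have "eis_sum (L - {0}) (m + 3) 0 = eis_sum L (m + 3) 0"
        unfolding eis_sum_def by (rule infsum_cong_neutral) auto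
      also have "\<dots> = (- 1) ^ (m + 3) * (\<Sum>\<^sub>\<infinity>\<omega>\<in>L. 1 / \<omega> ^ (m + 3))"
        unfolding eis_sum_def infsum_cmult_right'[symmetric]
        by (intro infsum_cong) (simp only: diff_0 inverse_power_minus)
      finally have *: "eis_sum (L - {0}) (m + 3) 0 = (- 1) ^ (m + 3) * eisenstein L (m + 3)"
        by (simp add: eisenstein_def)
      have "fps_nth (fps_expansion ?R 0) n = (deriv ^^ Suc m) ?R 0 / fact (Suc m)"
        by (simp add: fps_expansion_def Suc del: funpow.simps)
      also have "\<dots> = ((- 1) ^ Suc m * (- 1) ^ (m + 3)) * (fact (m + 2) / fact (Suc m)) * eisenstein L (m + 3)"
        by (subst higher_deriv_wp_sum) (auto simp: *)
      also have "(fact (m + 2) / fact (Suc m) :: complex) = of_nat (m + 2)"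
      proof -
        have "(fact (m + 2) :: complex) = of_nat (m + 2) * fact (Suc m)"
          using fact_Suc[of "Suc m"] by (simp del: fact_Suc add: add.assoc[symmetric])
        then show ?thesis by (simp del: fact_Suc)
      qed
      also have "((- 1) ^ Suc m * (- 1) ^ (m + 3) :: complex) = 1"
        by (simp flip: power_add)
      finally show ?thesis by (simp add: wp_fps_def Suc algebra_simps numeral_3_eq_3)
    qed
  qed
  finally show ?thesis .
qed

lemma eventually_not_mem: "\<forall>\<^sub>F z in at 0. z \<notin> L"
proof -
  have "open (- (L - {0}))" by (intro open_Compl closed_subset) auto
  from eventually_nhds_in_open[OF this, of 0] show ?thesis
    by (auto simp: eventually_at_filter elim!: eventually_mono)
qed

lemma wp_fps_nth:
  "fps_nth wp_fps 0 = 0" "fps_nth wp_fps 1 = 0" "fps_nth wp_fps (Suc 0) = 0"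
  "fps_nth wp_fps 2 = 3 * eisenstein L 4" "fps_nth wp_fps (Suc (Suc 0)) = 3 * eisenstein L 4"
  "fps_nth wp_fps 3 = 0" "fps_nth wp_fps 4 = 5 * eisenstein L 6" "fps_nth wp_fps 5 = 0"
  "fps_nth wp_fps 6 = 7 * eisenstein L 8"
proof -
  have odd: "eisenstein L 3 = 0" "eisenstein L 5 = 0" "eisenstein L 7 = 0"
    by (simp_all add: eisenstein_odd)
  show "fps_nth wp_fps 0 = 0" "fps_nth wp_fps 1 = 0" "fps_nth wp_fps (Suc 0) = 0"
    "fps_nth wp_fps 2 = 3 * eisenstein L 4" "fps_nth wp_fps (Suc (Suc 0)) = 3 * eisenstein L 4"
    "fps_nth wp_fps 3 = 0" "fps_nth wp_fps 4 = 5 * eisenstein L 6" "fps_nth wp_fps 5 = 0"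
    "fps_nth wp_fps 6 = 7 * eisenstein L 8"
    using odd by (simp_all add: wp_fps_def numeral_eq_Suc)
qed

lemma wp_fps_square_nth:
  "fps_nth (wp_fps * wp_fps) 2 = 0" "fps_nth (wp_fps * wp_fps) 4 = 9 * (eisenstein L 4)\<^sup>2"
proof -
  have "{0..2::nat} = {0, 1, 2}" "{0..4::nat} = {0, 1, 2, 3, 4}" by auto
  then show "fps_nth (wp_fps * wp_fps) 2 = 0" "fps_nth (wp_fps * wp_fps) 4 = 9 * (eisenstein L 4)\<^sup>2"
    by (simp_all add: fps_mult_nth wp_fps_nth power2_eq_square)
qed

end

text \<open>
  Limits at a pole of order \<open>m\<close> whose polar part cancels are read off from the Taylor series of the
  function multiplied by \<open>z\<^sup>m\<close>.
\<close>

lemma tendsto_at_0_of_fps: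
  fixes f g :: "complex \<Rightarrow> complex"
  assumes g: "g has_fps_expansion H" and zero: "\<And>i. i < m \<Longrightarrow> fps_nth H i = 0"
    and eq: "\<forall>\<^sub>F z in at 0. g z = z ^ m * f z"
  shows "(f \<longlongrightarrow> fps_nth H m) (at 0)"
proof -
  have "(\<lambda>z. if z = 0 then fps_nth H m else g z / z ^ m) has_fps_expansion fps_shift m H"
  proof (cases "H = 0")
    case False
    then have "m \<le> subdegree H" using zero by (intro subdegree_geI) auto
    then show ?thesis by (intro has_fps_expansion_shift g) auto
  next
    case True
    then have "\<forall>\<^sub>F z in nhds 0. g z = 0" using g by (auto simp: has_fps_expansion_def)
    then have "\<forall>\<^sub>F z in nhds 0. (if z = 0 then fps_nth H m else g z / z ^ m) = 0"
      by eventually_elim (auto simp: True)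
    then show ?thesis using True by (auto simp: has_fps_expansion_def elim!: eventually_mono)
  qed
  then have "isCont (\<lambda>z. if z = 0 then fps_nth H m else g z / z ^ m) 0"
    by (rule has_fps_expansion_imp_continuous)
  then have "((\<lambda>z. if z = 0 then fps_nth H m else g z / z ^ m) \<longlongrightarrow> fps_nth H m) (at 0)"
    by (simp add: isCont_def)
  moreover have "\<forall>\<^sub>F z in at 0. (if z = 0 then fps_nth H m else g z / z ^ m) = f z"
    using eq eventually_at_filter[of "\<lambda>z. z \<noteq> 0" 0 UNIV]
    by (auto simp: eventually_at_filter elim!: eventually_mono)
  ultimately show ?thesis by (rule Lim_transform_eventually)
qed

section \<open>The differential equations of the Weierstrass function\<close>

locale lattice = discrete_subgroup +
  assumes cocompact: "\<exists>R. \<forall>z. \<exists>\<omega>\<in>L. norm (z - \<omega>) \<le> R"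
begin

text \<open>
  An elliptic function without poles is constant: filling in the limit at the lattice points makes it
  entire, and it is bounded because its values are taken on a compact set.
\<close>

lemma periodic_constant:
  assumes hol: "f holomorphic_on - L" and per: "\<And>z \<omega>. z \<notin> L \<Longrightarrow> \<omega> \<in> L \<Longrightarrow> f (z + \<omega>) = f z"
    and lim: "(f \<longlongrightarrow> c) (at 0)" and z: "z \<notin> L"
  shows "f z = c"
proof -
  define F where "F z = (if z \<in> L then c else f z)" for z
  have Fper: "F (z + \<omega>) = F z" if "\<omega> \<in> L" for z \<omega>
    using that per by (auto simp: F_def add_mem_iff)
  have holF': "F holomorphic_on - L"
    using hol by (rule holomorphic_transform) (auto simp: F_def)
  have lim0: "(F \<longlongrightarrow> F 0) (at 0)"
  proof -
    have op: "open (- (L - {0}))" by (intro open_Compl closed_subset) auto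
    then have "\<forall>\<^sub>F z in at 0. f z = F z"
      using eventually_nhds_in_open[OF op, of 0]
      by (auto simp: eventually_at_filter F_def elim!: eventually_mono)
    then show ?thesis using lim by (simp add: F_def Lim_transform_eventually)
  qed
  have lim\<omega>: "(F \<longlongrightarrow> F \<omega>) (at \<omega>)" if "\<omega> \<in> L" for \<omega>
  proof -
    have "((\<lambda>z. F (z + \<omega>)) \<longlongrightarrow> F \<omega>) (at 0)"
      using lim0 Fper[OF that] Fper[OF that, of 0] by simp
    then show ?thesis by (subst at_to_0) (simp add: filterlim_filtermap)
  qed
  have holF: "F holomorphic_on ball x 1" for x
  proof (rule no_isolated_singularity')
    show "(F \<longlongrightarrow> F z) (at z within ball x 1)" if "z \<in> L \<inter> ball x 1" for z
      using lim\<omega>[of z] that by (auto intro: tendsto_within_subset)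
    show "F holomorphic_on ball x 1 - L \<inter> ball x 1"
      using holF' by (rule holomorphic_on_subset) auto
    show "finite (L \<inter> ball x 1)"
      by (rule finite_subset[OF _ finite_in_cball'[of L x 1]]) auto
  qed auto
  have "F holomorphic_on UNIV"
    using holomorphic_on_imp_differentiable_at[OF holF open_ball centre_in_ball[THEN iffD2]]
    by (simp add: holomorphic_on_def)
  moreover have "bounded (range F)"
  proof -
    obtain R where R: "\<And>z. \<exists>\<omega>\<in>L. norm (z - \<omega>) \<le> R" using cocompact by blast
    have "continuous_on (cball 0 R) F"
      using \<open>F holomorphic_on UNIV\<close> holomorphic_on_imp_continuous_on continuous_on_subset by blast
    then have "bounded (F ` cball 0 R)"
      by (intro compact_imp_bounded compact_continuous_image) auto
    moreover have "range F \<subseteq> F ` cball 0 R"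
    proof
      fix y assume "y \<in> range F"
      then obtain z where y: "y = F z" by auto
      obtain \<omega> where \<omega>: "\<omega> \<in> L" "norm (z - \<omega>) \<le> R" using R by blast
      then have "y = F (z - \<omega>)" using Fper[of \<omega> "z - \<omega>"] y by simp
      then show "y \<in> F ` cball 0 R" using \<omega> by auto
    qed
    ultimately show ?thesis using bounded_subset by blast
  qed
  ultimately have "F constant_on UNIV" by (rule Liouville_theorem)
  then have "F z = F 0" by (auto simp: constant_on_def)
  then show ?thesis using z by (simp add: F_def)
qed

end

context lattice
begin

lemma wp_sum_holomorphic: "wp_sum L holomorphic_on - L"
  using wp_sum_has_field_derivative[of L] open_compl by (auto simp: holomorphic_on_open)

lemma eis_sum_holomorphic: "k \<ge> 3 \<Longrightarrow> eis_sum L k holomorphic_on - L"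
  using eis_sum_has_field_derivative[of L k] open_compl by (auto simp: holomorphic_on_open)

lemma deriv_regular_part:
  assumes "z \<notin> L"
  shows "deriv (wp_sum (L - {0})) z = - 2 * eis_sum (L - {0}) 3 z"
    and "deriv (deriv (wp_sum (L - {0}))) z = 6 * eis_sum (L - {0}) 4 z"
  using higher_deriv_wp_sum[of "L - {0}" z 0] higher_deriv_wp_sum[of "L - {0}" z 1] assms
  by (auto simp: fact_numeral eval_nat_numeral)

text \<open>
  The first equation says \<open>\<wp>'' = 6 \<wp>\<^sup>2 - 30 G\<^sub>4\<close>, since \<open>\<wp>'' = 6 E\<^sub>4\<close> for the sums \<open>E\<^sub>k = \<Sum>\<^sub>\<omega> (z - \<omega>)\<^bsup>-k\<^esup>\<close>.
  The difference of the two sides is elliptic, and with \<open>\<wp> = 1/z\<^sup>2 + R\<close> the Taylor series of \<open>R\<close> shows that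
  its polar part and its constant term at the origin vanish. The coefficient of \<open>z\<^sup>4\<close> in the resulting
  identity is the relation between \<open>G\<^sub>4\<close> and \<open>G\<^sub>8\<close>.
\<close>

lemma wp_second_order_ode:
  shows "z \<notin> L \<Longrightarrow> eis_sum L 4 z = (wp_sum L z)\<^sup>2 - 5 * eisenstein L 4"
    and "7 * eisenstein L 8 = 3 * (eisenstein L 4)\<^sup>2"
proof -
  define R where "R = wp_sum (L - {0})"
  define f where "f z = 6 * eis_sum L 4 z - 6 * (wp_sum L z)\<^sup>2 + 30 * eisenstein L 4" for z
  \<comment> \<open>\<open>g = z\<^sup>2 f\<close>, written without poles, and its Taylor series \<open>H\<close>\<close>
  define g where "g z = z ^ 2 * deriv (deriv R) z - 12 * R z - 6 * (z ^ 2 * (R z * R z)) +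
      30 * eisenstein L 4 * z ^ 2" for z
  define H where "H = fps_X ^ 2 * fps_deriv (fps_deriv wp_fps) - 12 * wp_fps -
      6 * (fps_X ^ 2 * (wp_fps * wp_fps)) + fps_const (30 * eisenstein L 4) * fps_X ^ 2"
  have R: "R has_fps_expansion wp_fps" unfolding R_def by (rule wp_sum_has_fps_expansion)
  have g: "g has_fps_expansion H"
    unfolding g_def H_def by (intro fps_expansion_intros R)
  have eq: "g z = z ^ 2 * f z" if "z \<notin> L" for z
  proof -
    have "z \<noteq> 0" using that by auto
    then show ?thesis
      using that by (simp add: f_def g_def R_def deriv_regular_part wp_sum_singular_part eis_sum_singular_part
          field_simps power2_eq_square power_numeral_reduce)
  qed
  have "(f \<longlongrightarrow> fps_nth H 2) (at 0)"
  proof (rule tendsto_at_0_of_fps[OF g])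
    show "fps_nth H i = 0" if "i < 2" for i
      using that by (auto simp: H_def less_2_cases_iff fps_X_power_mult_nth wp_fps_nth)
    show "\<forall>\<^sub>F z in at 0. g z = z ^ 2 * f z"
      using eventually_not_mem by eventually_elim (rule eq)
  qed
  also have "fps_nth H 2 = 0"
    by (simp add: H_def fps_X_power_mult_nth wp_fps_nth)
  finally have lim: "(f \<longlongrightarrow> 0) (at 0)" .
  have f0: "f z = 0" if "z \<notin> L" for z
  proof (rule periodic_constant[OF _ _ lim that])
    show "f holomorphic_on - L"
      unfolding f_def by (intro holomorphic_intros wp_sum_holomorphic eis_sum_holomorphic) auto
    show "f (z + \<omega>) = f z" if "z \<notin> L" "\<omega> \<in> L" for z \<omega>
      using that by (simp add: f_def eis_sum_periodic wp_sum_periodic)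
  qed
  show "eis_sum L 4 z = (wp_sum L z)\<^sup>2 - 5 * eisenstein L 4" if "z \<notin> L"
  proof -
    have "6 * (eis_sum L 4 z - ((wp_sum L z)\<^sup>2 - 5 * eisenstein L 4)) = 0"
      using f0[OF that] by (simp add: f_def algebra_simps)
    then show ?thesis unfolding mult_eq_0_iff by simp
  qed
  \<comment> \<open>as \<open>f\<close> vanishes off the lattice, so does the whole Taylor series of \<open>g\<close>\<close>
  have "((\<lambda>_. 0) has_fps_expansion H)"
  proof -
    have "\<forall>\<^sub>F z in nhds 0. g z = 0"
      using eventually_not_mem eq f0
      by (auto simp: eventually_at_filter g_def R_def wp_sum_def elim!: eventually_mono)
    then show ?thesis using g has_fps_expansion_cong[of g "\<lambda>_. 0" H H] by simp
  qed
  then have "H = 0" using fps_expansion_unique_complex has_fps_expansion_0 by blast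
  then have "fps_nth H 6 = 0" by simp
  moreover have "fps_nth H 6 = 210 * eisenstein L 8 - 84 * eisenstein L 8 - 54 * (eisenstein L 4)\<^sup>2"
    by (simp add: H_def fps_X_power_mult_nth wp_fps_nth wp_fps_square_nth)
  ultimately have "18 * (7 * eisenstein L 8) = 18 * (3 * (eisenstein L 4)\<^sup>2)" by simp
  then show "7 * eisenstein L 8 = 3 * (eisenstein L 4)\<^sup>2"
    unfolding mult_cancel_left by simp
qed

text \<open>
  This is \<open>\<wp>'\<^sup>2 = 4 \<wp>\<^sup>3 - 60 G\<^sub>4 \<wp> - 140 G\<^sub>6\<close>, as \<open>\<wp>' = -2 E\<^sub>3\<close>; the constant \<open>140 G\<^sub>6\<close> is the limit at the
  origin, found as in the second-order equation.
\<close>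

lemma wp_first_order_ode:
  assumes z: "z \<notin> L"
  shows "(eis_sum L 3 z)\<^sup>2 = wp_sum L z ^ 3 - 15 * eisenstein L 4 * wp_sum L z - 35 * eisenstein L 6"
proof -
  define R where "R = wp_sum (L - {0})"
  define f where "f z = 4 * (eis_sum L 3 z)\<^sup>2 - 4 * wp_sum L z ^ 3 + 60 * eisenstein L 4 * wp_sum L z" for z
  define g where "g z = z ^ 6 * (deriv R z * deriv R z) - 4 * (z ^ 3 * deriv R z) - 12 * (z ^ 2 * R z)
      - 12 * (z ^ 4 * (R z * R z)) - 4 * (z ^ 6 * (R z * (R z * R z)))
      + 60 * eisenstein L 4 * z ^ 4 + 60 * eisenstein L 4 * (z ^ 6 * R z)" for z
  define H where "H = fps_X ^ 6 * (fps_deriv wp_fps * fps_deriv wp_fps) - 4 * (fps_X ^ 3 * fps_deriv wp_fps)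
      - 12 * (fps_X ^ 2 * wp_fps) - 12 * (fps_X ^ 4 * (wp_fps * wp_fps))
      - 4 * (fps_X ^ 6 * (wp_fps * (wp_fps * wp_fps)))
      + fps_const (60 * eisenstein L 4) * fps_X ^ 4 + fps_const (60 * eisenstein L 4) * (fps_X ^ 6 * wp_fps)"
  have R: "R has_fps_expansion wp_fps" unfolding R_def by (rule wp_sum_has_fps_expansion)
  have g: "g has_fps_expansion H"
    unfolding g_def H_def by (intro fps_expansion_intros R)
  have eq: "g z = z ^ 6 * f z" if "z \<notin> L" for z
  proof -
    have nz: "z \<noteq> 0" using that by auto
    have "f z = 4 * (1 / z ^ 3 - deriv R z / 2)\<^sup>2 - 4 * (1 / z\<^sup>2 + R z) ^ 3 + 60 * eisenstein L 4 * (1 / z\<^sup>2 + R z)"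
      using that by (simp add: f_def R_def deriv_regular_part wp_sum_singular_part eis_sum_singular_part)
    also have "z ^ 6 * \<dots> = g z"
      unfolding g_def using nz by (simp add: field_simps power2_eq_square power3_eq_cube power_numeral_reduce)
    finally show ?thesis ..
  qed
  have "(f \<longlongrightarrow> fps_nth H 6) (at 0)"
  proof (rule tendsto_at_0_of_fps[OF g])
    show "fps_nth H i = 0" if "i < 6" for i
    proof -
      have "i = 0 \<or> i = 1 \<or> i = 2 \<or> i = 3 \<or> i = 4 \<or> i = 5" using that by linarith
      then show ?thesis
        by (elim disjE) (simp_all add: H_def fps_X_power_mult_nth wp_fps_nth)
    qed
    show "\<forall>\<^sub>F z in at 0. g z = z ^ 6 * f z"
      using eventually_not_mem by eventually_elim (rule eq)
  qed
  also have "fps_nth H 6 = - 140 * eisenstein L 6"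
    by (simp add: H_def fps_X_power_mult_nth wp_fps_nth wp_fps_square_nth)
  finally have lim: "(f \<longlongrightarrow> - 140 * eisenstein L 6) (at 0)" .
  have "f z = - 140 * eisenstein L 6"
  proof (rule periodic_constant[OF _ _ lim z])
    show "f holomorphic_on - L"
      unfolding f_def by (intro holomorphic_intros wp_sum_holomorphic eis_sum_holomorphic) auto
    show "f (z + \<omega>) = f z" if "z \<notin> L" "\<omega> \<in> L" for z \<omega>
      using that by (simp add: f_def eis_sum_periodic wp_sum_periodic)
  qed
  then have "4 * (eis_sum L 3 z)\<^sup>2 =
      4 * (wp_sum L z ^ 3 - 15 * eisenstein L 4 * wp_sum L z - 35 * eisenstein L 6)"
    by (simp add: f_def algebra_simps)
  then show ?thesis unfolding mult_cancel_left by simp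
qed

text \<open>
  Differentiate \<open>E\<^sub>4 = \<wp>\<^sup>2 - 5 G\<^sub>4\<close> twice, using \<open>E\<^sub>k' = -k E\<^bsub>k+1\<^esub>\<close> and \<open>\<wp>' = -2 E\<^sub>3\<close>.
\<close>

lemma eis_sum_6:
  assumes z: "z \<notin> L"
  shows "eis_sum L 5 z = wp_sum L z * eis_sum L 3 z"
    and "eis_sum L 6 z = wp_sum L z ^ 3 - 9 * eisenstein L 4 * wp_sum L z - 14 * eisenstein L 6"
proof -
  have E5: "eis_sum L 5 z = wp_sum L z * eis_sum L 3 z" if z: "z \<notin> L" for z
  proof -
    have "((\<lambda>z. (wp_sum L z)\<^sup>2 - 5 * eisenstein L 4) has_field_derivative
        2 * wp_sum L z * (- 2 * eis_sum L 3 z)) (at z)"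
      by (auto intro!: derivative_eq_intros wp_sum_has_field_derivative z)
    then have "(eis_sum L 4 has_field_derivative 2 * wp_sum L z * (- 2 * eis_sum L 3 z)) (at z)"
      by (rule has_field_derivative_transform_within_open[OF _ open_compl])
         (use z in \<open>auto simp: wp_second_order_ode\<close>)
    from DERIV_unique[OF this eis_sum_has_field_derivative[of L 4 z]] z show ?thesis by simp
  qed
  show "eis_sum L 5 z = wp_sum L z * eis_sum L 3 z" by (rule E5[OF z])
  have "((\<lambda>z. wp_sum L z * eis_sum L 3 z) has_field_derivative
      (- 2 * eis_sum L 3 z) * eis_sum L 3 z + (- of_nat 3 * eis_sum L (Suc 3) z) * wp_sum L z) (at z)"
    by (intro DERIV_mult wp_sum_has_field_derivative eis_sum_has_field_derivative z) auto
  then have "(eis_sum L 5 has_field_derivative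
      (- 2 * eis_sum L 3 z) * eis_sum L 3 z + (- of_nat 3 * eis_sum L (Suc 3) z) * wp_sum L z) (at z)"
    by (rule has_field_derivative_transform_within_open[OF _ open_compl]) (use z in \<open>auto simp: E5\<close>)
  from DERIV_unique[OF this eis_sum_has_field_derivative[of L 5 z]] z
  have "5 * eis_sum L 6 z = 2 * (eis_sum L 3 z)\<^sup>2 + 3 * wp_sum L z * eis_sum L 4 z"
    by (simp add: power2_eq_square algebra_simps)
  also have "\<dots> = 5 * (wp_sum L z ^ 3 - 9 * eisenstein L 4 * wp_sum L z - 14 * eisenstein L 6)"
    unfolding wp_first_order_ode[OF z] wp_second_order_ode(1)[OF z]
    by (simp add: power2_eq_square power3_eq_cube algebra_simps)
  finally show "eis_sum L 6 z = wp_sum L z ^ 3 - 9 * eisenstein L 4 * wp_sum L z - 14 * eisenstein L 6"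
    unfolding mult_cancel_left by simp
qed

lemma eis_sum_8:
  assumes z: "z \<notin> L"
  shows "7 * eis_sum L 8 z = 7 * wp_sum L z ^ 4 - 84 * eisenstein L 4 * (wp_sum L z)\<^sup>2
    - 140 * eisenstein L 6 * wp_sum L z + 45 * (eisenstein L 4)\<^sup>2"
proof -
  have E7: "eis_sum L 7 z = ((wp_sum L z)\<^sup>2 - 3 * eisenstein L 4) * eis_sum L 3 z" if z: "z \<notin> L" for z
  proof -
    have "((\<lambda>z. wp_sum L z ^ 3 - 9 * eisenstein L 4 * wp_sum L z - 14 * eisenstein L 6) has_field_derivative
        (3 * wp_sum L z ^ 2 - 9 * eisenstein L 4) * (- 2 * eis_sum L 3 z)) (at z)"
      by (auto intro!: derivative_eq_intros wp_sum_has_field_derivative z simp: algebra_simps)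
    then have "(eis_sum L 6 has_field_derivative
        (3 * wp_sum L z ^ 2 - 9 * eisenstein L 4) * (- 2 * eis_sum L 3 z)) (at z)"
      by (rule has_field_derivative_transform_within_open[OF _ open_compl])
         (use z in \<open>auto simp: eis_sum_6\<close>)
    from DERIV_unique[OF this eis_sum_has_field_derivative[of L 6 z]] z
    have "6 * eis_sum L 7 z = 6 * (((wp_sum L z)\<^sup>2 - 3 * eisenstein L 4) * eis_sum L 3 z)"
      by (simp add: algebra_simps)
    then show ?thesis by simp
  qed
  have "((\<lambda>z. ((wp_sum L z)\<^sup>2 - 3 * eisenstein L 4) * eis_sum L 3 z) has_field_derivative
      (2 * wp_sum L z * (- 2 * eis_sum L 3 z)) * eis_sum L 3 z
      + (- of_nat 3 * eis_sum L (Suc 3) z) * ((wp_sum L z)\<^sup>2 - 3 * eisenstein L 4)) (at z)"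
    by (intro DERIV_mult eis_sum_has_field_derivative z)
       (auto intro!: derivative_eq_intros wp_sum_has_field_derivative z)
  then have "(eis_sum L 7 has_field_derivative
      (2 * wp_sum L z * (- 2 * eis_sum L 3 z)) * eis_sum L 3 z
      + (- of_nat 3 * eis_sum L (Suc 3) z) * ((wp_sum L z)\<^sup>2 - 3 * eisenstein L 4)) (at z)"
    by (rule has_field_derivative_transform_within_open[OF _ open_compl]) (use z in \<open>auto simp: E7\<close>)
  from DERIV_unique[OF this eis_sum_has_field_derivative[of L 7 z]] z
  have "7 * eis_sum L 8 z = 4 * wp_sum L z * (eis_sum L 3 z)\<^sup>2
      + 3 * ((wp_sum L z)\<^sup>2 - 3 * eisenstein L 4) * eis_sum L 4 z"
    by (simp add: power2_eq_square algebra_simps)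
  then show ?thesis
    unfolding wp_first_order_ode[OF z] wp_second_order_ode(1)[OF z]
    by (simp add: power_numeral_reduce algebra_simps)
qed

end

section \<open>Sublattices of index three\<close>

text \<open>
  The lattice generated by \<open>L\<close> and a point \<open>u\<close> of order three modulo \<open>L\<close>; the projection from
  \<open>\<complex>/L\<close> to \<open>\<complex>/M\<close> is an isogeny of degree three with kernel generated by \<open>u\<close>.
\<close>

locale three_isogeny = lattice +
  fixes u :: complex and M :: "complex set"
  assumes u_notin: "u \<notin> L" and three_u: "3 * u \<in> L"
    and M: "lattice M" and M_eq: "M = L \<union> (+) u ` L \<union> (+) (- u) ` L"
begin

text \<open>
  The cosets of \<open>u\<close> and \<open>-u\<close> contribute \<open>E\<^sub>k(\<plusminus>u)\<close>, and these agree as \<open>k\<close> is even.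
\<close>

lemma eisenstein_isogeny:
  assumes k: "k \<ge> 3" "even k"
  shows "eisenstein M k = eisenstein L k + 2 * eis_sum L k u"
proof -
  have two_u: "2 * u \<notin> L"
    using u_notin diff_mem[OF three_u, of "2 * u"] by auto
  have notin: "- u \<notin> L" using u_notin by simp
  have sum_u: "((\<lambda>\<omega>. 1 / \<omega> ^ k) has_sum eis_sum L k u) ((+) v ` L)" if v: "v = u \<or> v = - u" for v
  proof -
    have "((\<lambda>\<omega>. 1 / (v - \<omega>) ^ k) has_sum eis_sum L k v) L"
      unfolding eis_sum_def using v k u_notin notin by (intro has_sum_infsum eis_sum_summable) auto
    also have "?this \<longleftrightarrow> ((\<lambda>\<omega>. 1 / \<omega> ^ k) has_sum eis_sum L k v) ((+) v ` L)"
      by (rule has_sum_reindex_bij_witness[of _ "\<lambda>\<eta>. v - \<eta>" "\<lambda>\<omega>. v - \<omega>"])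
         (auto simp: image_iff uminus_mem intro!: bexI[of _ "- _"])
    also have "eis_sum L k v = eis_sum L k u"
      using v eis_sum_minus[of k u] k by auto
    finally show ?thesis .
  qed
  have "((\<lambda>\<omega>. 1 / \<omega> ^ k) has_sum eisenstein L k + eis_sum L k u + eis_sum L k u) M"
    unfolding M_eq
  proof (intro has_sum_Un_disjoint sum_u)
    show "((\<lambda>\<omega>. 1 / \<omega> ^ k) has_sum eisenstein L k) L"
      unfolding eisenstein_def by (intro has_sum_infsum eisenstein_summable k)
    show "L \<inter> (+) u ` L = {}"
      using u_notin by (auto simp: add_mem_iff)
    show "(L \<union> (+) u ` L) \<inter> (+) (- u) ` L = {}"
    proof -
      have False if "x \<in> L" "y \<in> L" "u + x = y - u" for x y
      proof -
        have "2 * u = y - x" using that(3) by (simp add: algebra_simps)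
        then show False using two_u diff_mem that by metis
      qed
      moreover have "- u + x \<notin> L" if "x \<in> L" for x
        using add_mem_iff[OF that, of "- u"] u_notin by simp
      ultimately show ?thesis by fastforce
    qed
  qed auto
  then show ?thesis by (simp add: eisenstein_def infsumI)
qed

lemma eisenstein_isogeny_4: "eisenstein M 4 = 2 * (wp_sum L u)\<^sup>2 - 9 * eisenstein L 4"
  using eisenstein_isogeny[of 4] wp_second_order_ode(1)[OF u_notin] by simp

lemma eisenstein_isogeny_6:
  "eisenstein M 6 = 2 * wp_sum L u ^ 3 - 18 * eisenstein L 4 * wp_sum L u - 27 * eisenstein L 6"
  using eisenstein_isogeny[of 6] eis_sum_6(2)[OF u_notin] by simp

text \<open>
  The relation \<open>7 G\<^sub>8 = 3 G\<^sub>4\<^sup>2\<close> holds for both lattices. Written in terms of \<open>L\<close> and \<open>\<wp>(u)\<close>, the one for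
  \<open>M\<close> is a quartic equation for \<open>\<wp>(u)\<close>.
\<close>

lemma three_division_polynomial:
  "wp_sum L u ^ 4 = 30 * eisenstein L 4 * (wp_sum L u)\<^sup>2 + 140 * eisenstein L 6 * wp_sum L u
     + 75 * (eisenstein L 4)\<^sup>2"
proof -
  define p where "p = wp_sum L u"
  define G4 G6 where "G4 = eisenstein L 4" and "G6 = eisenstein L 6"
  have G8: "7 * eisenstein L 8 = 3 * G4\<^sup>2" unfolding G4_def by (rule wp_second_order_ode(2))
  have "7 * eisenstein M 8 = 3 * (eisenstein M 4)\<^sup>2" by (rule lattice.wp_second_order_ode(2)[OF M])
  also have "\<dots> = 3 * (2 * p\<^sup>2 - 9 * G4)\<^sup>2" by (simp add: eisenstein_isogeny_4 p_def G4_def)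
  finally have "7 * eisenstein L 8 + 2 * (7 * eis_sum L 8 u) = 3 * (2 * p\<^sup>2 - 9 * G4)\<^sup>2"
    using eisenstein_isogeny[of 8] by simp
  then have "3 * G4\<^sup>2 + 2 * (7 * p ^ 4 - 84 * G4 * p\<^sup>2 - 140 * G6 * p + 45 * G4\<^sup>2) = 3 * (2 * p\<^sup>2 - 9 * G4)\<^sup>2"
    using G8 eis_sum_8[OF u_notin] by (simp add: p_def G4_def G6_def)
  then have "2 * p ^ 4 = 2 * (30 * G4 * p\<^sup>2 + 140 * G6 * p + 75 * G4\<^sup>2)"
    by (simp add: power_numeral_reduce algebra_simps)
  then show ?thesis unfolding mult_cancel_left by (simp add: p_def G4_def G6_def)
qed

end

context lattice
begin

lemma of_int_mult_mem: "x \<in> L \<Longrightarrow> of_int n * x \<in> L"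
proof (induction n rule: int_induct[where k = 0])
  case (step1 i)
  then show ?case using add_mem[of "of_int i * x" x] by (simp add: algebra_simps)
next
  case (step2 i)
  then show ?case using diff_mem[of "of_int i * x" x] by (simp add: algebra_simps)
qed simp

lemma three_torsion_cosets:
  assumes "3 * u \<in> L"
  shows "L \<union> (+) u ` L \<union> (+) (- u) ` L = {of_int k * u + \<omega> |k \<omega>. \<omega> \<in> L}" (is "?M = ?M'")
proof
  show "?M \<subseteq> ?M'"
  proof
    fix x assume "x \<in> ?M"
    then obtain \<omega> where "\<omega> \<in> L" "x = of_int 0 * u + \<omega> \<or> x = of_int 1 * u + \<omega> \<or> x = of_int (- 1) * u + \<omega>"
      by auto
    then show "x \<in> ?M'" by blast
  qed
  show "?M' \<subseteq> ?M"
  proof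
    fix x assume "x \<in> ?M'"
    then obtain k \<omega> where x: "x = of_int k * u + \<omega>" "\<omega> \<in> L" by blast
    have *: "of_int j * (3 * u) + \<omega> \<in> L" for j by (intro add_mem of_int_mult_mem assms x)
    have "\<exists>j. k = 3 * j \<or> k = 3 * j + 1 \<or> k = 3 * j - 1" by presburger
    then obtain j where "k = 3 * j \<or> k = 3 * j + 1 \<or> k = 3 * j - 1" by blast
    then have k: "(of_int k :: complex) = 3 * of_int j \<or> (of_int k :: complex) = 3 * of_int j + 1
        \<or> (of_int k :: complex) = 3 * of_int j - 1"
      by (elim disjE) simp_all
    then have "x = of_int j * (3 * u) + \<omega> \<or> x = u + (of_int j * (3 * u) + \<omega>)
        \<or> x = - u + (of_int j * (3 * u) + \<omega>)"
    proof -
      have "\<kappa> * u + \<omega> = \<iota> * (3 * u) + \<omega> \<or> \<kappa> * u + \<omega> = u + (\<iota> * (3 * u) + \<omega>)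
          \<or> \<kappa> * u + \<omega> = - u + (\<iota> * (3 * u) + \<omega>)"
        if "\<kappa> = 3 * \<iota> \<or> \<kappa> = 3 * \<iota> + 1 \<or> \<kappa> = 3 * \<iota> - 1" for \<kappa> \<iota> :: complex
        using that by (elim disjE; hypsubst) (simp_all add: algebra_simps)
      from this[of "of_int k" "of_int j"] k show ?thesis unfolding x(1) by blast
    qed
    then show "x \<in> ?M" using *[of j] by blast
  qed
qed

lemma three_isogenyI:
  assumes u: "u \<notin> L" "3 * u \<in> L"
  shows "three_isogeny L u {of_int k * u + \<omega> |k \<omega>. \<omega> \<in> L}" (is "three_isogeny L u ?M")
proof (intro three_isogeny.intro three_isogeny_axioms.intro)
  have M: "?M = L \<union> (+) u ` L \<union> (+) (- u) ` L"
    using three_torsion_cosets[OF u(2)] by simp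
  have sub: "L \<subseteq> ?M" unfolding M by blast
  show "lattice ?M"
  proof
    show "0 \<in> ?M" by (rule subsetD[OF sub zero_mem])
    show "x - y \<in> ?M" if xy: "x \<in> ?M" "y \<in> ?M" for x y
    proof -
      obtain k \<omega> k' \<omega>' where "x = of_int k * u + \<omega>" "y = of_int k' * u + \<omega>'" "\<omega> \<in> L" "\<omega>' \<in> L"
        using xy by blast
      then have "x - y = of_int (k - k') * u + (\<omega> - \<omega>')" "\<omega> - \<omega>' \<in> L"
        by (auto simp: algebra_simps diff_mem)
      then show ?thesis by blast
    qed
    have "(\<lambda>\<omega>. 1 / (1 + norm \<omega>) ^ 3) summable_on (+) v ` L" for v
    proof -
      have "(\<lambda>\<omega>. 1 / (1 + norm (v + \<omega>)) ^ 3) summable_on L"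
      proof (rule summable_on_comparison_test[OF summable_cube_subset[OF order_refl, of "(1 + norm v) ^ 3"]])
        \<comment> \<open>a translation changes \<open>1 + norm \<omega>\<close> at most by the factor \<open>1 + norm v\<close>\<close>
        fix \<omega>
        have "norm \<omega> \<le> norm (v + \<omega>) + norm v"
          using norm_triangle_sub[of \<omega> "v + \<omega>"] by simp
        then have "1 + norm \<omega> \<le> (1 + norm v) * (1 + norm (v + \<omega>))"
        proof -
          have "(1 + norm v) * (1 + norm (v + \<omega>)) = 1 + norm v + norm (v + \<omega>) + norm v * norm (v + \<omega>)"
            by (simp only: algebra_simps)
          moreover have "0 \<le> norm v * norm (v + \<omega>)" by simp
          ultimately show ?thesis using \<open>norm \<omega> \<le> norm (v + \<omega>) + norm v\<close> by linarith
        qed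
        then have "(1 + norm \<omega>) ^ 3 \<le> ((1 + norm v) * (1 + norm (v + \<omega>))) ^ 3"
          by (intro power_mono) auto
        moreover have "1 + norm (v + \<omega>) > 0" "1 + norm \<omega> > 0" by (auto simp: add_pos_nonneg)
        ultimately show "1 / (1 + norm (v + \<omega>)) ^ 3 \<le> (1 + norm v) ^ 3 / (1 + norm \<omega>) ^ 3"
          by (simp add: divide_le_eq le_divide_eq power_mult_distrib mult.commute)
      qed auto
      then show ?thesis by (subst summable_on_reindex) (auto simp: o_def)
    qed
    then show "(\<lambda>\<omega>. 1 / (1 + norm \<omega>) ^ 3) summable_on ?M"
      unfolding M by (intro summable_on_union summable_cube)
    show "\<exists>R. \<forall>z. \<exists>\<omega>\<in>?M. norm (z - \<omega>) \<le> R"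
      using cocompact sub by (meson subsetD)
  qed
  show "?M = L \<union> (+) u ` L \<union> (+) (- u) ` L" by (rule M)
qed (use u lattice_axioms in auto)

end

section \<open>The period lattice\<close>

lemma summable_on_int:
  fixes f :: "int \<Rightarrow> real"
  assumes "(\<lambda>n::nat. f (int n)) summable_on UNIV" "(\<lambda>n::nat. f (- int n)) summable_on UNIV"
  shows "f summable_on UNIV"
proof -
  have "f summable_on range int" "f summable_on range (\<lambda>n. - int n)"
    using assms by (auto simp: summable_on_reindex o_def inj_on_def)
  then have "f summable_on range int \<union> range (\<lambda>n. - int n)"
    by (rule summable_on_union)
  also have "range int \<union> range (\<lambda>n. - int n) = UNIV"
    by (auto intro: int_cases2)
  finally show ?thesis .
qed

lemma summable_on_int_powr: "(\<lambda>m::int. (1 + \<bar>real_of_int m\<bar>) powr (- 3 / 2)) summable_on UNIV"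
proof -
  have "summable (\<lambda>n. real n powr (- 3 / 2))" by (subst summable_real_powr_iff) simp
  then have "summable (\<lambda>n. real (Suc n) powr (- 3 / 2))" by (subst summable_Suc_iff)
  then have "(\<lambda>n. (1 + real n) powr (- 3 / 2)) summable_on UNIV"
    by (subst summable_on_UNIV_nonneg_real_iff) (simp_all add: add.commute)
  then show ?thesis by (intro summable_on_int) simp_all
qed

text \<open>
  Half of the exponent three is spent on each of the two coordinates, and \<open>3/2 > 1\<close>.
\<close>

lemma summable_on_int_pairs:
  "(\<lambda>(m::int, n::int). C / (1 + \<bar>real_of_int m\<bar> + \<bar>real_of_int n\<bar>) ^ 3) summable_on UNIV"
proof -
  let ?f = "\<lambda>m::int. (1 + \<bar>real_of_int m\<bar>) powr (- 3 / 2)"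
  have "(\<lambda>(m, n). ?f m * ?f n) summable_on UNIV \<times> UNIV"
    by (intro summable_on_SigmaI[where g = "\<lambda>m. ?f m * infsum ?f UNIV"])
       (use summable_on_int_powr in \<open>auto intro!: has_sum_cmult_right has_sum_infsum summable_on_cmult_left\<close>)
  then have "(\<lambda>(m::int, n::int). 1 / (1 + \<bar>real_of_int m\<bar> + \<bar>real_of_int n\<bar>) ^ 3) summable_on UNIV"
  proof (simp only: UNIV_Times_UNIV, elim summable_on_comparison_test, safe)
    fix m n :: int
    define x y where "x = \<bar>real_of_int m\<bar>" and "y = \<bar>real_of_int n\<bar>"
    have xy: "x \<ge> 0" "y \<ge> 0" by (auto simp: x_def y_def)
    have "1 / (1 + x + y) ^ 3 = (1 + x + y) powr (- 3 / 2) * (1 + x + y) powr (- 3 / 2)"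
      using xy by (simp add: powr_add[symmetric] powr_minus powr_numeral field_simps)
    also have "\<dots> \<le> (1 + x) powr (- 3 / 2) * (1 + y) powr (- 3 / 2)"
      using xy by (intro mult_mono powr_mono2') auto
    finally show "1 / (1 + \<bar>real_of_int m\<bar> + \<bar>real_of_int n\<bar>) ^ 3 \<le> ?f m * ?f n"
      by (simp add: x_def y_def)
  qed (auto simp: add_nonneg_nonneg)
  from summable_on_cmult_right[OF this, of C] show ?thesis by (simp add: case_prod_unfold)
qed

text \<open>
  The constant depends on \<open>\<tau>\<close> only through a lower bound of its imaginary part and an upper bound of its
  norm; hence estimates based on it are uniform for \<open>\<tau>\<close> in a compact set.
\<close>

lemma norm_lattice_point_ge:
  fixes \<tau> :: complex
  assumes y: "0 < y" "y \<le> Im \<tau>" and T: "norm \<tau> \<le> T"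
  shows "y / (y + 1 + T) * (\<bar>m\<bar> + \<bar>n\<bar>) \<le> norm (of_real m * \<tau> + of_real n)"
proof -
  define N where "N = norm (of_real m * \<tau> + of_real n)"
  have T0: "T \<ge> 0" using T norm_ge_zero order_trans by blast
  have "\<bar>m\<bar> * y \<le> \<bar>Im (of_real m * \<tau> + of_real n)\<bar>"
    using y by (simp add: abs_mult mult_left_mono)
  also have "\<dots> \<le> N" unfolding N_def by (rule abs_Im_le_cmod)
  finally have m: "\<bar>m\<bar> * y \<le> N" .
  have "\<bar>n\<bar> = norm ((of_real m * \<tau> + of_real n) - of_real m * \<tau>)" by simp
  also have "\<dots> \<le> N + \<bar>m\<bar> * T"
    unfolding N_def using T
    by (intro order_trans[OF norm_triangle_ineq4] add_left_mono) (auto simp: norm_mult mult_left_mono)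
  finally have "y * \<bar>n\<bar> \<le> y * (N + \<bar>m\<bar> * T)"
    using y by (intro mult_left_mono) auto
  then have "y * \<bar>n\<bar> \<le> y * N + T * (\<bar>m\<bar> * y)"
    by (simp add: algebra_simps)
  also have "\<dots> \<le> y * N + T * N" using m T0 by (intro add_left_mono mult_left_mono)
  finally have "y * (\<bar>m\<bar> + \<bar>n\<bar>) \<le> N * (y + 1 + T)" using m by (simp add: algebra_simps)
  then show ?thesis using y T0 by (simp add: N_def divide_le_eq)
qed

lemma period_lattice_eq: "period_lattice \<tau> = range (\<lambda>(m, n). of_int m * \<tau> + of_int n)"
  unfolding period_lattice_def by (auto simp: image_iff) (metis add.commute)+

lemma lattice_coordinates_eq_iff:
  assumes "Im \<tau> > 0"
  shows "of_int m * \<tau> + of_int n = of_int m' * \<tau> + of_int n' \<longleftrightarrow> m = m' \<and> n = n'"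
proof
  assume *: "of_int m * \<tau> + of_int n = of_int m' * \<tau> + of_int n'"
  have "of_int m * Im \<tau> = of_int m' * Im \<tau>" using arg_cong[OF *, of Im] by simp
  then have "m = m'" using assms by simp
  then show "m = m' \<and> n = n'" using * by simp
qed simp

lemma inj_lattice_coordinates: "Im \<tau> > 0 \<Longrightarrow> inj (\<lambda>(m, n). of_int m * \<tau> + of_int n)"
  by (auto simp: inj_on_def lattice_coordinates_eq_iff)

lemma infsum_period_lattice:
  assumes "Im \<tau> > 0"
  shows "infsum f (period_lattice \<tau>) = (\<Sum>\<^sub>\<infinity>(m, n). f (of_int m * \<tau> + of_int n))"
  unfolding period_lattice_eq infsum_reindex[OF inj_lattice_coordinates[OF assms]]
  by (simp add: o_def case_prod_unfold)

lemma summable_on_period_lattice: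
  assumes "Im \<tau> > 0"
  shows "f summable_on (period_lattice \<tau>) \<longleftrightarrow> (\<lambda>(m, n). f (of_int m * \<tau> + of_int n)) summable_on UNIV"
  unfolding period_lattice_eq summable_on_reindex[OF inj_lattice_coordinates[OF assms]]
  by (simp add: o_def case_prod_unfold)

lemma lattice_period_lattice:
  assumes \<tau>: "Im \<tau> > 0"
  shows "lattice (period_lattice \<tau>)"
proof
  show "0 \<in> period_lattice \<tau>"
    unfolding period_lattice_def by (rule CollectI, rule exI[of _ 0], rule exI[of _ 0]) simp
  show "x - y \<in> period_lattice \<tau>" if xy: "x \<in> period_lattice \<tau>" "y \<in> period_lattice \<tau>" for x y
  proof -
    obtain a b c d where "x = of_int a + of_int b * \<tau>" "y = of_int c + of_int d * \<tau>"
      using xy unfolding period_lattice_def by blast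
    then have "x - y = of_int (a - c) + of_int (b - d) * \<tau>" by (simp add: algebra_simps)
    then show ?thesis unfolding period_lattice_def by blast
  qed
  define c where "c = min 1 (Im \<tau> / (Im \<tau> + 1 + norm \<tau>))"
  have c: "c > 0" "c \<le> 1" "c \<le> Im \<tau> / (Im \<tau> + 1 + norm \<tau>)"
    using \<tau> by (auto simp: c_def add_pos_nonneg)
  show "(\<lambda>\<omega>. 1 / (1 + norm \<omega>) ^ 3) summable_on period_lattice \<tau>"
    unfolding summable_on_period_lattice[OF \<tau>]
  proof (rule summable_on_comparison_test[OF summable_on_int_pairs[of "1 / c ^ 3"]], safe)
    fix m n :: int
    define s where "s = \<bar>real_of_int m\<bar> + \<bar>real_of_int n\<bar>"
    have "c * s \<le> Im \<tau> / (Im \<tau> + 1 + norm \<tau>) * s" by (intro mult_right_mono c) (simp add: s_def)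
    also have "\<dots> \<le> norm (of_int m * \<tau> + of_int n)"
      using norm_lattice_point_ge[of "Im \<tau>" \<tau> "norm \<tau>" m n] \<tau> by (simp add: s_def)
    finally have "c * (1 + s) \<le> 1 + norm (of_int m * \<tau> + of_int n)"
      using c by (simp add: algebra_simps)
    then have "1 / (1 + norm (of_int m * \<tau> + of_int n)) ^ 3 \<le> 1 / (c * (1 + s)) ^ 3"
      using c by (intro divide_left_mono power_mono mult_pos_pos zero_less_power)
        (auto simp: s_def add_pos_nonneg)
    then show "1 / (1 + norm (of_int m * \<tau> + of_int n)) ^ 3
        \<le> 1 / c ^ 3 / (1 + \<bar>real_of_int m\<bar> + \<bar>real_of_int n\<bar>) ^ 3"
      by (simp add: s_def power_mult_distrib add.assoc)
  qed auto
  show "\<exists>R. \<forall>z. \<exists>\<omega>\<in>period_lattice \<tau>. norm (z - \<omega>) \<le> R"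
  proof (intro exI allI)
    fix z
    define n where "n = \<lfloor>Im z / Im \<tau>\<rfloor>"
    define w where "w = z - of_int n * \<tau>"
    define m where "m = \<lfloor>Re w\<rfloor>"
    define \<omega> where "\<omega> = of_int m + of_int n * \<tau>"
    have "of_int n \<le> Im z / Im \<tau>" "Im z / Im \<tau> \<le> of_int n + 1"
      unfolding n_def by linarith+
    then have "of_int n * Im \<tau> \<le> Im z" "Im z \<le> (of_int n + 1) * Im \<tau>"
      using \<tau> by (simp_all only: pos_le_divide_eq pos_divide_le_eq)
    then have "\<bar>Im (z - \<omega>)\<bar> \<le> Im \<tau>" by (simp add: \<omega>_def algebra_simps)
    moreover have "\<bar>Re (z - \<omega>)\<bar> \<le> 1"
    proof -
      have "Re (z - \<omega>) = Re w - of_int \<lfloor>Re w\<rfloor>" by (simp add: \<omega>_def w_def m_def)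
      then show ?thesis by linarith
    qed
    ultimately have "norm (z - \<omega>) \<le> 1 + Im \<tau>"
      using cmod_le[of "z - \<omega>"] by linarith
    then show "\<exists>\<omega>\<in>period_lattice \<tau>. norm (z - \<omega>) \<le> 1 + Im \<tau>"
      unfolding period_lattice_def \<omega>_def by blast
  qed
qed

lemma one_third_notin: "Im \<tau> > 0 \<Longrightarrow> 1 / 3 \<notin> period_lattice \<tau>"
proof
  assume \<tau>: "Im \<tau> > 0" and "1 / 3 \<in> period_lattice \<tau>"
  then obtain m n where *: "1 / 3 = of_int m + of_int n * \<tau>" by (auto simp: period_lattice_def)
  then have "n = 0" using arg_cong[OF *, of Im] \<tau> by simp
  then have "(of_int (3 * m) :: complex) = of_int 1" using * by (simp add: mult.commute)
  then have "3 * m = 1" by (simp only: of_int_eq_iff)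
  then show False by presburger
qed

lemma three_thirds_mem: "3 * (1 / 3) \<in> period_lattice \<tau>"
  unfolding period_lattice_def by (rule CollectI, rule exI[of _ 1], rule exI[of _ 0]) simp

lemma wp_one_third_holomorphic: "(\<lambda>\<tau>. weierstrass_p (1 / 3) (period_lattice \<tau>)) holomorphic_on uhp"
proof -
  define f :: "int \<times> int \<Rightarrow> complex \<Rightarrow> complex" where
    "f = (\<lambda>(m, n) \<tau>. 1 / (1 / 3 - (of_int m * \<tau> + of_int n))\<^sup>2 - 1 / (of_int m * \<tau> + of_int n)\<^sup>2)"
  have op: "open uhp" by (rule open_uhp)
  have nz: "1 / 3 - (of_int m * \<tau> + of_int n) \<noteq> 0" if "\<tau> \<in> uhp" for m n \<tau>
  proof
    assume "1 / 3 - (of_int m * \<tau> + of_int n) = 0"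
    then have "1 / 3 = of_int n + of_int m * \<tau>" by (simp only: right_minus_eq add.commute)
    then have "1 / 3 \<in> period_lattice \<tau>" unfolding period_lattice_def by blast
    then show False using that one_third_notin by (auto simp: uhp_def)
  qed
  have hol: "f i holomorphic_on uhp" for i
  proof -
    obtain m n where i: "i = (m, n)" by (cases i)
    show ?thesis
    proof (cases "m = 0 \<and> n = 0")
      case True
      then show ?thesis by (simp add: f_def i)
    next
      case False
      then have "of_int m * \<tau> + of_int n \<noteq> 0" if "\<tau> \<in> uhp" for \<tau>
        using lattice_coordinates_eq_iff[of \<tau> m n 0 0] that by (auto simp: uhp_def)
      then show ?thesis unfolding f_def i prod.case using nz by (intro holomorphic_intros) auto
    qed
  qed
  have bnd: "\<exists>d>0. \<exists>M. cball \<tau>\<^sub>0 d \<subseteq> uhp \<and> M summable_on UNIV \<and>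
      (\<forall>i\<in>UNIV. \<forall>\<tau>\<in>cball \<tau>\<^sub>0 d. norm (f i \<tau>) \<le> M i)" if "\<tau>\<^sub>0 \<in> uhp" for \<tau>\<^sub>0
  proof -
    define y T where "y = Im \<tau>\<^sub>0 / 2" and "T = norm \<tau>\<^sub>0 + y"
    have y: "y > 0" using that by (simp add: y_def uhp_def)
    \<comment> \<open>the factor 6 absorbs the shift by 1/3 and the passage from \<open>\<bar>m\<bar> + \<bar>n\<bar>\<close> to \<open>1 + \<bar>m\<bar> + \<bar>n\<bar>\<close>\<close>
    define c where "c = y / (y + 1 + T) / 6"
    have T: "T > 0" using y by (simp add: T_def add_nonneg_pos)
    have c: "c > 0" using y T by (simp add: c_def)
    have in_ball: "Im \<tau> \<ge> y" "norm \<tau> \<le> T" if "\<tau> \<in> cball \<tau>\<^sub>0 y" for \<tau>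
      using that abs_Im_le_cmod[of "\<tau>\<^sub>0 - \<tau>"] norm_triangle_sub[of \<tau> \<tau>\<^sub>0]
      by (auto simp: dist_norm y_def T_def norm_minus_commute)
    \<comment> \<open>9 is the value of the term with \<open>m = n = 0\<close>\<close>
    define C where "C = 2 * norm (1 / 3 :: complex) / c ^ 3 + 9"
    have "norm (f (m, n) \<tau>) \<le> C / (1 + \<bar>real_of_int m\<bar> + \<bar>real_of_int n\<bar>) ^ 3"
      if "\<tau> \<in> cball \<tau>\<^sub>0 y" for m n \<tau>
    proof (cases "m = 0 \<and> n = 0")
      case True
      then show ?thesis using c by (simp add: f_def C_def power2_eq_square)
    next
      case False
      define s where "s = 1 + \<bar>real_of_int m\<bar> + \<bar>real_of_int n\<bar>"
      have s: "s > 0" by (simp add: s_def add_pos_nonneg)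
      have ge: "y / (y + 1 + T) * (\<bar>a\<bar> + \<bar>b\<bar>) \<le> norm (of_real a * \<tau> + of_real b)" for a b
        using in_ball[OF that] y by (intro norm_lattice_point_ge)
      have mn: "\<bar>m\<bar> + \<bar>n\<bar> \<ge> 1" using False by linarith
      then have "\<bar>real_of_int m\<bar> + \<bar>real_of_int n\<bar> \<ge> 1" by linarith
      then have "s / 6 \<le> \<bar>real_of_int m\<bar> + \<bar>real_of_int n\<bar>" by (simp add: s_def)
      then have "y / (y + 1 + T) * (s / 6) \<le> y / (y + 1 + T) * (\<bar>real_of_int m\<bar> + \<bar>real_of_int n\<bar>)"
        using y T by (intro mult_left_mono) auto
      then have 1: "c * s \<le> norm (of_int m * \<tau> + of_int n)"
        using ge[of m n] by (simp add: c_def)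
      have "s / 6 \<le> \<bar>real_of_int m\<bar> + \<bar>real_of_int n - 1 / 3\<bar>"
      proof (cases "n = 0")
        case n: False
        then have "\<bar>real_of_int n\<bar> \<ge> 1" by linarith
        moreover have "\<bar>real_of_int n - 1 / 3\<bar> \<ge> \<bar>real_of_int n\<bar> - 1 / 3" by linarith
        moreover have "\<bar>real_of_int m\<bar> \<ge> 0" by simp
        ultimately show ?thesis unfolding s_def by (simp add: field_simps)
      qed (auto simp: s_def)
      then have "y / (y + 1 + T) * (s / 6) \<le> y / (y + 1 + T) * (\<bar>real_of_int m\<bar> + \<bar>real_of_int n - 1 / 3\<bar>)"
        using y T by (intro mult_left_mono) auto
      also have "\<dots> \<le> norm (of_real m * \<tau> + of_real (n - 1 / 3))" by (rule ge)
      also have "\<dots> = norm (1 / 3 - (of_int m * \<tau> + of_int n))"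
        by (subst norm_minus_commute[of "1 / 3"]) (simp add: algebra_simps)
      finally have 2: "c * s \<le> norm (1 / 3 - (of_int m * \<tau> + of_int n))"
        by (simp add: c_def)
      have "norm (f (m, n) \<tau>) \<le> 2 * norm (1 / 3 :: complex) / c ^ 3 / s ^ 3"
        unfolding f_def prod.case by (rule wp_term_bound[OF c s 2 1])
      also have "\<dots> \<le> C / s ^ 3" using s by (intro divide_right_mono) (auto simp: C_def)
      finally show ?thesis by (simp add: s_def)
    qed
    moreover have "cball \<tau>\<^sub>0 y \<subseteq> uhp" using in_ball(1) y by (fastforce simp: uhp_def)
    ultimately show ?thesis
      using y by (intro exI[of _ y] exI[of _ "\<lambda>(m, n). C / (1 + \<bar>real_of_int m\<bar> + \<bar>real_of_int n\<bar>) ^ 3"]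
          conjI summable_on_int_pairs) auto
  qed
  have "(\<lambda>\<tau>. \<Sum>\<^sub>\<infinity>i. f i \<tau>) holomorphic_on uhp"
    by (rule infsum_holomorphic(1)[OF op hol bnd])
  also have "?this \<longleftrightarrow> ?thesis"
  proof (rule holomorphic_cong[OF refl])
    fix \<tau> assume "\<tau> \<in> uhp"
    then have \<tau>: "Im \<tau> > 0" by (simp add: uhp_def)
    interpret lattice "period_lattice \<tau>" by (rule lattice_period_lattice[OF \<tau>])
    show "(\<Sum>\<^sub>\<infinity>i. f i \<tau>) = weierstrass_p (1 / 3) (period_lattice \<tau>)"
      using weierstrass_p_eq[OF one_third_notin[OF \<tau>]]
      by (simp add: wp_sum_def infsum_period_lattice[OF \<tau>] f_def case_prod_unfold)
  qed
  finally show ?thesis .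
qed

section \<open>The degenerate lattice of integers\<close>

lemma has_sum_int:
  fixes f :: "int \<Rightarrow> complex"
  assumes "((\<lambda>n::nat. f (int n)) has_sum a) UNIV" "((\<lambda>n::nat. f (- int (Suc n))) has_sum b) UNIV"
  shows "(f has_sum (a + b)) UNIV"
proof -
  have "(f has_sum a) (range int)" "(f has_sum b) (range (\<lambda>n. - int (Suc n)))"
    using assms by (subst has_sum_reindex; simp add: o_def inj_on_def)+
  then have "(f has_sum (a + b)) (range int \<union> range (\<lambda>n. - int (Suc n)))"
    by (rule has_sum_Un_disjoint) auto
  also have "range int \<union> range (\<lambda>n. - int (Suc n)) = UNIV"
  proof -
    have "x \<in> range int \<union> range (\<lambda>n. - int (Suc n))" for x
      by (cases x) blast+
    then show ?thesis by blast
  qed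
  finally show ?thesis .
qed

lemma summable_on_int_subsequence:
  fixes f :: "int \<Rightarrow> complex"
  assumes "f summable_on UNIV" "inj g"
  shows "(\<lambda>n::nat. f (g n)) summable_on UNIV"
  using summable_on_reindex[OF assms(2), of f] summable_on_subset_banach[OF assms(1), of "range g"]
  by (simp add: o_def)

lemma infsum_int_even:
  fixes f :: "int \<Rightarrow> complex"
  assumes f: "f summable_on UNIV" and even: "\<And>n. f (- n) = f n"
  shows "infsum f UNIV = f 0 + 2 * (\<Sum>\<^sub>\<infinity>n::nat. f (int (Suc n)))"
proof -
  define S where "S = (\<Sum>\<^sub>\<infinity>n::nat. f (int (Suc n)))"
  have S: "((\<lambda>n::nat. f (int (Suc n))) has_sum S) UNIV"
    unfolding S_def by (intro has_sum_infsum summable_on_int_subsequence f) (auto simp: inj_on_def)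
  have "((\<lambda>n::nat. f (int n)) has_sum (f 0 + S)) (insert 0 (range Suc))"
    using has_sum_insert[of 0 "range Suc" "\<lambda>n::nat. f (int n)" S] S by (simp add: has_sum_reindex o_def)
  also have "insert 0 (range Suc) = UNIV" by (auto intro: nat.exhaust)
  finally have "(f has_sum (f 0 + S + S)) UNIV"
    using S by (intro has_sum_int) (simp_all only: even)
  then show ?thesis by (simp add: infsumI S_def)
qed

lemma infsum_Ints: "infsum f \<int> = (\<Sum>\<^sub>\<infinity>n::int. f (of_int n))"
  and summable_on_Ints: "f summable_on \<int> \<longleftrightarrow> (\<lambda>n::int. f (of_int n)) summable_on UNIV"
  for f :: "complex \<Rightarrow> complex"
  by (simp_all add: Ints_def infsum_reindex summable_on_reindex inj_on_def o_def)

interpretation Z: discrete_subgroup "\<int> :: complex set"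
proof
  have "(\<lambda>n::int. 1 / (1 + \<bar>real_of_int n\<bar>) ^ 3) summable_on UNIV"
  proof (rule summable_on_comparison_test[OF summable_on_int_powr])
    fix n :: int
    have "(1 + \<bar>real_of_int n\<bar>) powr (- 3) \<le> (1 + \<bar>real_of_int n\<bar>) powr (- 3 / 2)"
      by (intro powr_mono) auto
    then show "1 / (1 + \<bar>real_of_int n\<bar>) ^ 3 \<le> (1 + \<bar>real_of_int n\<bar>) powr (- 3 / 2)"
      by (simp add: powr_minus_divide)
  qed auto
  then show "(\<lambda>\<omega>::complex. 1 / (1 + norm \<omega>) ^ 3) summable_on \<int>"
    by (simp add: Ints_def summable_on_reindex inj_on_def o_def)
qed auto

text \<open>
  The reflection formula of the Gamma function, differentiated logarithmically twice.
\<close>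

lemma Polygamma_reflection:
  fixes z :: complex
  assumes "z \<notin> \<int>"
  shows "Polygamma 1 z + Polygamma 1 (1 - z) = of_real pi ^ 2 / sin (of_real pi * z) ^ 2"
proof -
  have op: "open (- \<int> :: complex set)" by (rule Z.open_compl)
  have npi: "z \<notin> \<int>\<^sub>\<le>\<^sub>0" "1 - z \<notin> \<int>\<^sub>\<le>\<^sub>0" if "z \<notin> \<int>" for z :: complex
    using that nonpos_Ints_subset_Ints Ints_diff[of 1 "1 - z"] by auto
  have sin_nz: "sin (of_real pi * z) \<noteq> 0" if "z \<notin> \<int>" for z :: complex
    using that by (auto simp: sin_eq_0)
  have digamma: "Digamma (1 - z) - Digamma z = of_real pi * cos (of_real pi * z) / sin (of_real pi * z)"
    if z: "z \<notin> \<int>" for z :: complex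
  proof -
    have "((\<lambda>w. rGamma w * rGamma (1 - w)) has_field_derivative
        rGamma z * rGamma (1 - z) * (Digamma (1 - z) - Digamma z)) (at z)"
      using npi[OF z] by (auto intro!: derivative_eq_intros simp: algebra_simps)
    moreover have "((\<lambda>w. rGamma w * rGamma (1 - w)) has_field_derivative cos (of_real pi * z)) (at z)"
      unfolding rGamma_reflection_complex by (auto intro!: derivative_eq_intros)
    ultimately have "sin (of_real pi * z) / of_real pi * (Digamma (1 - z) - Digamma z) = cos (of_real pi * z)"
      unfolding rGamma_reflection_complex by (rule DERIV_unique)
    then show ?thesis using sin_nz[OF z] by (simp add: field_simps)
  qed
  have "((\<lambda>z. Digamma (1 - z) - Digamma z) has_field_derivative
      - Polygamma 1 (1 - z) - Polygamma 1 z) (at z)"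
    using npi[OF assms] by (auto intro!: derivative_eq_intros)
  moreover have "((\<lambda>z. of_real pi * cos (of_real pi * z) / sin (of_real pi * z)) has_field_derivative
      - (of_real pi ^ 2 / sin (of_real pi * z) ^ 2)) (at z)"
  proof -
    have "- (of_real pi ^ 2 / sin (of_real pi * z) ^ 2) =
      - (of_real pi ^ 2 * (sin (of_real pi * z) ^ 2 + cos (of_real pi * z) ^ 2)) / sin (of_real pi * z) ^ 2"
      by simp
    then show ?thesis
      using sin_nz[OF assms]
      by (auto intro!: derivative_eq_intros simp: power2_eq_square algebra_simps simp del: sin_cos_squared_add sin_cos_squared_add2 sin_cos_squared_add3)
  qed
  then have "((\<lambda>z. Digamma (1 - z) - Digamma z) has_field_derivative
      - (of_real pi ^ 2 / sin (of_real pi * z) ^ 2)) (at z)"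
    by (rule has_field_derivative_transform_within_open[OF _ op]) (use assms in \<open>auto simp: digamma\<close>)
  ultimately have "- Polygamma 1 (1 - z) - Polygamma 1 z = - (of_real pi ^ 2 / sin (of_real pi * z) ^ 2)"
    by (rule DERIV_unique)
  then show ?thesis by (simp add: algebra_simps)
qed

lemma inverse_squares_has_sum_int: "((\<lambda>n::int. 1 / of_int n ^ 2) has_sum complex_of_real (pi\<^sup>2 / 3)) UNIV"
  (is "(?f has_sum _) _")
proof -
  have "((\<lambda>n. 1 / real (Suc n) ^ 2) has_sum (pi\<^sup>2 / 6)) UNIV"
    using inverse_squares_sums by (intro sums_nonneg_imp_has_sum) (auto simp: add.commute)
  from has_sum_of_real[OF this, where ?'a = complex]
  have S: "((\<lambda>n. ?f (int (Suc n))) has_sum (of_real (pi\<^sup>2 / 6))) UNIV" by simp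
  have "((\<lambda>n::nat. ?f (int n)) has_sum (?f 0 + of_real (pi\<^sup>2 / 6))) (insert 0 (range Suc))"
    using has_sum_insert[of 0 "range Suc" "\<lambda>n::nat. ?f (int n)" "of_real (pi\<^sup>2 / 6)"] S
    by (simp add: has_sum_reindex o_def)
  also have "insert 0 (range Suc) = UNIV" by (auto intro: nat.exhaust)
  finally have "(?f has_sum (?f 0 + of_real (pi\<^sup>2 / 6) + of_real (pi\<^sup>2 / 6))) UNIV"
  proof (intro has_sum_int)
    have "?f (- int (Suc n)) = ?f (int (Suc n))" for n by (simp only: of_int_minus power2_minus)
    then show "((\<lambda>n. ?f (- int (Suc n))) has_sum of_real (pi\<^sup>2 / 6)) UNIV" using S by (simp only:)
  qed
  also have "?f 0 + of_real (pi\<^sup>2 / 6) + of_real (pi\<^sup>2 / 6) = of_real (pi\<^sup>2 / 3)" by simp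
  finally show ?thesis .
qed

text \<open>
  The positive and the negative integers contribute the trigamma values at \<open>z + 1\<close> and \<open>-z\<close>; the
  subtracted terms \<open>1/n\<^sup>2\<close> add up to \<open>\<pi>\<^sup>2/3\<close>.
\<close>

lemma wp_sum_Ints:
  assumes z: "z \<notin> \<int>"
  shows "wp_sum \<int> z = of_real pi ^ 2 / sin (of_real pi * z) ^ 2 - of_real pi ^ 2 / 3"
proof -
  let ?f = "\<lambda>n::int. 1 / (z - of_int n) ^ 2" and ?g = "\<lambda>n::int. 1 / of_int n ^ 2 :: complex"
  have fg: "(\<lambda>n. ?f n - ?g n) summable_on UNIV"
    using Z.wp_sum_summable[OF order_refl z] by (simp add: summable_on_Ints)
  have g: "(?g has_sum of_real (pi\<^sup>2 / 3)) UNIV" by (rule inverse_squares_has_sum_int)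
  have f: "?f summable_on UNIV"
    using summable_on_add[OF fg has_sum_imp_summable[OF g]] by simp
  have sq: "(z - of_nat n)\<^sup>2 = (- z + of_nat n)\<^sup>2" "(z - of_int (- int (Suc n)))\<^sup>2 = (z + 1 + of_nat n)\<^sup>2" for n
    by (simp_all add: power2_eq_square algebra_simps)
  have sub: "((\<lambda>n::nat. ?f (h n)) has_sum P) UNIV"
    if "inj h" and P: "(\<lambda>n. ?f (h n)) sums P" for h P
  proof -
    have s: "((\<lambda>n::nat. ?f (h n)) has_sum infsum (\<lambda>n::nat. ?f (h n)) UNIV) UNIV"
      by (intro has_sum_infsum summable_on_int_subsequence f \<open>inj h\<close>)
    then have "infsum (\<lambda>n::nat. ?f (h n)) UNIV = P"
      using P has_sum_imp_sums sums_unique2 by blast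
    with s show ?thesis by simp
  qed
  have "z \<noteq> - 1" using z by (metis Ints_1 Ints_minus)
  then have nz: "- z \<noteq> 0" "z + 1 \<noteq> 0" using z by (auto simp: add_eq_0_iff2)
  have "((\<lambda>n::nat. ?f (int n)) has_sum Polygamma 1 (- z)) UNIV"
  proof (rule sub)
    show "(\<lambda>n. ?f (int n)) sums Polygamma 1 (- z)"
      using Polygamma_LIMSEQ[of "- z" 1] nz unfolding of_int_of_nat_eq sq by (simp add: inverse_eq_divide numeral_2_eq_2)
  qed (auto simp: inj_on_def)
  moreover have "((\<lambda>n::nat. ?f (- int (Suc n))) has_sum Polygamma 1 (z + 1)) UNIV"
  proof (rule sub)
    show "(\<lambda>n. ?f (- int (Suc n))) sums Polygamma 1 (z + 1)"
      using Polygamma_LIMSEQ[of "z + 1" 1] nz unfolding sq by (simp add: inverse_eq_divide numeral_2_eq_2)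
  qed (auto simp: inj_on_def)
  ultimately have "(?f has_sum (Polygamma 1 (- z) + Polygamma 1 (z + 1))) UNIV"
    by (rule has_sum_int)
  moreover have "Polygamma 1 (- z) + Polygamma 1 (z + 1) = of_real pi ^ 2 / sin (of_real pi * z) ^ 2"
    using Polygamma_reflection[of "- z"] z by (simp add: add.commute)
  ultimately have "(?f has_sum (of_real pi ^ 2 / sin (of_real pi * z) ^ 2)) UNIV" by simp
  from has_sum_add[OF this has_sum_cmult_right[OF g, of "- 1"]] show ?thesis
    by (simp add: wp_sum_def infsum_Ints infsumI)
qed

text \<open>
  These are \<open>2\<zeta>(4)\<close> and \<open>2\<zeta>(6)\<close>. They are the second and fourth Taylor coefficients of
  \<open>\<pi>\<^sup>2/sin\<^sup>2 \<pi>z - 1/z\<^sup>2\<close>, up to the factors 3 and 5, and are found by comparing coefficients after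
  multiplication by \<open>2 sin\<^sup>2 \<pi>z = 1 - cos 2\<pi>z\<close>.
\<close>

lemma eisenstein_Ints:
  "eisenstein \<int> 4 = of_real pi ^ 4 / 45" "eisenstein \<int> 6 = 2 * of_real pi ^ 6 / 945"
proof -
  define p where "p = (of_real pi :: complex)"
  have p: "p \<noteq> 0" by (simp add: p_def)
  define R where "R = wp_sum (\<int> - {0})"
  define F where "F = (Z.wp_fps :: complex fps)"
  have R: "R has_fps_expansion F" unfolding R_def F_def by (rule Z.wp_sum_has_fps_expansion)
  define g where "g z = (z ^ 2 * R z + 1 + p ^ 2 / 3 * z ^ 2) * (1 - cos ((2 * p) * z)) - 2 * p ^ 2 * z ^ 2" for z
  define H where "H = (fps_X ^ 2 * F + 1 + fps_const (p ^ 2 / 3) * fps_X ^ 2) * (1 - fps_cos (2 * p))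
      - fps_const (2 * p ^ 2) * fps_X ^ 2"
  have g: "g has_fps_expansion H" unfolding g_def H_def by (intro fps_expansion_intros R)
  have "\<forall>\<^sub>F z in nhds 0. g z = 0"
  proof -
    have "g z = 0" if "z \<notin> \<int>" for z
    proof -
      have nz: "z \<noteq> 0" "sin (p * z) \<noteq> 0" using that by (auto simp: p_def sin_eq_0)
      have "1 / z ^ 2 + R z = p ^ 2 / sin (p * z) ^ 2 - p ^ 2 / 3"
        using wp_sum_Ints[OF that] Z.wp_sum_singular_part[OF that] by (simp add: R_def p_def)
      then have "z ^ 2 * R z + 1 + p ^ 2 / 3 * z ^ 2 = z ^ 2 * (p ^ 2 / sin (p * z) ^ 2)"
        using nz by (simp add: field_simps)
      moreover have "1 - cos ((2 * p) * z) = 2 * sin (p * z) ^ 2"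
        using cos_double_sin[of "p * z"] by (simp add: mult.assoc)
      ultimately show ?thesis using nz by (simp add: g_def)
    qed
    then show ?thesis using Z.eventually_not_mem
      by (auto simp: eventually_at_filter g_def elim!: eventually_mono)
  qed
  then have "(\<lambda>_. 0) has_fps_expansion H"
    using g has_fps_expansion_cong[of g "\<lambda>_. 0" H H] by simp
  then have H0: "H = 0" using fps_expansion_unique_complex has_fps_expansion_0 by blast
  define A where "A = fps_X ^ 2 * F + 1 + fps_const (p ^ 2 / 3) * fps_X ^ 2"
  have A: "fps_nth A 0 = 1" "fps_nth A (Suc 0) = 0" "fps_nth A 2 = p ^ 2 / 3" "fps_nth A 3 = 0"
    "fps_nth A 4 = 3 * eisenstein \<int> 4" "fps_nth A 5 = 0" "fps_nth A 6 = 5 * eisenstein \<int> 6"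
    by (simp_all add: A_def F_def fps_X_power_mult_nth Z.wp_fps_nth)
  define B where "B = 1 - fps_cos (2 * p)"
  have B: "fps_nth B 0 = 0" "fps_nth B (Suc 0) = 0" "fps_nth B 2 = 2 * p ^ 2" "fps_nth B 3 = 0"
    "fps_nth B 4 = - (2 / 3 * p ^ 4)" "fps_nth B 5 = 0" "fps_nth B 6 = 4 / 45 * p ^ 6" "fps_nth B 7 = 0"
    "fps_nth B 8 = - (2 / 315 * p ^ 8)"
    by (simp_all add: B_def fps_cos_def fact_numeral power_mult_distrib)
  have H: "H = A * B - fps_const (2 * p ^ 2) * fps_X ^ 2" by (simp add: H_def A_def B_def)
  have "{0..6::nat} = {0, Suc 0, 2, 3, 4, 5, 6}" "{0..8::nat} = {0, Suc 0, 2, 3, 4, 5, 6, 7, 8}" by auto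
  then have AB: "fps_nth (A * B) 6 = 4 / 45 * p ^ 6 - p ^ 2 / 3 * (2 / 3 * p ^ 4) + 3 * eisenstein \<int> 4 * (2 * p ^ 2)"
    "fps_nth (A * B) 8 = - (2 / 315 * p ^ 8) + p ^ 2 / 3 * (4 / 45 * p ^ 6)
       - 3 * eisenstein \<int> 4 * (2 / 3 * p ^ 4) + 5 * eisenstein \<int> 6 * (2 * p ^ 2)"
    by (simp_all add: fps_mult_nth A B)
  have "fps_nth (A * B) 6 = 0" "fps_nth (A * B) 8 = 0"
    using H0 arg_cong[OF H, of "\<lambda>h. fps_nth h 6"] arg_cong[OF H, of "\<lambda>h. fps_nth h 8"] by simp_all
  then have 4: "p ^ 2 * (6 * eisenstein \<int> 4 - 2 / 15 * p ^ 4) = 0"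
    and 6: "p ^ 2 * (10 * eisenstein \<int> 6 - 2 * p ^ 2 * eisenstein \<int> 4 + (8 / 270 - 2 / 315) * p ^ 6) = 0"
    unfolding AB by (simp_all add: algebra_simps power_numeral_reduce)
  have "6 * (eisenstein \<int> 4 - p ^ 4 / 45) = 0" using 4 p by simp
  then have G4: "eisenstein \<int> 4 = p ^ 4 / 45" unfolding mult_eq_0_iff by simp
  then show "eisenstein \<int> 4 = of_real pi ^ 4 / 45" by (simp add: p_def)
  have "10 * (eisenstein \<int> 6 - 2 * p ^ 6 / 945) = 0"
    using 6 p by (simp add: G4 algebra_simps power_numeral_reduce)
  then show "eisenstein \<int> 6 = 2 * of_real pi ^ 6 / 945"
    unfolding mult_eq_0_iff by (simp add: p_def)
qed

section \<open>Fourier expansions\<close>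

definition qsum :: "nat \<Rightarrow> complex \<Rightarrow> complex" where
  "qsum k z = (\<Sum>\<^sub>\<infinity>n::nat. of_nat (Suc n) ^ k * nome z ^ Suc n)"

lemma summable_power_times_geometric:
  fixes r :: real
  assumes r: "0 < r" "r < 1"
  shows "(\<lambda>n. real (Suc n) ^ k * r ^ Suc n) summable_on UNIV"
proof -
  have "((\<lambda>n. (real (Suc (Suc n)) / real (Suc n)) ^ k * r) \<longlonglongrightarrow> 1 ^ k * r)"
    by (intro tendsto_intros) real_asymp
  then have "\<forall>\<^sub>F n in sequentially. (real (Suc (Suc n)) / real (Suc n)) ^ k * r < (1 + r) / 2"
    by (rule order_tendstoD) (use r in simp)
  then obtain N where N: "\<And>n. n \<ge> N \<Longrightarrow> (real (Suc (Suc n)) / real (Suc n)) ^ k * r < (1 + r) / 2"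
    by (auto simp: eventually_at_top_linorder)
  have "summable (\<lambda>n. real (Suc n) ^ k * r ^ Suc n)"
  proof (rule summable_ratio_test[of "(1 + r) / 2" N])
    fix n assume "n \<ge> N"
    have "real (Suc (Suc n)) ^ k * r ^ Suc (Suc n) =
        ((real (Suc (Suc n)) / real (Suc n)) ^ k * r) * (real (Suc n) ^ k * r ^ Suc n)"
      by (simp add: power_divide del: of_nat_Suc)
    also have "\<dots> \<le> (1 + r) / 2 * (real (Suc n) ^ k * r ^ Suc n)"
      using N[OF \<open>n \<ge> N\<close>] r by (intro mult_right_mono) auto
    finally show "norm (real (Suc (Suc n)) ^ k * r ^ Suc (Suc n))
        \<le> (1 + r) / 2 * norm (real (Suc n) ^ k * r ^ Suc n)"
      using r by (simp add: abs_mult del: of_nat_Suc)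
  qed (use r in auto)
  then show ?thesis using r by (subst summable_on_UNIV_nonneg_real_iff) auto
qed

lemma norm_nome: "norm (nome \<tau>) = exp (- 2 * pi * Im \<tau>)"
  by (simp add: nome_def)

lemma norm_nome_less_1: "Im \<tau> > 0 \<Longrightarrow> norm (nome \<tau>) < 1"
  by (simp add: norm_nome)

lemma nome_has_field_derivative: "(nome has_field_derivative 2 * of_real pi * \<i> * nome z) (at z)"
  unfolding nome_def[abs_def] by (auto intro!: derivative_eq_intros)

lemma qsum_summable:
  assumes "Im z > 0"
  shows "(\<lambda>n. of_nat (Suc n) ^ k * nome z ^ Suc n) summable_on UNIV"
proof (rule abs_summable_summable)
  show "(\<lambda>n. norm (of_nat (Suc n) ^ k * nome z ^ Suc n)) summable_on UNIV"
    using summable_power_times_geometric[of "norm (nome z)" k] norm_nome_less_1[OF assms]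
    by (simp add: norm_mult norm_power norm_nome del: of_nat_Suc)
qed

lemma qsum_has_field_derivative:
  assumes z: "Im z > 0"
  shows "(qsum k has_field_derivative 2 * of_real pi * \<i> * qsum (Suc k) z) (at z)"
proof -
  have D: "((\<lambda>z. of_nat (Suc n) ^ k * nome z ^ Suc n) has_field_derivative
      2 * of_real pi * \<i> * (of_nat (Suc n) ^ Suc k * nome z ^ Suc n)) (at z)" for n z
    by (rule derivative_eq_intros nome_has_field_derivative refl | simp)+
  then have hol: "(\<lambda>z. of_nat (Suc n) ^ k * nome z ^ Suc n) holomorphic_on uhp" for n
    using open_uhp by (auto simp: holomorphic_on_open)
  have bnd: "\<exists>d>0. \<exists>M. cball z d \<subseteq> uhp \<and> M summable_on UNIV \<and>
      (\<forall>n\<in>UNIV. \<forall>w\<in>cball z d. norm (of_nat (Suc n) ^ k * nome w ^ Suc n) \<le> M n)" if "z \<in> uhp" for z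
  proof -
    define y where "y = Im z / 2"
    have y: "y > 0" using that by (simp add: y_def uhp_def)
    have in_ball: "Im w \<ge> y" if "w \<in> cball z y" for w
      using that abs_Im_le_cmod[of "z - w"] by (simp add: dist_norm y_def)
    have "norm (of_nat (Suc n) ^ k * nome w ^ Suc n) \<le> real (Suc n) ^ k * exp (- 2 * pi * y) ^ Suc n"
      if "w \<in> cball z y" for w n
      using in_ball[OF that] unfolding norm_mult norm_power norm_of_nat norm_nome
      by (intro mult_left_mono power_mono) auto
    moreover have "cball z y \<subseteq> uhp" using in_ball y by (fastforce simp: uhp_def)
    ultimately show ?thesis
      using y by (intro exI[of _ y] exI[of _ "\<lambda>n. real (Suc n) ^ k * exp (- 2 * pi * y) ^ Suc n"]
          conjI summable_power_times_geometric) auto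
  qed
  have zu: "z \<in> uhp" using z by (simp add: uhp_def)
  have "((\<lambda>n. 2 * of_real pi * \<i> * (of_nat (Suc n) ^ Suc k * nome z ^ Suc n)) has_sum deriv (qsum k) z) UNIV"
    using infsum_holomorphic(2)[OF open_uhp hol bnd zu] unfolding DERIV_imp_deriv[OF D]
    by (simp add: qsum_def[abs_def])
  moreover have "((\<lambda>n. 2 * of_real pi * \<i> * (of_nat (Suc n) ^ Suc k * nome z ^ Suc n)) has_sum
      2 * of_real pi * \<i> * qsum (Suc k) z) UNIV"
    unfolding qsum_def by (intro has_sum_cmult_right has_sum_infsum qsum_summable z)
  ultimately have "deriv (qsum k) z = 2 * of_real pi * \<i> * qsum (Suc k) z" by (rule has_sum_unique)
  moreover have "qsum k holomorphic_on uhp"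
    using infsum_holomorphic(1)[OF open_uhp hol bnd] by (simp add: qsum_def[abs_def])
  ultimately show ?thesis using holomorphic_derivI[OF _ open_uhp zu, of "qsum k" UNIV] by simp
qed

lemma uhp_not_Ints: "Im z > 0 \<Longrightarrow> z \<notin> \<int>"
  by (auto simp: Ints_def)

text \<open>
  In terms of \<open>q\<close>, \<open>\<pi>\<^sup>2/sin\<^sup>2 \<pi>z\<close> is \<open>-4\<pi>\<^sup>2 q/(1 - q)\<^sup>2\<close>, a derivative of the geometric series.
\<close>

lemma wp_sum_Ints_qsum:
  assumes z: "Im z > 0"
  shows "wp_sum \<int> z = - (of_real pi ^ 2 / 3) - 4 * of_real pi ^ 2 * qsum 1 z"
proof -
  define q where "q = nome z"
  define w where "w = exp (\<i> * (of_real pi * z))"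
  have q: "q = w ^ 2"
    by (simp add: q_def w_def nome_def exp_double[symmetric] algebra_simps)
  have w: "w \<noteq> 0" by (simp add: w_def)
  have q1: "norm q < 1" using z by (simp add: q_def norm_nome_less_1)
  then have "q \<noteq> 1" by auto
  have "sin (of_real pi * z) = (w - 1 / w) / (2 * \<i>)"
    by (simp add: sin_exp_eq w_def exp_minus inverse_eq_divide)
  also have "\<dots> = (q - 1) / (2 * \<i> * w)" using w by (simp add: q field_simps power2_eq_square)
  finally have "sin (of_real pi * z) ^ 2 = (q - 1) ^ 2 / (2 * \<i> * w) ^ 2" by (simp add: power_divide)
  also have "\<dots> = - ((1 - q) ^ 2 / (4 * q))" by (simp add: power_mult_distrib q power2_commute)
  finally have s: "of_real pi ^ 2 / sin (of_real pi * z) ^ 2 = - 4 * of_real pi ^ 2 * (q * (1 / (1 - q) ^ 2))"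
    by simp
  have "(\<lambda>n. q * (of_nat (Suc n) * q ^ n)) sums (q * (1 / (1 - q) ^ 2))"
    by (intro sums_mult geometric_deriv_sums q1)
  moreover have "(\<lambda>n. of_nat (Suc n) ^ 1 * nome z ^ Suc n) sums qsum 1 z"
    unfolding qsum_def by (intro has_sum_imp_sums has_sum_infsum qsum_summable z)
  ultimately have "qsum 1 z = q * (1 / (1 - q) ^ 2)"
    by (intro sums_unique2[of "\<lambda>n. of_nat (Suc n) ^ 1 * nome z ^ Suc n"]) (simp_all add: q_def algebra_simps)
  then show ?thesis using wp_sum_Ints[OF uhp_not_Ints[OF z]] s by simp
qed

text \<open>
  Lipschitz's formula: \<open>k + 1\<close> derivatives of the expansion above, where each one multiplies
  the \<open>n\<close>th term by \<open>2\<pi>\<i>n\<close>.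
\<close>

lemma eis_sum_Ints_qsum:
  assumes z: "Im z > 0"
  shows "eis_sum \<int> (k + 3) z = (- 2 * of_real pi * \<i>) ^ (k + 3) / fact (k + 2) * qsum (k + 2) z"
  using z
proof (induction k arbitrary: z)
  case 0
  have "((\<lambda>z. - (of_real pi ^ 2 / 3) - 4 * of_real pi ^ 2 * qsum 1 z) has_field_derivative
      0 - 4 * of_real pi ^ 2 * (2 * of_real pi * \<i> * qsum (Suc 1) z)) (at z)"
    by (intro DERIV_diff DERIV_const DERIV_cmult qsum_has_field_derivative 0)
  then have "(wp_sum \<int> has_field_derivative
      0 - 4 * of_real pi ^ 2 * (2 * of_real pi * \<i> * qsum (Suc 1) z)) (at z)"
    by (rule has_field_derivative_transform_within_open[OF _ open_uhp])
       (use 0 in \<open>auto simp: uhp_def wp_sum_Ints_qsum\<close>)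
  from DERIV_unique[OF this Z.wp_sum_has_field_derivative[OF order_refl uhp_not_Ints[OF 0]]]
  have "2 * eis_sum \<int> 3 z = 2 * (4 * of_real pi ^ 3 * \<i> * qsum 2 z)"
    by (simp add: eval_nat_numeral algebra_simps)
  then show ?case unfolding mult_cancel_left by (simp add: fact_numeral power3_eq_cube numeral_2_eq_2)
next
  case (Suc k)
  let ?C = "(- 2 * of_real pi * \<i>) ^ (k + 3) / fact (k + 2)"
  have "((\<lambda>z. ?C * qsum (k + 2) z) has_field_derivative
      ?C * (2 * of_real pi * \<i> * qsum (Suc (k + 2)) z)) (at z)"
    by (intro DERIV_cmult qsum_has_field_derivative Suc.prems)
  then have "(eis_sum \<int> (k + 3) has_field_derivative
      ?C * (2 * of_real pi * \<i> * qsum (Suc (k + 2)) z)) (at z)"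
    by (rule has_field_derivative_transform_within_open[OF _ open_uhp])
       (use Suc in \<open>auto simp: uhp_def\<close>)
  from DERIV_unique[OF this Z.eis_sum_has_field_derivative[OF order_refl _ uhp_not_Ints[OF Suc.prems]]]
  have eq: "- of_nat (k + 3) * eis_sum \<int> (Suc (k + 3)) z = ?C * (2 * of_real pi * \<i> * qsum (Suc (k + 2)) z)"
    by simp
  define x f c where "x = (of_nat (k + 3) :: complex)" and "f = (fact (k + 2) :: complex)"
    and "c = - 2 * of_real pi * \<i>"
  have "x \<noteq> 0" unfolding x_def of_nat_eq_0_iff by simp
  moreover have "f \<noteq> 0" unfolding f_def by (rule fact_nonzero)
  moreover have "2 * of_real pi * \<i> = - c" by (simp add: c_def)
  with eq have "- x * eis_sum \<int> (Suc (k + 3)) z = c ^ (k + 3) / f * (- c * qsum (Suc (k + 2)) z)"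
    by (simp only: x_def f_def c_def)
  then have "x * eis_sum \<int> (Suc (k + 3)) z = c ^ (k + 3) / f * (c * qsum (Suc (k + 2)) z)" by simp
  ultimately have "eis_sum \<int> (Suc (k + 3)) z = c * c ^ (k + 3) / (x * f) * qsum (Suc (k + 2)) z"
    by (simp add: field_simps)
  moreover have "c * c ^ (k + 3) = c ^ (Suc k + 3)" by (simp flip: power_Suc)
  moreover have "fact (Suc k + 2) = x * f"
    unfolding x_def f_def using fact_Suc[of "k + 2", where ?'a = complex] by (simp del: fact_Suc)
  ultimately have "eis_sum \<int> (Suc (k + 3)) z = c ^ (Suc k + 3) / fact (Suc k + 2) * qsum (Suc (k + 2)) z"
    by (simp only:)
  then show ?case by (simp only: c_def add_Suc)
qed

text \<open>
  Collect the terms of the absolutely convergent double series with the same product \<open>(m + 1)(n + 1)\<close>.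
\<close>

lemma lambert_series:
  fixes q :: complex
  assumes q: "norm q < 1"
  shows "(\<lambda>N. of_nat (sigma j (Suc N)) * q ^ Suc N) sums
    (\<Sum>\<^sub>\<infinity>m::nat. \<Sum>\<^sub>\<infinity>n::nat. of_nat (Suc n) ^ j * q ^ (Suc m * Suc n))"
proof -
  define h where "h = (\<lambda>(m::nat, n::nat). of_nat (Suc n) ^ j * q ^ (Suc m * Suc n) :: complex)"
  define r where "r = max (norm q) (1 / 2)"
  have r: "0 < r" "r < 1" "norm q \<le> r" using q by (auto simp: r_def)
  have "h summable_on UNIV \<times> UNIV"
  proof (rule abs_summable_summable, rule summable_on_comparison_test)
    let ?b = "\<lambda>n. real (Suc n) ^ j * r ^ Suc n"
    have geo: "(\<lambda>m. r ^ m) summable_on UNIV"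
      using r by (subst summable_on_UNIV_nonneg_real_iff) (auto intro: summable_geometric)
    show "(\<lambda>(m, n). r ^ m * ?b n) summable_on UNIV \<times> UNIV"
      by (intro summable_on_SigmaI[where g = "\<lambda>m. r ^ m * infsum ?b UNIV"])
         (use geo r summable_power_times_geometric[OF r(1,2), of j] in
           \<open>auto intro!: has_sum_cmult_right has_sum_infsum summable_on_cmult_left simp del: of_nat_Suc power_Suc\<close>)
    show "norm (h i) \<le> (case i of (m, n) \<Rightarrow> r ^ m * ?b n)" for i
    proof (cases i)
      case (Pair m n)
      have "norm q ^ (Suc m * Suc n) \<le> r ^ (Suc m * Suc n)" using r by (intro power_mono) auto
      also have "\<dots> \<le> r ^ (m + Suc n)" using r by (intro power_decreasing) auto
      finally have "norm q ^ (Suc m * Suc n) \<le> r ^ m * r ^ Suc n" by (simp only: power_add)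
      then have "real (Suc n) ^ j * norm q ^ (Suc m * Suc n) \<le> real (Suc n) ^ j * (r ^ m * r ^ Suc n)"
        by (intro mult_left_mono) auto
      then show ?thesis
        by (simp add: Pair h_def norm_mult norm_power mult_ac del: of_nat_Suc power_Suc mult_Suc mult_Suc_right)
    qed
  qed auto
  then have h: "h summable_on UNIV" by simp
  have "(\<Sum>\<^sub>\<infinity>m::nat. \<Sum>\<^sub>\<infinity>n::nat. of_nat (Suc n) ^ j * q ^ (Suc m * Suc n)) = infsum h (UNIV \<times> UNIV)"
    using infsum_Sigma'_banach[of "\<lambda>m n. h (m, n)" UNIV "\<lambda>_. UNIV"] h by (simp add: h_def)
  define h' where "h' = (\<lambda>(N, d). of_nat d ^ j * q ^ Suc N)"
  define D where "D = Sigma (UNIV :: nat set) (\<lambda>N. {d. d dvd Suc N})"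
  have bij: "(h has_sum S) UNIV \<longleftrightarrow> (h' has_sum S) D" for S
  proof (rule has_sum_reindex_bij_witness[where
        i = "\<lambda>(N, d). (Suc N div d - 1, d - 1)" and j = "\<lambda>(m, n). (Suc m * Suc n - 1, Suc n)"])
    fix b assume "b \<in> D"
    then obtain N d where b: "b = (N, d)" "d dvd Suc N" by (auto simp: D_def)
    from b(2) obtain e where e: "Suc N = d * e" by (rule dvdE)
    then have "d > 0" "e > 0" by (auto intro: Nat.gr0I)
    moreover have "Suc N div d = e" unfolding e using \<open>d > 0\<close> by simp
    moreover have "e * d = Suc N" by (simp add: e)
    ultimately show "(case case b of (N, d) \<Rightarrow> (Suc N div d - 1, d - 1) of (m, n) \<Rightarrow> (Suc m * Suc n - 1, Suc n)) = b"
      using b(1) by (simp del: mult_Suc mult_Suc_right)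
  next
    fix a :: "nat \<times> nat"
    obtain m n where a: "a = (m, n)" by (cases a)
    show "(case case a of (m, n) \<Rightarrow> (Suc m * Suc n - 1, Suc n) of (N, d) \<Rightarrow> (Suc N div d - 1, d - 1)) = a"
    proof -
      have "Suc (Suc m * Suc n - 1) = Suc m * Suc n" by simp
      then show ?thesis
        by (simp only: a prod.case nonzero_mult_div_cancel_right[OF nat.distinct(2)] diff_Suc_1)
    qed
    show "(case a of (m, n) \<Rightarrow> (Suc m * Suc n - 1, Suc n)) \<in> D"
      by (simp add: a D_def del: mult_Suc mult_Suc_right)
    show "h' (case a of (m, n) \<Rightarrow> (Suc m * Suc n - 1, Suc n)) = h a"
      by (simp add: a h_def h'_def del: mult_Suc mult_Suc_right of_nat_Suc power_Suc)
  qed auto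
  have "(h has_sum infsum h UNIV) UNIV" by (rule has_sum_infsum[OF h])
  then have "(h' has_sum infsum h UNIV) (Sigma UNIV (\<lambda>N. {d. d dvd Suc N}))"
    using bij by (simp add: D_def)
  then have "((\<lambda>N. of_nat (sigma j (Suc N)) * q ^ Suc N) has_sum infsum h UNIV) UNIV"
  proof (rule has_sum_SigmaD)
    fix N :: nat
    have "finite {d. d dvd Suc N}" by simp
    then show "((\<lambda>d. h' (N, d)) has_sum of_nat (sigma j (Suc N)) * q ^ Suc N) {d. d dvd Suc N}"
      by (intro has_sum_finiteI) (simp_all add: h'_def sigma_def sum_distrib_right del: power_Suc)
  qed
  then have "(\<lambda>N. of_nat (sigma j (Suc N)) * q ^ Suc N) sums infsum h UNIV"
    by (rule has_sum_imp_sums)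
  then show ?thesis using \<open>_ = infsum h (UNIV \<times> UNIV)\<close> by simp
qed

text \<open>
  Sum over the rows \<open>m\<tau> + \<int>\<close>. The row \<open>m = 0\<close> is the lattice of integers, and the rows \<open>m\<close> and \<open>-m\<close>
  agree for even \<open>k\<close>.
\<close>

lemma eisenstein_period_lattice_sum:
  assumes \<tau>: "Im \<tau> > 0" and k: "k \<ge> 3" "even k"
  shows "eisenstein (period_lattice \<tau>) k =
    eisenstein \<int> k + 2 * (\<Sum>\<^sub>\<infinity>m::nat. eis_sum \<int> k (of_nat (Suc m) * \<tau>))"
proof -
  interpret lattice "period_lattice \<tau>" by (rule lattice_period_lattice[OF \<tau>])
  define f where "f = (\<lambda>(m::int, n::int). 1 / (of_int m * \<tau> + of_int n) ^ k)"
  have f: "f summable_on UNIV \<times> UNIV"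
    using eisenstein_summable[OF k(1)] unfolding summable_on_period_lattice[OF \<tau>] f_def by simp
  define g where "g m = (\<Sum>\<^sub>\<infinity>n. f (m, n))" for m
  have g: "g summable_on UNIV"
    using summable_on_Sigma_banach[of "\<lambda>m n. f (m, n)" UNIV "\<lambda>_. UNIV"] f by (simp add: g_def[abs_def])
  have g_eis: "g m = eis_sum \<int> k (of_int m * \<tau>)" for m
    unfolding g_def eis_sum_def infsum_Ints f_def
    by (rule infsum_reindex_bij_witness[of _ uminus uminus]) auto
  have "eisenstein (period_lattice \<tau>) k = infsum f (UNIV \<times> UNIV)"
    unfolding eisenstein_def infsum_period_lattice[OF \<tau>] f_def by simp
  also have "\<dots> = infsum g UNIV"
    using infsum_Sigma'_banach[of "\<lambda>m n. f (m, n)" UNIV "\<lambda>_. UNIV"] f by (simp add: g_def[abs_def])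
  also have "\<dots> = g 0 + 2 * (\<Sum>\<^sub>\<infinity>m::nat. g (int (Suc m)))"
  proof (rule infsum_int_even[OF g])
    show "g (- m) = g m" for m
      using Z.eis_sum_minus[of k "of_int m * \<tau>"] k by (simp add: g_eis)
  qed
  also have "g 0 = eisenstein \<int> k"
    using k by (simp add: g_eis eis_sum_def eisenstein_def)
  finally show ?thesis by (simp add: g_eis)
qed

lemma eisenstein_period_lattice_qsum:
  assumes \<tau>: "Im \<tau> > 0" and k: "k \<ge> 3" "even k"
  shows "eisenstein (period_lattice \<tau>) k = eisenstein \<int> k +
    2 * ((2 * of_real pi * \<i>) ^ k / fact (k - 1) * (\<Sum>N. of_nat (sigma (k - 1) (Suc N)) * nome \<tau> ^ Suc N))"
proof -
  define C where "C = (2 * of_real pi * \<i>) ^ k / fact (k - 1)"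
  obtain j where j: "k = j + 3" using k by (metis add.commute le_Suc_ex)
  have "eis_sum \<int> k (of_nat (Suc m) * \<tau>) =
      C * (\<Sum>\<^sub>\<infinity>n. of_nat (Suc n) ^ (k - 1) * nome \<tau> ^ (Suc m * Suc n))" for m
  proof -
    have "nome (of_nat (Suc m) * \<tau>) = nome \<tau> ^ Suc m"
      unfolding nome_def exp_of_nat_mult[symmetric] by (simp add: algebra_simps)
    moreover have "(- 2 * of_real pi * \<i>) ^ k = (2 * of_real pi * \<i>) ^ k"
      using power_minus_even[OF k(2), of "2 * of_real pi * \<i>"] by simp
    moreover have "Im (of_nat (Suc m) * \<tau>) > 0" using \<tau> by simp
    moreover have "j + 2 = k - 1" using j by simp
    ultimately show ?thesis
      unfolding C_def using eis_sum_Ints_qsum[of "of_nat (Suc m) * \<tau>" j]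
      by (simp add: j[symmetric] qsum_def power_mult del: of_nat_Suc power_Suc mult_Suc mult_Suc_right)
  qed
  then have "(\<Sum>\<^sub>\<infinity>m::nat. eis_sum \<int> k (of_nat (Suc m) * \<tau>)) =
      C * (\<Sum>\<^sub>\<infinity>m::nat. \<Sum>\<^sub>\<infinity>n. of_nat (Suc n) ^ (k - 1) * nome \<tau> ^ (Suc m * Suc n))"
    by (simp only: infsum_cmult_right')
  also have "\<dots> = C * (\<Sum>N. of_nat (sigma (k - 1) (Suc N)) * nome \<tau> ^ Suc N)"
    by (simp only: sums_unique[OF lambert_series[OF norm_nome_less_1[OF \<tau>]]])
  finally show ?thesis
    using eisenstein_period_lattice_sum[OF \<tau> k] by (simp add: C_def)
qed

lemma a_fun_eq_eisenstein:
  assumes "Im \<tau> > 0"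
  shows "a_fun \<tau> = - 15 / of_real pi ^ 4 * eisenstein (period_lattice \<tau>) 4"
proof -
  have "(2 * of_real pi * \<i>) ^ 4 / fact 3 = (8 / 3) * of_real pi ^ 4"
    by (simp add: power_mult_distrib fact_numeral)
  then show ?thesis
    using eisenstein_period_lattice_qsum[OF assms, of 4]
    by (simp add: a_fun_def eisenstein_Ints field_simps)
qed

lemma b_fun_eq_eisenstein:
  assumes "Im \<tau> > 0"
  shows "b_fun \<tau> = 35 / of_real pi ^ 6 * eisenstein (period_lattice \<tau>) 6"
proof -
  have "\<i> ^ 6 = - 1" by (simp add: eval_nat_numeral)
  then have "(2 * of_real pi * \<i>) ^ 6 / fact 5 = - (8 / 15) * of_real pi ^ 6"
    by (simp add: power_mult_distrib fact_numeral)
  then show ?thesis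
    using eisenstein_period_lattice_qsum[OF assms, of 6]
    by (simp add: b_fun_def eisenstein_Ints field_simps)
qed


section \<open>Relations between the forms\<close>

lemma eisenstein_scale:
  assumes "c \<noteq> 0"
  shows "eisenstein ((*) c ` L) k = eisenstein L k / c ^ k"
proof -
  have "eisenstein ((*) c ` L) k = (\<Sum>\<^sub>\<infinity>\<omega>\<in>L. 1 / c ^ k * (1 / \<omega> ^ k))"
    unfolding eisenstein_def using assms
    by (subst infsum_reindex) (auto simp: inj_on_def o_def power_mult_distrib)
  then show ?thesis by (simp only: infsum_cmult_right' eisenstein_def) simp
qed

lemma wp_sum_scale:
  assumes "c \<noteq> 0"
  shows "wp_sum ((*) c ` L) (c * z) = wp_sum L z / c ^ 2"
proof -
  have "wp_sum ((*) c ` L) (c * z) = (\<Sum>\<^sub>\<infinity>\<omega>\<in>L. 1 / c ^ 2 * (1 / (z - \<omega>)\<^sup>2 - 1 / \<omega>\<^sup>2))"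
    unfolding wp_sum_def using assms
  proof (subst infsum_reindex)
    have "1 / (c * z - c * \<omega>)\<^sup>2 - 1 / (c * \<omega>)\<^sup>2 = 1 / c ^ 2 * (1 / (z - \<omega>)\<^sup>2 - 1 / \<omega>\<^sup>2)" for \<omega>
      unfolding right_diff_distrib[symmetric, of c] power_mult_distrib
      by (simp add: right_diff_distrib)
    then show "infsum ((\<lambda>\<omega>. 1 / (c * z - \<omega>)\<^sup>2 - 1 / \<omega>\<^sup>2) \<circ> (*) c) L =
        (\<Sum>\<^sub>\<infinity>\<omega>\<in>L. 1 / c ^ 2 * (1 / (z - \<omega>)\<^sup>2 - 1 / \<omega>\<^sup>2))"
      by (simp only: o_def)
  qed (auto simp: inj_on_def)
  then show ?thesis by (simp only: infsum_cmult_right' wp_sum_def) simp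
qed

text \<open>
  The \<open>x\<close>-coordinate of the point \<open>u\<close> on the curve \<open>y\<^sup>2 = x\<^sup>3 + ax + b\<close>.
\<close>

definition x_torsion :: "complex \<Rightarrow> complex \<Rightarrow> complex" where
  "x_torsion \<tau> u = - wp_sum (period_lattice \<tau>) u / of_real pi ^ 2"

text \<open>
  The isogeny formulas and the division polynomial in the normalisation of \<open>a\<close>, \<open>b\<close> and \<open>x\<close>.
\<close>

lemma x_torsion_relations:
  assumes \<tau>: "Im \<tau> > 0" and u: "u \<notin> period_lattice \<tau>" "3 * u \<in> period_lattice \<tau>"
  defines "M \<equiv> {of_int k * u + \<omega> |k \<omega>. \<omega> \<in> period_lattice \<tau>}"
  defines "x \<equiv> x_torsion \<tau> u" and "a \<equiv> a_fun \<tau>" and "b \<equiv> b_fun \<tau>"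
  shows "- 15 / of_real pi ^ 4 * eisenstein M 4 = - 9 * a - 30 * x ^ 2"
    and "35 / of_real pi ^ 6 * eisenstein M 6 = - 27 * b - 42 * a * x - 70 * x ^ 3"
    and "3 * x ^ 4 = - 6 * a * x ^ 2 - 12 * b * x + a ^ 2"
proof -
  interpret lattice "period_lattice \<tau>" by (rule lattice_period_lattice[OF \<tau>])
  interpret three_isogeny "period_lattice \<tau>" u M
    unfolding M_def by (rule three_isogenyI[OF u])
  define P where "P = (of_real pi :: complex)"
  have P: "P \<noteq> 0" by (simp add: P_def)
  define p where "p = wp_sum (period_lattice \<tau>) u"
  have p: "p = - (P ^ 2 * x)" using P by (simp add: x_def x_torsion_def p_def P_def)
  have G4: "eisenstein (period_lattice \<tau>) 4 = - (P ^ 4 * a / 15)"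
    using a_fun_eq_eisenstein[OF \<tau>] P by (simp add: a_def P_def)
  have G6: "eisenstein (period_lattice \<tau>) 6 = P ^ 6 * b / 35"
    using b_fun_eq_eisenstein[OF \<tau>] P by (simp add: b_def P_def)
  show "- 15 / of_real pi ^ 4 * eisenstein M 4 = - 9 * a - 30 * x ^ 2"
    unfolding eisenstein_isogeny_4 G4 p_def[symmetric] p P_def[symmetric] using P
    by (simp add: field_simps power_mult_distrib flip: power_mult)
  show "35 / of_real pi ^ 6 * eisenstein M 6 = - 27 * b - 42 * a * x - 70 * x ^ 3"
    unfolding eisenstein_isogeny_6 G4 G6 p_def[symmetric] p P_def[symmetric] using P
    by (simp add: field_simps power_numeral_reduce)
  have "p ^ 4 = 30 * (- (P ^ 4 * a / 15)) * p\<^sup>2 + 140 * (P ^ 6 * b / 35) * p + 75 * (- (P ^ 4 * a / 15))\<^sup>2"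
    using three_division_polynomial unfolding G4 G6 p_def[symmetric] .
  then have "P ^ 8 * (3 * x ^ 4) = P ^ 8 * (- 6 * a * x ^ 2 - 12 * b * x + a ^ 2)"
    unfolding p by (simp add: field_simps power_numeral_reduce)
  then show "3 * x ^ 4 = - 6 * a * x ^ 2 - 12 * b * x + a ^ 2" using P by simp
qed

section \<open>Modular transformations\<close>

lemma SL2Z_det: "\<gamma> \<in> SL2Z \<Longrightarrow> \<gamma>$1$1 * \<gamma>$2$2 - \<gamma>$1$2 * \<gamma>$2$1 = 1"
  by (simp add: SL2Z_def det_2)

lemma aut_factor_nonzero:
  assumes "\<gamma> \<in> SL2Z" "Im \<tau> > 0"
  shows "aut_factor \<gamma> \<tau> \<noteq> 0"
proof
  assume "aut_factor \<gamma> \<tau> = 0"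
  then have "\<gamma>$2$1 = 0 \<and> \<gamma>$2$2 = 0"
    using lattice_coordinates_eq_iff[OF assms(2), of "\<gamma>$2$1" "\<gamma>$2$2" 0 0] by (simp add: aut_factor_def)
  then show False using SL2Z_det[OF assms(1)] by simp
qed

lemma Im_moebius_act:
  assumes \<gamma>: "\<gamma> \<in> SL2Z" and \<tau>: "Im \<tau> > 0"
  shows "Im (moebius_act \<gamma> \<tau>) = Im \<tau> / norm (aut_factor \<gamma> \<tau>) ^ 2"
proof -
  define a b c d where "a = real_of_int (\<gamma>$1$1)" "b = real_of_int (\<gamma>$1$2)"
    "c = real_of_int (\<gamma>$2$1)" "d = real_of_int (\<gamma>$2$2)"
  have "real_of_int (\<gamma>$1$1 * \<gamma>$2$2 - \<gamma>$1$2 * \<gamma>$2$1) = 1" using SL2Z_det[OF \<gamma>] by simp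
  then have det: "a * d - b * c = 1" by (simp add: a_b_c_d_def)
  have "Im (moebius_act \<gamma> \<tau>) = ((a * d - b * c) * Im \<tau>) / norm (aut_factor \<gamma> \<tau>) ^ 2"
    by (simp add: moebius_act_def aut_factor_def Im_divide cmod_power2 a_b_c_d_def) (simp add: algebra_simps)
  then show ?thesis by (simp add: det)
qed

lemma moebius_act_in_uhp:
  "\<gamma> \<in> SL2Z \<Longrightarrow> \<tau> \<in> uhp \<Longrightarrow> moebius_act \<gamma> \<tau> \<in> uhp"
  using aut_factor_nonzero by (simp add: uhp_def Im_moebius_act)

lemma period_lattice_moebius_act:
  assumes \<gamma>: "\<gamma> \<in> SL2Z" and \<tau>: "Im \<tau> > 0"
  shows "period_lattice \<tau> = (*) (aut_factor \<gamma> \<tau>) ` period_lattice (moebius_act \<gamma> \<tau>)"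
proof -
  define a b c d where "a = \<gamma>$1$1" "b = \<gamma>$1$2" "c = \<gamma>$2$1" "d = \<gamma>$2$2"
  have det: "a * d - b * c = 1" using SL2Z_det[OF \<gamma>] by (simp add: a_b_c_d_def)
  have *: "aut_factor \<gamma> \<tau> * (of_int m + of_int n * moebius_act \<gamma> \<tau>) =
      of_int (m * d + n * b) + of_int (m * c + n * a) * \<tau>" for m n
  proof -
    have "aut_factor \<gamma> \<tau> * moebius_act \<gamma> \<tau> = of_int a * \<tau> + of_int b"
      using aut_factor_nonzero[OF assms] by (simp add: moebius_act_def a_b_c_d_def)
    then have "aut_factor \<gamma> \<tau> * (of_int m + of_int n * moebius_act \<gamma> \<tau>) =
        of_int m * aut_factor \<gamma> \<tau> + of_int n * (of_int a * \<tau> + of_int b)"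
      by (simp add: algebra_simps)
    then show ?thesis by (simp add: aut_factor_def a_b_c_d_def algebra_simps)
  qed
  have **: "of_int m + of_int n * \<tau> = aut_factor \<gamma> \<tau> *
      (of_int (a * m - b * n) + of_int (d * n - c * m) * moebius_act \<gamma> \<tau>)" for m n
  proof -
    have "(a * m - b * n) * d + (d * n - c * m) * b = (a * d - b * c) * m"
      "(a * m - b * n) * c + (d * n - c * m) * a = (a * d - b * c) * n"
      by (simp_all add: algebra_simps)
    then show ?thesis unfolding * by (simp add: det)
  qed
  show ?thesis
  proof (intro equalityI subsetI)
    fix x assume "x \<in> period_lattice \<tau>"
    then obtain m n where "x = of_int m + of_int n * \<tau>" unfolding period_lattice_def by blast
    then show "x \<in> (*) (aut_factor \<gamma> \<tau>) ` period_lattice (moebius_act \<gamma> \<tau>)"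
      unfolding period_lattice_def ** by blast
  next
    fix x assume "x \<in> (*) (aut_factor \<gamma> \<tau>) ` period_lattice (moebius_act \<gamma> \<tau>)"
    then obtain m n where "x = aut_factor \<gamma> \<tau> * (of_int m + of_int n * moebius_act \<gamma> \<tau>)"
      unfolding period_lattice_def by blast
    then show "x \<in> period_lattice \<tau>" unfolding period_lattice_def * by blast
  qed
qed

lemma eisenstein_moebius_act:
  assumes "\<gamma> \<in> SL2Z" and "Im \<tau> > 0"
  shows "eisenstein (period_lattice (moebius_act \<gamma> \<tau>)) k = aut_factor \<gamma> \<tau> ^ k * eisenstein (period_lattice \<tau>) k"
  using eisenstein_scale[OF aut_factor_nonzero[OF assms], of "period_lattice (moebius_act \<gamma> \<tau>)" k]
    aut_factor_nonzero[OF assms]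
  by (simp add: period_lattice_moebius_act[OF assms, symmetric])

lemma
  assumes "\<gamma> \<in> SL2Z" and \<tau>: "\<tau> \<in> uhp"
  shows slash_a_fun: "slash 4 a_fun \<gamma> \<tau> = a_fun \<tau>"
    and slash_b_fun: "slash 6 b_fun \<gamma> \<tau> = b_fun \<tau>"
proof -
  have "Im \<tau> > 0" using \<tau> by (simp add: uhp_def)
  moreover have "Im (moebius_act \<gamma> \<tau>) > 0" using moebius_act_in_uhp assms by (simp add: uhp_def)
  ultimately show "slash 4 a_fun \<gamma> \<tau> = a_fun \<tau>" "slash 6 b_fun \<gamma> \<tau> = b_fun \<tau>"
    using assms(1) aut_factor_nonzero
    by (simp_all add: slash_def a_fun_eq_eisenstein b_fun_eq_eisenstein eisenstein_moebius_act)
qed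

definition xP_fun :: "complex \<Rightarrow> complex" where
  "xP_fun \<tau> = - weierstrass_p (1/3) (period_lattice \<tau>) / of_real pi ^ 2"

lemma xP_fun_eq:
  assumes "Im \<tau> > 0"
  shows "xP_fun \<tau> = x_torsion \<tau> (1 / 3)"
proof -
  interpret lattice "period_lattice \<tau>" by (rule lattice_period_lattice[OF assms])
  show ?thesis
    by (simp add: xP_fun_def x_torsion_def weierstrass_p_eq one_third_notin assms)
qed

text \<open>
  The conjugates of \<open>x\<^sub>P\<close> are the \<open>x\<close>-coordinates of the other points of order three.
\<close>

lemma slash_xP_fun:
  assumes "\<gamma> \<in> SL2Z" and \<tau>: "\<tau> \<in> uhp"
  shows "slash 2 xP_fun \<gamma> \<tau> = x_torsion \<tau> (aut_factor \<gamma> \<tau> / 3)"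
proof -
  have \<tau>': "Im \<tau> > 0" using \<tau> by (simp add: uhp_def)
  have "Im (moebius_act \<gamma> \<tau>) > 0" using moebius_act_in_uhp assms by (simp add: uhp_def)
  then have "slash 2 xP_fun \<gamma> \<tau> = x_torsion (moebius_act \<gamma> \<tau>) (1 / 3) / aut_factor \<gamma> \<tau> ^ 2"
    by (simp add: slash_def xP_fun_eq)
  also have "\<dots> = x_torsion \<tau> (aut_factor \<gamma> \<tau> / 3)"
    using wp_sum_scale[OF aut_factor_nonzero[OF assms(1) \<tau>'], of "period_lattice (moebius_act \<gamma> \<tau>)" "1 / 3"]
    by (simp add: x_torsion_def period_lattice_moebius_act[OF assms(1) \<tau>', symmetric])
  finally show ?thesis .
qed

lemma torsion_point:
  assumes \<gamma>: "\<gamma> \<in> SL2Z" and \<tau>: "Im \<tau> > 0"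
  shows "aut_factor \<gamma> \<tau> / 3 \<notin> period_lattice \<tau>" "3 * (aut_factor \<gamma> \<tau> / 3) \<in> period_lattice \<tau>"
proof
  assume "aut_factor \<gamma> \<tau> / 3 \<in> period_lattice \<tau>"
  then obtain m n where "aut_factor \<gamma> \<tau> / 3 = of_int m + of_int n * \<tau>"
    unfolding period_lattice_def by blast
  then have "of_int (\<gamma>$2$1) * \<tau> + of_int (\<gamma>$2$2) = of_int (3 * n) * \<tau> + of_int (3 * m)"
    by (simp add: aut_factor_def field_simps)
  then have "\<gamma>$2$1 = 3 * n" "\<gamma>$2$2 = 3 * m"
    unfolding lattice_coordinates_eq_iff[OF \<tau>] by blast+
  then have "3 dvd \<gamma>$1$1 * \<gamma>$2$2 - \<gamma>$1$2 * \<gamma>$2$1" by simp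
  then show False using SL2Z_det[OF \<gamma>] by simp
next
  show "3 * (aut_factor \<gamma> \<tau> / 3) \<in> period_lattice \<tau>"
  proof -
    have "3 * (aut_factor \<gamma> \<tau> / 3) = of_int (\<gamma>$2$2) + of_int (\<gamma>$2$1) * \<tau>"
      by (simp add: aut_factor_def)
    then show ?thesis unfolding period_lattice_def by blast
  qed
qed

text \<open>
  If \<open>3\<close> divides \<open>c\<close>, then \<open>d\<close> is \<open>\<plusminus>1\<close> modulo \<open>3\<close>, so the point \<open>(c\<tau> + d)/3\<close> is \<open>\<plusminus>1/3\<close> modulo the lattice,
  and the Weierstrass function is even.
\<close>

lemma slash_xP_fun_Gamma0:
  assumes \<gamma>: "\<gamma> \<in> Gamma0 3" and \<tau>: "\<tau> \<in> uhp"
  shows "slash 2 xP_fun \<gamma> \<tau> = xP_fun \<tau>"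
proof -
  have \<tau>': "Im \<tau> > 0" using \<tau> by (simp add: uhp_def)
  interpret lattice "period_lattice \<tau>" by (rule lattice_period_lattice[OF \<tau>'])
  have SL: "\<gamma> \<in> SL2Z" using \<gamma> by (simp add: Gamma0_def)
  obtain c where c: "\<gamma>$2$1 = 3 * c" using \<gamma> by (auto simp: Gamma0_def)
  have "\<exists>e. \<gamma>$2$2 = 3 * e \<or> \<gamma>$2$2 = 3 * e + 1 \<or> \<gamma>$2$2 = 3 * e - 1" by presburger
  then obtain e where e: "\<gamma>$2$2 = 3 * e \<or> \<gamma>$2$2 = 3 * e + 1 \<or> \<gamma>$2$2 = 3 * e - 1" by blast
  define \<omega> where "\<omega> = of_int e + of_int c * \<tau>"
  have \<omega>: "\<omega> \<in> period_lattice \<tau>" unfolding \<omega>_def period_lattice_def by blast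
  have "\<gamma>$2$2 \<noteq> 3 * e"
  proof
    assume "\<gamma>$2$2 = 3 * e"
    then have "3 dvd \<gamma>$1$1 * \<gamma>$2$2 - \<gamma>$1$2 * \<gamma>$2$1" using c by simp
    then show False using SL2Z_det[OF SL] by simp
  qed
  with e have "(of_int (\<gamma>$2$2) :: complex) = of_int (3 * e + 1) \<or> (of_int (\<gamma>$2$2) :: complex) = of_int (3 * e - 1)"
    by (elim disjE) (simp_all only: simp_thms)
  then have "aut_factor \<gamma> \<tau> = 3 * \<omega> + 1 \<or> aut_factor \<gamma> \<tau> = 3 * \<omega> - 1"
    unfolding aut_factor_def c \<omega>_def by (elim disjE) (simp_all add: algebra_simps)
  then have "aut_factor \<gamma> \<tau> / 3 = 1 / 3 + \<omega> \<or> aut_factor \<gamma> \<tau> / 3 = - (1 / 3) + \<omega>"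
    by auto
  moreover have n: "1 / 3 \<notin> period_lattice \<tau>" "- (1 / 3) \<notin> period_lattice \<tau>"
    using one_third_notin[OF \<tau>'] by (simp_all only: uminus_mem_iff not_False_eq_True)
  ultimately have "wp_sum (period_lattice \<tau>) (aut_factor \<gamma> \<tau> / 3) = wp_sum (period_lattice \<tau>) (1 / 3)"
    using wp_sum_periodic[OF \<omega> n(1)] wp_sum_periodic[OF \<omega> n(2)] wp_sum_minus[of "1 / 3"]
    by (elim disjE) (simp_all only:)
  then show ?thesis
    by (simp add: slash_xP_fun[OF SL \<tau>] xP_fun_eq[OF \<tau>'] x_torsion_def)
qed

section \<open>Power series in the nome\<close>

definition sigma_fps :: "nat \<Rightarrow> complex fps" where
  "sigma_fps k = Abs_fps (\<lambda>n. of_nat (sigma k n))"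

lemma sigma_0 [simp]: "sigma k 0 = 0"
  by (simp add: sigma_def)

lemma sigma_1: "sigma k (Suc 0) = 1"
  by (simp add: sigma_def)

text \<open>
  The Lambert series converges for every \<open>q\<close> in the open unit disc.
\<close>

lemma sigma_fps_conv_radius: "fps_conv_radius (sigma_fps k) \<ge> 1"
  unfolding fps_conv_radius_def
proof (rule conv_radius_geI_ex')
  fix r :: real assume r: "0 < r" "ereal r < 1"
  then have "norm (of_real r :: complex) < 1" by simp
  from sums_summable[OF lambert_series[OF this, of k]]
  have "summable (\<lambda>n. fps_nth (sigma_fps k) (Suc n) * of_real r ^ Suc n)" by (simp add: sigma_fps_def)
  then show "summable (\<lambda>n. fps_nth (sigma_fps k) n * of_real r ^ n)" by (subst (asm) summable_Suc_iff)
qed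

lemma eval_sigma_fps:
  assumes "norm q < 1"
  shows "eval_fps (sigma_fps k) q = (\<Sum>n. of_nat (sigma k (Suc n)) * q ^ Suc n)"
proof -
  have "summable (\<lambda>n. of_nat (sigma k (Suc n)) * q ^ Suc n)"
    by (rule sums_summable[OF lambert_series[OF assms]])
  then have "summable (\<lambda>n. of_nat (sigma k n) * q ^ n)" by (subst (asm) summable_Suc_iff)
  from suminf_split_head[OF this] show ?thesis by (simp add: eval_fps_def sigma_fps_def)
qed

lemma sigma_fps_holomorphic: "eval_fps (sigma_fps k) holomorphic_on ball 0 1"
proof (rule holomorphic_on_eval_fps)
  show "ball 0 1 \<subseteq> eball 0 (fps_conv_radius (sigma_fps k))"
    using eball_mono[OF sigma_fps_conv_radius, of 0 k] by (simp add: eball_def ball_def one_ereal_def)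
qed

lemma a_fun_eval: "Im \<tau> > 0 \<Longrightarrow> a_fun \<tau> = - (1/3) * (1 + 240 * eval_fps (sigma_fps 3) (nome \<tau>))"
  and b_fun_eval: "Im \<tau> > 0 \<Longrightarrow> b_fun \<tau> = (2/27) * (1 - 504 * eval_fps (sigma_fps 5) (nome \<tau>))"
  by (simp_all add: a_fun_def b_fun_def eval_sigma_fps norm_nome_less_1)

lemma sigma_fps_nome_holomorphic: "(\<lambda>\<tau>. eval_fps (sigma_fps k) (nome \<tau>)) holomorphic_on uhp"
proof -
  have "nome holomorphic_on uhp" unfolding nome_def[abs_def] by (intro holomorphic_intros)
  moreover have "nome ` uhp \<subseteq> ball 0 1" using norm_nome_less_1 by (auto simp: uhp_def)
  ultimately show ?thesis
    using holomorphic_on_compose_gen[OF _ sigma_fps_holomorphic, of nome uhp k] by (simp add: o_def)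
qed

lemma a_fun_holomorphic: "a_fun holomorphic_on uhp"
proof (rule holomorphic_transform)
  show "(\<lambda>\<tau>. - (1/3) * (1 + 240 * eval_fps (sigma_fps 3) (nome \<tau>))) holomorphic_on uhp"
    by (intro holomorphic_intros sigma_fps_nome_holomorphic)
qed (simp add: uhp_def a_fun_eval)

lemma b_fun_holomorphic: "b_fun holomorphic_on uhp"
proof (rule holomorphic_transform)
  show "(\<lambda>\<tau>. (2/27) * (1 - 504 * eval_fps (sigma_fps 5) (nome \<tau>))) holomorphic_on uhp"
    by (intro holomorphic_intros sigma_fps_nome_holomorphic)
qed (simp add: uhp_def b_fun_eval)

lemma bounded_sigma_fps_nome: "\<exists>C. \<forall>\<tau>. Im \<tau> \<ge> 1 \<longrightarrow> norm (eval_fps (sigma_fps k) (nome \<tau>)) \<le> C"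
proof -
  define r where "r = exp (- 2 * pi)"
  have "r < 1" by (simp add: r_def)
  then have "continuous_on (cball 0 r) (eval_fps (sigma_fps k))"
    by (intro holomorphic_on_imp_continuous_on holomorphic_on_subset[OF sigma_fps_holomorphic]) auto
  then have "bounded (eval_fps (sigma_fps k) ` cball 0 r)"
    by (intro compact_imp_bounded compact_continuous_image) auto
  then obtain C where C: "\<forall>x \<in> eval_fps (sigma_fps k) ` cball 0 r. norm x \<le> C"
    unfolding bounded_iff by blast
  have "norm (eval_fps (sigma_fps k) (nome \<tau>)) \<le> C" if "Im \<tau> \<ge> 1" for \<tau>
    using that by (intro C[rule_format] imageI) (simp add: norm_nome r_def)
  then show ?thesis by blast
qed

lemma bounded_affine:
  fixes f :: "complex \<Rightarrow> complex"
  assumes "\<exists>C. \<forall>\<tau>. Im \<tau> \<ge> 1 \<longrightarrow> norm (f \<tau>) \<le> C"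
  shows "\<exists>C. \<forall>\<tau>. Im \<tau> \<ge> 1 \<longrightarrow> norm (\<alpha> * (1 + \<beta> * f \<tau>)) \<le> C"
proof -
  obtain C where C: "\<And>\<tau>. Im \<tau> \<ge> 1 \<Longrightarrow> norm (f \<tau>) \<le> C" using assms by blast
  have "norm (\<alpha> * (1 + \<beta> * f \<tau>)) \<le> norm \<alpha> * (1 + norm \<beta> * C)" if "Im \<tau> \<ge> 1" for \<tau>
  proof -
    have "norm (1 + \<beta> * f \<tau>) \<le> 1 + norm \<beta> * norm (f \<tau>)"
      using norm_triangle_ineq[of 1 "\<beta> * f \<tau>"] by (simp add: norm_mult)
    also have "\<dots> \<le> 1 + norm \<beta> * C" using C[OF that] by (intro add_left_mono mult_left_mono) auto
    finally show ?thesis unfolding norm_mult by (intro mult_left_mono) auto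
  qed
  then show ?thesis by blast
qed

lemma bounded_a_fun: "\<exists>C. \<forall>\<tau>. Im \<tau> \<ge> 1 \<longrightarrow> norm (a_fun \<tau>) \<le> C"
  using bounded_affine[OF bounded_sigma_fps_nome, of "- (1/3)" 240 3] by (simp add: a_fun_eval)

lemma bounded_b_fun: "\<exists>C. \<forall>\<tau>. Im \<tau> \<ge> 1 \<longrightarrow> norm (b_fun \<tau>) \<le> C"
  using bounded_affine[OF bounded_sigma_fps_nome, of "2/27" "- 504" 5] by (simp add: b_fun_eval)

lemma xP_fun_holomorphic: "xP_fun holomorphic_on uhp"
  unfolding xP_fun_def[abs_def] by (intro holomorphic_intros wp_one_third_holomorphic) auto

lemma quartic_root_bound:
  fixes x :: complex
  assumes eq: "3 * x ^ 4 = - 6 * a * x ^ 2 - 12 * b * x + a ^ 2"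
    and a: "norm a \<le> A" and b: "norm b \<le> B"
  shows "norm x \<le> 1 + (6 * A + 12 * B + A ^ 2)"
proof (cases "norm x \<le> 1")
  case True
  have "A \<ge> 0" "B \<ge> 0" using a b norm_ge_zero order_trans by blast+
  then have "6 * A + 12 * B + A ^ 2 \<ge> 0" by simp
  with True show ?thesis by simp
next
  case False
  define y where "y = norm x"
  have y: "y > 1" using False by (simp add: y_def)
  have "3 * y ^ 4 = norm (- 6 * a * x ^ 2 - 12 * b * x + a ^ 2)"
    unfolding eq[symmetric] by (simp add: norm_mult norm_power y_def)
  also have "\<dots> \<le> 6 * norm a * y ^ 2 + 12 * norm b * y + norm a ^ 2"
  proof -
    have "norm (- 6 * a * x ^ 2 - 12 * b * x + a ^ 2) \<le> norm (- 6 * a * x ^ 2) + norm (12 * b * x) + norm (a ^ 2)"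
      by (intro order_trans[OF norm_triangle_ineq] add_right_mono norm_triangle_ineq4)
    then show ?thesis by (simp add: norm_mult norm_power y_def)
  qed
  also have "\<dots> \<le> 6 * A * y ^ 3 + 12 * B * y ^ 3 + A ^ 2 * y ^ 3"
  proof (intro add_mono)
    have A: "A \<ge> 0" using a norm_ge_zero order_trans by blast
    have B: "B \<ge> 0" using b norm_ge_zero order_trans by blast
    have yy: "y ^ 2 \<le> y ^ 3" "y \<le> y ^ 3" "1 \<le> y ^ 3"
      using y power_increasing[of 2 3 y] power_increasing[of 1 3 y] one_le_power[of y 3] by auto
    show "6 * norm a * y ^ 2 \<le> 6 * A * y ^ 3" using a A yy y by (intro mult_mono) auto
    show "12 * norm b * y \<le> 12 * B * y ^ 3" using b B yy y by (intro mult_mono) auto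
    have "norm a ^ 2 * 1 \<le> A ^ 2 * y ^ 3" using a yy by (intro mult_mono power_mono) auto
    then show "norm a ^ 2 \<le> A ^ 2 * y ^ 3" by simp
  qed
  finally have "y ^ 3 * (3 * y) \<le> y ^ 3 * (6 * A + 12 * B + A ^ 2)"
    by (simp add: algebra_simps power_numeral_reduce)
  then have "3 * y \<le> 6 * A + 12 * B + A ^ 2" using y by simp
  then show ?thesis using y by (simp add: y_def)
qed

text \<open>
  No expansion at the cusps is computed: each conjugate is a root of the quartic, whose coefficients are
  polynomials in the bounded functions \<open>a\<close> and \<open>b\<close>.
\<close>

lemma bounded_slash_xP_fun:
  assumes \<gamma>: "\<gamma> \<in> SL2Z"
  shows "\<exists>C. \<forall>\<tau>. Im \<tau> \<ge> 1 \<longrightarrow> norm (slash 2 xP_fun \<gamma> \<tau>) \<le> C"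
proof -
  obtain A B where AB: "\<And>\<tau>. Im \<tau> \<ge> 1 \<Longrightarrow> norm (a_fun \<tau>) \<le> A" "\<And>\<tau>. Im \<tau> \<ge> 1 \<Longrightarrow> norm (b_fun \<tau>) \<le> B"
    using bounded_a_fun bounded_b_fun by blast
  have "norm (slash 2 xP_fun \<gamma> \<tau>) \<le> 1 + (6 * A + 12 * B + A ^ 2)" if "Im \<tau> \<ge> 1" for \<tau>
  proof -
    have \<tau>: "Im \<tau> > 0" using that by simp
    show ?thesis
      using x_torsion_relations(3)[OF \<tau> torsion_point[OF \<gamma> \<tau>]] AB[OF that]
      by (subst slash_xP_fun[OF \<gamma>]) (auto simp: uhp_def \<tau> intro!: quartic_root_bound)
  qed
  then show ?thesis by blast
qed

text \<open>
  For \<open>u = 1/3\<close> the larger lattice is \<open>(\<int> + 3\<tau>\<int>)/3\<close>, which accounts for the powers of 3 in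
  \<open>a'\<close> and \<open>b'\<close>.
\<close>

lemma isogenous_forms:
  assumes \<tau>: "Im \<tau> > 0"
  shows "3 ^ 4 * a_fun (3 * \<tau>) = - 9 * a_fun \<tau> - 30 * xP_fun \<tau> ^ 2"
    and "3 ^ 6 * b_fun (3 * \<tau>) = - 27 * b_fun \<tau> - 42 * a_fun \<tau> * xP_fun \<tau> - 70 * xP_fun \<tau> ^ 3"
proof -
  have \<tau>': "Im (3 * \<tau>) > 0" using \<tau> by simp
  note u = one_third_notin[OF \<tau>] three_thirds_mem[of \<tau>]
  have M: "{of_int k * (1 / 3) + \<omega> |k \<omega>. \<omega> \<in> period_lattice \<tau>} = (*) (1 / 3) ` period_lattice (3 * \<tau>)"
  proof (intro equalityI subsetI)
    fix x assume "x \<in> {of_int k * (1 / 3) + \<omega> |k \<omega>. \<omega> \<in> period_lattice \<tau>}"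
    then obtain k m n where "x = of_int k * (1 / 3) + (of_int m + of_int n * \<tau>)"
      by (auto simp: period_lattice_def)
    then have "x = 1 / 3 * (of_int (k + 3 * m) + of_int n * (3 * \<tau>))" by (simp add: algebra_simps)
    then show "x \<in> (*) (1 / 3) ` period_lattice (3 * \<tau>)" unfolding period_lattice_def by blast
  next
    fix x assume "x \<in> (*) (1 / 3) ` period_lattice (3 * \<tau>)"
    then obtain m n where "x = 1 / 3 * (of_int m + of_int n * (3 * \<tau>))"
      by (auto simp: period_lattice_def)
    then have "x = of_int m * (1 / 3) + (of_int 0 + of_int n * \<tau>)" by (simp add: field_simps)
    then show "x \<in> {of_int k * (1 / 3) + \<omega> |k \<omega>. \<omega> \<in> period_lattice \<tau>}"
      unfolding period_lattice_def by blast
  qed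
  have third: "(1 / 3 :: complex) \<noteq> 0" by simp
  show "3 ^ 4 * a_fun (3 * \<tau>) = - 9 * a_fun \<tau> - 30 * xP_fun \<tau> ^ 2"
    using x_torsion_relations(1)[OF \<tau> u, unfolded M eisenstein_scale[OF third]]
    by (simp add: xP_fun_eq[OF \<tau>] a_fun_eq_eisenstein[OF \<tau>'] power_divide)
  show "3 ^ 6 * b_fun (3 * \<tau>) = - 27 * b_fun \<tau> - 42 * a_fun \<tau> * xP_fun \<tau> - 70 * xP_fun \<tau> ^ 3"
    using x_torsion_relations(2)[OF \<tau> u, unfolded M eisenstein_scale[OF third]]
    by (simp add: xP_fun_eq[OF \<tau>] b_fun_eq_eisenstein[OF \<tau>'] power_divide)
qed

section \<open>The conjugates of the torsion coordinate\<close>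

text \<open>
  For \<open>j = 0, 1, 2\<close> these matrices represent, together with the identity, the cosets of \<open>\<Gamma>\<^sub>0(3)\<close> in \<open>SL\<^sub>2(\<int>)\<close>;
  the corresponding points of order three are \<open>(\<tau> + j)/3\<close>.
\<close>

definition cusp_rep :: "int \<Rightarrow> int^2^2" where
  "cusp_rep j = vector [vector [0, - 1], vector [1, j]]"

lemma cusp_rep_in_SL2Z: "cusp_rep j \<in> SL2Z"
  by (simp add: cusp_rep_def SL2Z_def det_2)

lemma aut_factor_cusp_rep: "aut_factor (cusp_rep j) \<tau> = \<tau> + of_int j"
  by (simp add: aut_factor_def cusp_rep_def)

text \<open>
  For \<open>u = (\<tau> + j)/3\<close> the larger lattice is \<open>\<int> + \<int>u\<close>, so a conjugate of \<open>x\<^sub>P\<close> determines \<open>a(u)\<close>.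
\<close>

lemma a_fun_conjugate:
  assumes \<tau>: "Im \<tau> > 0"
  shows "a_fun ((\<tau> + of_int j) / 3) = - 9 * a_fun \<tau> - 30 * slash 2 xP_fun (cusp_rep j) \<tau> ^ 2"
proof -
  define u where "u = (\<tau> + of_int j) / 3"
  have u0: "Im u > 0" using \<tau> by (simp add: u_def)
  have u: "u \<notin> period_lattice \<tau>" "3 * u \<in> period_lattice \<tau>"
    using torsion_point[OF cusp_rep_in_SL2Z \<tau>, of j] by (simp_all add: u_def aut_factor_cusp_rep)
  have \<tau>u: "\<tau> = 3 * u - of_int j" by (simp add: u_def field_simps)
  have M: "{of_int k * u + \<omega> |k \<omega>. \<omega> \<in> period_lattice \<tau>} = period_lattice u"
  proof (intro equalityI subsetI)
    fix x assume "x \<in> {of_int k * u + \<omega> |k \<omega>. \<omega> \<in> period_lattice \<tau>}"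
    then obtain k m n where "x = of_int k * u + (of_int m + of_int n * \<tau>)"
      by (auto simp: period_lattice_def)
    then have "x = of_int (m - n * j) + of_int (k + 3 * n) * u" by (simp add: \<tau>u algebra_simps)
    then show "x \<in> period_lattice u" unfolding period_lattice_def by blast
  next
    fix x assume "x \<in> period_lattice u"
    then obtain m n where "x = of_int m + of_int n * u" by (auto simp: period_lattice_def)
    then have "x = of_int n * u + (of_int m + of_int 0 * \<tau>)" by simp
    then show "x \<in> {of_int k * u + \<omega> |k \<omega>. \<omega> \<in> period_lattice \<tau>}"
      unfolding period_lattice_def by blast
  qed
  have "slash 2 xP_fun (cusp_rep j) \<tau> = x_torsion \<tau> u"
    using \<tau> by (subst slash_xP_fun[OF cusp_rep_in_SL2Z]) (simp_all add: uhp_def aut_factor_cusp_rep u_def)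
  then show ?thesis
    using x_torsion_relations(1)[OF \<tau> u, unfolded M] a_fun_eq_eisenstein[OF u0] by (simp add: u_def)
qed


lemma sigma_fps_has_derivative_at_0: "(eval_fps (sigma_fps k) has_field_derivative 1) (at 0)"
proof -
  have "(0::ereal) < fps_conv_radius (sigma_fps k)"
    by (rule less_le_trans[OF _ sigma_fps_conv_radius]) simp
  then have "(eval_fps (sigma_fps k) has_field_derivative eval_fps (fps_deriv (sigma_fps k)) 0) (at 0)"
    by (intro has_field_derivative_eval_fps) (simp add: zero_ereal_def)
  then show ?thesis by (simp add: eval_fps_at_0 sigma_fps_def sigma_1)
qed

lemma sigma_fps_at_0: "eval_fps (sigma_fps k) 0 = 0"
  by (simp add: eval_fps_at_0 sigma_fps_def)

lemma nome_surj:
  assumes "t \<noteq> 0" "norm t < 1"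
  shows "\<exists>\<tau>. Im \<tau> > 0 \<and> nome (\<tau> / 3) = t"
proof (intro exI conjI)
  define \<tau> where "\<tau> = 3 * Ln t / (2 * of_real pi * \<i>)"
  have "ln (norm t) < 0" using assms by simp
  moreover have "Im \<tau> = - (3 * ln (norm t) / (2 * pi))"
    using assms by (simp add: \<tau>_def Im_divide power2_eq_square)
  ultimately show "Im \<tau> > 0" by (simp add: divide_neg_pos)
  show "nome (\<tau> / 3) = t" using assms by (simp add: \<tau>_def nome_def)
qed

lemma a_fun_third:
  assumes "Im \<tau> > 0"
  shows "a_fun ((\<tau> + of_int j) / 3) = - (1/3) * (1 + 240 * eval_fps (sigma_fps 3) (nome (of_int j / 3) * nome (\<tau> / 3)))"
proof -
  have "nome ((\<tau> + of_int j) / 3) = nome (of_int j / 3) * nome (\<tau> / 3)"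
    unfolding nome_def by (simp add: exp_add[symmetric] add_divide_distrib algebra_simps)
  then show ?thesis using assms by (simp add: a_fun_eval)
qed

text \<open>
  The expansion of \<open>a((\<tau> + j)/3)\<close> in powers of \<open>t = exp(2\<pi>\<i>\<tau>/3)\<close> has the linear coefficient
  \<open>-80 exp(2\<pi>\<i>j/3)\<close>, which the conjugate of \<open>x\<^sub>P\<close> thus determines.
\<close>

lemma conjugates_distinct:
  assumes eq: "\<And>\<tau>. \<tau> \<in> uhp \<Longrightarrow> slash 2 xP_fun (cusp_rep i) \<tau> = slash 2 xP_fun (cusp_rep j) \<tau>"
  shows "nome (of_int i / 3) = nome (of_int j / 3)"
proof -
  let ?F = "eval_fps (sigma_fps 3)"
  have F: "?F (nome (of_int i / 3) * t) = ?F (nome (of_int j / 3) * t)" if t: "norm t < 1" for t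
  proof (cases "t = 0")
    case False
    obtain \<tau> where \<tau>: "Im \<tau> > 0" "nome (\<tau> / 3) = t" using nome_surj[OF False t] by blast
    have "a_fun ((\<tau> + of_int i) / 3) = a_fun ((\<tau> + of_int j) / 3)"
      using eq[of \<tau>] \<tau>(1) by (simp add: a_fun_conjugate uhp_def)
    then show ?thesis by (simp add: a_fun_third \<tau>)
  qed simp
  have D: "((\<lambda>t. ?F (c * t)) has_field_derivative c) (at 0)" for c
    using DERIV_chain2[of ?F 1 "(*) c" 0 c UNIV] sigma_fps_has_derivative_at_0[of 3]
    by (auto intro!: derivative_eq_intros)
  have "((\<lambda>t. ?F (nome (of_int j / 3) * t)) has_field_derivative nome (of_int i / 3)) (at 0)"
    by (rule has_field_derivative_transform_within_open[OF D[of "nome (of_int i / 3)"], of "ball 0 1"])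
       (auto simp: F)
  from DERIV_unique[OF this D] show ?thesis .
qed

text \<open>
  Otherwise \<open>a((\<tau> + j)/3)\<close> and \<open>81 a(3\<tau>)\<close> would agree, but their constant terms are \<open>-1/3\<close> and \<open>-27\<close>.
\<close>

lemma conjugate_neq_xP:
  "\<exists>\<tau>\<in>uhp. slash 2 xP_fun (cusp_rep j) \<tau> \<noteq> xP_fun \<tau>"
proof (rule ccontr)
  assume "\<not> ?thesis"
  then have eq: "slash 2 xP_fun (cusp_rep j) \<tau> = xP_fun \<tau>" if "\<tau> \<in> uhp" for \<tau> using that by blast
  let ?F = "eval_fps (sigma_fps 3)"
  define c where "c = nome (of_int j / 3)"
  have F: "1 + 240 * ?F (c * t) = 81 * (1 + 240 * ?F (t ^ 9))" if t: "t \<noteq> 0" "norm t < 1" for t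
  proof -
    obtain \<tau> where \<tau>: "Im \<tau> > 0" "nome (\<tau> / 3) = t" using nome_surj[OF t] by blast
    have "nome (3 * \<tau>) = t ^ 9"
      unfolding \<tau>(2)[symmetric] nome_def exp_of_nat_mult[symmetric] by (simp add: algebra_simps)
    then have "a_fun (3 * \<tau>) = - (1/3) * (1 + 240 * ?F (t ^ 9))"
      using \<tau>(1) by (simp add: a_fun_eval)
    moreover have "a_fun ((\<tau> + of_int j) / 3) = - (1/3) * (1 + 240 * ?F (c * t))"
      by (simp add: a_fun_third \<tau> c_def)
    moreover have "a_fun ((\<tau> + of_int j) / 3) = 3 ^ 4 * a_fun (3 * \<tau>)"
      using eq[of \<tau>] \<tau>(1) isogenous_forms(1)[of \<tau>] a_fun_conjugate[of \<tau> j] by (simp add: uhp_def)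
    ultimately have "- (1/3) * (1 + 240 * ?F (c * t)) = - (1/3) * (81 * (1 + 240 * ?F (t ^ 9)))" by simp
    then show ?thesis unfolding mult_cancel_left by simp
  qed
  have cont: "isCont ?F 0" using sigma_fps_has_derivative_at_0 by (rule DERIV_isCont)
  have "((\<lambda>t. ?F (c * t)) \<longlongrightarrow> 0) (at 0)" "((\<lambda>t. ?F (t ^ 9)) \<longlongrightarrow> 0) (at 0)"
  proof -
    have comp: "isCont (\<lambda>t. ?F (h t)) 0" if "isCont h 0" "h 0 = 0" for h :: "complex \<Rightarrow> complex"
      using isCont_o2[OF that(1), of ?F] cont that(2) by simp
    have "isCont (\<lambda>t. ?F (c * t)) 0" "isCont (\<lambda>t. ?F (t ^ 9)) 0"
      by (rule comp; simp)+
    then show "((\<lambda>t. ?F (c * t)) \<longlongrightarrow> 0) (at 0)" "((\<lambda>t. ?F (t ^ 9)) \<longlongrightarrow> 0) (at 0)"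
      by (auto simp: isCont_def sigma_fps_at_0)
  qed
  then have "((\<lambda>t. 1 + 240 * ?F (c * t) - 81 * (1 + 240 * ?F (t ^ 9))) \<longlongrightarrow> 1 + 240 * 0 - 81 * (1 + 240 * 0)) (at 0)"
    by (intro tendsto_intros)
  moreover have "\<forall>\<^sub>F t in at 0. 1 + 240 * ?F (c * t) - 81 * (1 + 240 * ?F (t ^ 9)) = 0"
    unfolding eventually_at by (rule exI[of _ 1]) (simp add: F)
  then have "((\<lambda>t. 1 + 240 * ?F (c * t) - 81 * (1 + 240 * ?F (t ^ 9))) \<longlongrightarrow> 0) (at 0)"
    by (rule tendsto_eventually)
  ultimately have "1 + 240 * 0 - 81 * (1 + 240 * 0) = (0::complex)"
    by (rule tendsto_unique[rotated]) simp
  then show False by simp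
qed

lemma nome_third_eq_iff: "nome (of_int i / 3) = nome (of_int j / 3) \<longleftrightarrow> 3 dvd i - j"
proof
  assume "nome (of_int i / 3) = nome (of_int j / 3)"
  then obtain n where "2 * of_real pi * \<i> * (of_int i / 3) =
      2 * of_real pi * \<i> * (of_int j / 3) + of_real (real_of_int (2 * n) * pi) * \<i>"
    unfolding nome_def exp_eq by blast
  then have "2 * of_real pi * \<i> * (of_int i / 3) = 2 * of_real pi * \<i> * (of_int j / 3 + of_int n)"
    by (simp add: algebra_simps)
  then have "(of_int i / 3 :: complex) = of_int j / 3 + of_int n" unfolding mult_cancel_left by simp
  then have "3 * (of_int i / 3 :: complex) = 3 * (of_int j / 3 + of_int n)" by (simp only:)
  then have "(of_int i :: complex) = of_int (j + 3 * n)" by (simp add: distrib_left)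
  then have "i = j + 3 * n" by (simp only: of_int_eq_iff)
  then show "3 dvd i - j" by simp
next
  assume "3 dvd i - j"
  then obtain n where "i = j + 3 * n" by (metis add.commute diff_add_cancel dvdE)
  then have "2 * of_real pi * \<i> * (of_int i / 3) =
      2 * of_real pi * \<i> * (of_int j / 3) + of_real (real_of_int (2 * n) * pi) * \<i>"
    by (simp add: field_simps)
  then show "nome (of_int i / 3) = nome (of_int j / 3)"
    unfolding nome_def exp_eq by blast
qed

section \<open>The graded ring and its field of fractions\<close>

lemma hol_fun_add [simp]: "hol_fun (f + g) \<tau> = hol_fun f \<tau> + hol_fun g \<tau>"
  and hol_fun_mult [simp]: "hol_fun (f * g) \<tau> = hol_fun f \<tau> * hol_fun g \<tau>"
  and hol_fun_diff [simp]: "hol_fun (f - g) \<tau> = hol_fun f \<tau> - hol_fun g \<tau>"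
  and hol_fun_minus [simp]: "hol_fun (- f) \<tau> = - hol_fun f \<tau>"
  and hol_fun_0 [simp]: "hol_fun 0 \<tau> = 0"
  and hol_fun_1: "hol_fun 1 \<tau> = (if \<tau> \<in> uhp then 1 else 0)"
  by (simp_all add: plus_uhp_hol.rep_eq times_uhp_hol.rep_eq minus_uhp_hol.rep_eq uminus_uhp_hol.rep_eq
      zero_uhp_hol.rep_eq one_uhp_hol.rep_eq)

lemma hol_fun_power: "\<tau> \<in> uhp \<Longrightarrow> hol_fun (f ^ n) \<tau> = hol_fun f \<tau> ^ n"
  by (induction n) (simp_all add: hol_fun_1)

lemma hol_fun_numeral: "\<tau> \<in> uhp \<Longrightarrow> hol_fun (numeral n) \<tau> = numeral n"
proof -
  have "hol_fun (of_nat m) \<tau> = of_nat m" if "\<tau> \<in> uhp" for m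
    using that by (induction m) (simp_all add: hol_fun_1)
  from this[of "numeral n"] show "\<tau> \<in> uhp \<Longrightarrow> hol_fun (numeral n) \<tau> = numeral n" by simp
qed

lemma bounded_at_infinity_add:
  assumes "bounded_at_infinity f" "bounded_at_infinity g"
  shows "bounded_at_infinity (\<lambda>\<tau>. f \<tau> + g \<tau>)"
proof -
  obtain B C B' C' where *: "B > 0" "\<And>\<tau>. Im \<tau> \<ge> B \<Longrightarrow> norm (f \<tau>) \<le> C" "\<And>\<tau>. Im \<tau> \<ge> B' \<Longrightarrow> norm (g \<tau>) \<le> C'"
    using assms by (auto simp: bounded_at_infinity_def)
  have "norm (f \<tau> + g \<tau>) \<le> C + C'" if "Im \<tau> \<ge> max B B'" for \<tau>
    using *(2,3)[of \<tau>] that by (intro norm_triangle_mono) auto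
  then show ?thesis unfolding bounded_at_infinity_def using *(1) by (metis max.strict_coboundedI1)
qed

lemma bounded_at_infinity_mult:
  assumes "bounded_at_infinity f" "bounded_at_infinity g"
  shows "bounded_at_infinity (\<lambda>\<tau>. f \<tau> * g \<tau>)"
proof -
  obtain B C B' C' where *: "B > 0" "\<And>\<tau>. Im \<tau> \<ge> B \<Longrightarrow> norm (f \<tau>) \<le> C" "\<And>\<tau>. Im \<tau> \<ge> B' \<Longrightarrow> norm (g \<tau>) \<le> C'"
    using assms by (auto simp: bounded_at_infinity_def)
  have "norm (f \<tau> * g \<tau>) \<le> C * C'" if "Im \<tau> \<ge> max B B'" for \<tau>
  proof -
    have le: "norm (f \<tau>) \<le> C" "norm (g \<tau>) \<le> C'" using *(2,3)[of \<tau>] that by auto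
    then have "C \<ge> 0" using norm_ge_zero[of "f \<tau>"] by linarith
    then show ?thesis unfolding norm_mult using le by (intro mult_mono) auto
  qed
  then show ?thesis unfolding bounded_at_infinity_def using *(1) by (metis max.strict_coboundedI1)
qed

lemma slash_add: "slash k (hol_fun (f + g)) \<gamma> = (\<lambda>\<tau>. slash k (hol_fun f) \<gamma> \<tau> + slash k (hol_fun g) \<gamma> \<tau>)"
  by (simp add: slash_def fun_eq_iff add_divide_distrib)

lemma slash_mult:
  "slash (k + l) (hol_fun (f * g)) \<gamma> = (\<lambda>\<tau>. slash k (hol_fun f) \<gamma> \<tau> * slash l (hol_fun g) \<gamma> \<tau>)"
  by (simp add: slash_def fun_eq_iff power_add)

lemma slash_minus: "slash k (hol_fun (- f)) \<gamma> = (\<lambda>\<tau>. - slash k (hol_fun f) \<gamma> \<tau>)"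
  by (simp add: slash_def fun_eq_iff)

lemma slash_0: "slash k (hol_fun 0) \<gamma> = (\<lambda>_. 0)"
  by (simp add: slash_def fun_eq_iff)

lemma modular_forms_add: "f \<in> modular_forms \<Gamma> k \<Longrightarrow> g \<in> modular_forms \<Gamma> k \<Longrightarrow> f + g \<in> modular_forms \<Gamma> k"
  by (auto simp: modular_forms_def slash_add intro: bounded_at_infinity_add)

lemma modular_forms_mult:
  "f \<in> modular_forms \<Gamma> k \<Longrightarrow> g \<in> modular_forms \<Gamma> l \<Longrightarrow> f * g \<in> modular_forms \<Gamma> (k + l)"
  by (auto simp: modular_forms_def slash_mult intro: bounded_at_infinity_mult)

lemma modular_forms_minus: "f \<in> modular_forms \<Gamma> k \<Longrightarrow> - f \<in> modular_forms \<Gamma> k"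
  by (auto simp: modular_forms_def slash_minus bounded_at_infinity_def)

lemma modular_forms_0: "0 \<in> modular_forms \<Gamma> k"
  by (auto simp: modular_forms_def slash_0 bounded_at_infinity_def intro: exI[of _ 1])

lemma modular_forms_1:
  assumes "\<Gamma> \<subseteq> SL2Z"
  shows "1 \<in> modular_forms \<Gamma> 0"
proof -
  have *: "slash 0 (hol_fun 1) \<gamma> \<tau> = 1" if "\<gamma> \<in> SL2Z" "\<tau> \<in> uhp" for \<gamma> \<tau>
    using moebius_act_in_uhp[OF that] by (simp add: slash_def hol_fun_1)
  then have "norm (slash 0 (hol_fun 1) \<gamma> \<tau>) \<le> 1" if "\<gamma> \<in> SL2Z" "Im \<tau> \<ge> 1" for \<gamma> \<tau>
    using that by (simp add: uhp_def)
  then have "bounded_at_infinity (slash 0 (hol_fun 1) \<gamma>)" if "\<gamma> \<in> SL2Z" for \<gamma>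
    unfolding bounded_at_infinity_def using that zero_less_one by blast
  with * assms show ?thesis by (auto simp: modular_forms_def hol_fun_1)
qed

lemma modular_forms_sum: "(\<And>i. i \<in> I \<Longrightarrow> f i \<in> modular_forms \<Gamma> k) \<Longrightarrow> sum f I \<in> modular_forms \<Gamma> k"
  by (induction I rule: infinite_finite_induct) (auto intro: modular_forms_0 modular_forms_add)

lemma modular_ring_add: "p \<in> modular_ring \<Gamma> \<Longrightarrow> q \<in> modular_ring \<Gamma> \<Longrightarrow> p + q \<in> modular_ring \<Gamma>"
  by (auto simp: modular_ring_def intro: modular_forms_add)

lemma modular_ring_minus: "p \<in> modular_ring \<Gamma> \<Longrightarrow> - p \<in> modular_ring \<Gamma>"
  by (auto simp: modular_ring_def intro: modular_forms_minus)

lemma modular_ring_mult: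
  assumes "p \<in> modular_ring \<Gamma>" "q \<in> modular_ring \<Gamma>"
  shows "p * q \<in> modular_ring \<Gamma>"
proof -
  have "coeff p i * coeff q (n - i) \<in> modular_forms \<Gamma> n" if "i \<le> n" for i n
    using modular_forms_mult[of "coeff p i" \<Gamma> i "coeff q (n - i)" "n - i"] assms that
    by (simp add: modular_ring_def)
  then show ?thesis
    by (auto simp: modular_ring_def coeff_mult intro!: modular_forms_sum)
qed

lemma modular_ring_0: "0 \<in> modular_ring \<Gamma>"
  by (simp add: modular_ring_def modular_forms_0)

lemma modular_ring_monom: "f \<in> modular_forms \<Gamma> k \<Longrightarrow> monom f k \<in> modular_ring \<Gamma>"
  by (auto simp: modular_ring_def modular_forms_0)

lemma modular_ring_1: "\<Gamma> \<subseteq> SL2Z \<Longrightarrow> 1 \<in> modular_ring \<Gamma>"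
  using modular_ring_monom[OF modular_forms_1, of \<Gamma>] by simp

lemma modular_field_ring: "\<Gamma> \<subseteq> SL2Z \<Longrightarrow> p \<in> modular_ring \<Gamma> \<Longrightarrow> to_fract p \<in> modular_field \<Gamma>"
  unfolding modular_field_def to_fract_def using modular_ring_1[of \<Gamma>] one_neq_zero by blast

lemma modular_field_add: "x \<in> modular_field \<Gamma> \<Longrightarrow> y \<in> modular_field \<Gamma> \<Longrightarrow> x + y \<in> modular_field \<Gamma>"
  unfolding modular_field_def
  by (fastforce intro: modular_ring_add modular_ring_mult)

lemma modular_field_mult: "x \<in> modular_field \<Gamma> \<Longrightarrow> y \<in> modular_field \<Gamma> \<Longrightarrow> x * y \<in> modular_field \<Gamma>"
  unfolding modular_field_def
  by (fastforce intro: modular_ring_mult)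

lemma modular_field_minus: "x \<in> modular_field \<Gamma> \<Longrightarrow> - x \<in> modular_field \<Gamma>"
  unfolding modular_field_def
  by (fastforce intro: modular_ring_minus)

lemma modular_field_diff: "x \<in> modular_field \<Gamma> \<Longrightarrow> y \<in> modular_field \<Gamma> \<Longrightarrow> x - y \<in> modular_field \<Gamma>"
  using modular_field_add[OF _ modular_field_minus, of x \<Gamma> y] by simp

lemma modular_field_1: "\<Gamma> \<subseteq> SL2Z \<Longrightarrow> 1 \<in> modular_field \<Gamma>"
  using modular_field_ring[OF _ modular_ring_1] by simp

lemma modular_field_0: "0 \<in> modular_field \<Gamma>" if "\<Gamma> \<subseteq> SL2Z"
  using modular_field_ring[OF that modular_ring_0] by simp

lemma modular_field_numeral: "\<Gamma> \<subseteq> SL2Z \<Longrightarrow> numeral n \<in> modular_field \<Gamma>"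
proof -
  assume *: "\<Gamma> \<subseteq> SL2Z"
  have "of_nat m \<in> modular_field \<Gamma>" for m
    by (induction m) (use * in \<open>auto intro: modular_field_0 modular_field_1 modular_field_add\<close>)
  from this[of "numeral n"] show ?thesis by simp
qed

lemma modular_field_divide:
  assumes "\<Gamma> \<subseteq> SL2Z" "x \<in> modular_field \<Gamma>" "y \<in> modular_field \<Gamma>"
  shows "x / y \<in> modular_field \<Gamma>"
proof -
  obtain p q where y: "y = Fract p q" "p \<in> modular_ring \<Gamma>" "q \<in> modular_ring \<Gamma>" "q \<noteq> 0"
    using assms(3) unfolding modular_field_def by blast
  have "inverse y \<in> modular_field \<Gamma>"
  proof (cases "p = 0")
    case True
    then have "y = 0" using y by (simp add: fract_collapse)
    then show ?thesis using assms(3) by simp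
  next
    case False
    then show ?thesis using y unfolding modular_field_def by fastforce
  qed
  then show ?thesis using assms(2) by (simp add: divide_inverse modular_field_mult)
qed

lemma modular_field_power: "\<Gamma> \<subseteq> SL2Z \<Longrightarrow> x \<in> modular_field \<Gamma> \<Longrightarrow> x ^ n \<in> modular_field \<Gamma>"
  by (induction n) (auto intro: modular_field_1 modular_field_mult)

lemmas modular_field_intros = modular_field_0 modular_field_1 modular_field_numeral modular_field_add
  modular_field_diff modular_field_minus modular_field_mult modular_field_divide modular_field_power

lemma modular_field_mono: "\<Gamma> \<subseteq> \<Gamma>' \<Longrightarrow> modular_field \<Gamma>' \<subseteq> modular_field \<Gamma>"
  unfolding modular_field_def modular_ring_def modular_forms_def by blast

lemma hol_fun_xP: "\<tau> \<in> uhp \<Longrightarrow> hol_fun (hol_of xP_fun) \<tau> = xP_fun \<tau>"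
  and hol_fun_a: "\<tau> \<in> uhp \<Longrightarrow> hol_fun (hol_of a_fun) \<tau> = a_fun \<tau>"
  and hol_fun_b: "\<tau> \<in> uhp \<Longrightarrow> hol_fun (hol_of b_fun) \<tau> = b_fun \<tau>"
  by (simp_all add: hol_fun_hol_of xP_fun_holomorphic a_fun_holomorphic b_fun_holomorphic)

text \<open>
  The modularity conditions concern the extension by zero of \<open>f\<close>; it may be replaced by \<open>f\<close> itself because
  Moebius transformations preserve the half-plane.
\<close>

lemma hol_of_in_modular_forms:
  assumes f: "f holomorphic_on uhp"
    and inv: "\<And>\<gamma> \<tau>. \<gamma> \<in> \<Gamma> \<Longrightarrow> \<tau> \<in> uhp \<Longrightarrow> slash k f \<gamma> \<tau> = f \<tau>"
    and bnd: "\<And>\<gamma>. \<gamma> \<in> SL2Z \<Longrightarrow> \<exists>C. \<forall>\<tau>. Im \<tau> \<ge> 1 \<longrightarrow> norm (slash k f \<gamma> \<tau>) \<le> C"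
    and \<Gamma>: "\<Gamma> \<subseteq> SL2Z"
  shows "hol_of f \<in> modular_forms \<Gamma> k"
proof -
  have eq: "slash k (hol_fun (hol_of f)) \<gamma> \<tau> = slash k f \<gamma> \<tau>" if "\<gamma> \<in> SL2Z" "\<tau> \<in> uhp" for \<gamma> \<tau>
    using moebius_act_in_uhp[OF that] by (simp add: slash_def hol_fun_hol_of f)
  have "bounded_at_infinity (slash k (hol_fun (hol_of f)) \<gamma>)" if \<gamma>: "\<gamma> \<in> SL2Z" for \<gamma>
  proof -
    obtain C where "\<And>\<tau>. Im \<tau> \<ge> 1 \<Longrightarrow> norm (slash k f \<gamma> \<tau>) \<le> C" using bnd[OF \<gamma>] by blast
    then have "norm (slash k (hol_fun (hol_of f)) \<gamma> \<tau>) \<le> C" if "Im \<tau> \<ge> 1" for \<tau>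
      using that eq[OF \<gamma>, of \<tau>] by (simp add: uhp_def)
    then show ?thesis unfolding bounded_at_infinity_def using zero_less_one by blast
  qed
  moreover have "slash k (hol_fun (hol_of f)) \<gamma> \<tau> = hol_fun (hol_of f) \<tau>" if "\<gamma> \<in> \<Gamma>" "\<tau> \<in> uhp" for \<gamma> \<tau>
    using eq[of \<gamma> \<tau>] inv[OF that] \<Gamma> that by (auto simp: hol_fun_hol_of f)
  ultimately show ?thesis by (simp add: modular_forms_def)
qed

lemma Gamma0_subset: "Gamma0 N \<subseteq> SL2Z"
  by (auto simp: Gamma0_def)

lemma bounded_at_cusps:
  assumes "\<exists>C. \<forall>\<tau>. Im \<tau> \<ge> 1 \<longrightarrow> norm (f \<tau>) \<le> C" "\<And>\<tau>. \<tau> \<in> uhp \<Longrightarrow> slash k f \<gamma> \<tau> = f \<tau>"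
  shows "\<exists>C. \<forall>\<tau>. Im \<tau> \<ge> 1 \<longrightarrow> norm (slash k f \<gamma> \<tau>) \<le> C"
  using assms by (simp add: uhp_def)

lemma a_modular: "hol_of a_fun \<in> modular_forms SL2Z 4"
  by (rule hol_of_in_modular_forms[OF a_fun_holomorphic slash_a_fun bounded_at_cusps[OF bounded_a_fun slash_a_fun] order_refl])

lemma b_modular: "hol_of b_fun \<in> modular_forms SL2Z 6"
  by (rule hol_of_in_modular_forms[OF b_fun_holomorphic slash_b_fun bounded_at_cusps[OF bounded_b_fun slash_b_fun] order_refl])

lemma xP_modular: "hol_of xP_fun \<in> modular_forms (Gamma0 3) 2"
  by (rule hol_of_in_modular_forms[OF xP_fun_holomorphic slash_xP_fun_Gamma0 bounded_slash_xP_fun Gamma0_subset])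

lemma mf_in_modular_field:
  "mf_a \<in> modular_field SL2Z" "mf_b \<in> modular_field SL2Z" "mf_xP \<in> modular_field (Gamma0 3)"
  unfolding mf_a_def mf_b_def mf_xP_def form_def xP_fun_def[abs_def, symmetric]
  by (intro modular_field_ring modular_ring_monom a_modular b_modular xP_modular Gamma0_subset order_refl)+

lemma to_fract_numeral: "to_fract (numeral n) = numeral n"
proof -
  have "to_fract (of_nat m) = of_nat m" for m by (induction m) simp_all
  from this[of "numeral n"] show ?thesis by simp
qed

definition homog :: "nat \<Rightarrow> uhp_hol \<Rightarrow> uhp_hol poly fract" where
  "homog k f = to_fract (monom f k)"

lemma homog_add: "homog k f + homog k g = homog k (f + g)"
  and homog_diff: "homog k f - homog k g = homog k (f - g)"
  and homog_minus: "- homog k f = homog k (- f)"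
  and homog_mult: "homog k f * homog l g = homog (k + l) (f * g)"
  and homog_numeral: "numeral n * homog k f = homog k (numeral n * f)"
proof -
  show "numeral n * homog k f = homog k (numeral n * f)"
  proof -
    have "numeral n * monom f k = monom (numeral n * f) k"
      by (simp add: numeral_poly smult_monom)
    then show ?thesis unfolding homog_def by (simp flip: to_fract_numeral to_fract_mult)
  qed
qed (simp_all add: homog_def mult_monom add_monom diff_monom minus_monom
    flip: to_fract_add to_fract_diff to_fract_uminus to_fract_mult)

lemma homog_power: "homog k f ^ n = homog (n * k) (f ^ n)"
proof (induction n)
  case 0
  then show ?case by (simp add: homog_def monom_0 one_pCons[symmetric])
next
  case (Suc n)
  then show ?case by (simp add: homog_mult)
qed

section \<open>Linear independence of the powers of the torsion coordinate\<close>

lemma slash_xP_fun_holomorphic: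
  assumes \<gamma>: "\<gamma> \<in> SL2Z"
  shows "slash 2 xP_fun \<gamma> holomorphic_on uhp"
proof -
  have nz: "aut_factor \<gamma> \<tau> \<noteq> 0" if "\<tau> \<in> uhp" for \<tau>
    using aut_factor_nonzero[OF \<gamma>] that by (simp add: uhp_def)
  have aut: "aut_factor \<gamma> holomorphic_on uhp"
    unfolding aut_factor_def[abs_def] by (intro holomorphic_intros)
  have "moebius_act \<gamma> holomorphic_on uhp"
    unfolding moebius_act_def[abs_def] using nz by (intro holomorphic_intros aut) auto
  then have "(\<lambda>\<tau>. xP_fun (moebius_act \<gamma> \<tau>)) holomorphic_on uhp"
    using holomorphic_on_compose_gen[OF _ xP_fun_holomorphic, of "moebius_act \<gamma>" uhp] moebius_act_in_uhp[OF \<gamma>]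
    by (auto simp: o_def)
  then show ?thesis
    unfolding slash_def[abs_def] using nz by (intro holomorphic_intros aut) auto
qed

text \<open>
  The coefficient of degree \<open>k\<close> of the relation is \<open>\<Sum>\<^sub>i f\<^sub>i x\<^sup>i = 0\<close> with \<open>f\<^sub>i\<close> of weight \<open>k - 2i\<close>. Evaluating it
  at the transformed point multiplies every term by the same power of the automorphy factor and replaces \<open>x\<close> by
  its conjugate, as the \<open>f\<^sub>i\<close> are invariant under the whole modular group.
\<close>

lemma conjugate_root:
  assumes P: "\<And>i. i < 4 \<Longrightarrow> P i \<in> modular_ring SL2Z"
    and rel: "(\<Sum>i<4. monom (hol_of xP_fun) 2 ^ i * P i) = 0"
    and \<gamma>: "\<gamma> \<in> SL2Z"
  defines "f \<equiv> \<lambda>k i. if k < 2 * i then 0 else coeff (P i) (k - 2 * i)"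
  shows "(\<Sum>i<4. hol_of (slash 2 xP_fun \<gamma>) ^ i * f k i) = 0"
proof (rule uhp_hol_eqI)
  fix \<tau> assume \<tau>: "\<tau> \<in> uhp"
  define \<sigma> where "\<sigma> = moebius_act \<gamma> \<tau>"
  define j where "j = aut_factor \<gamma> \<tau>"
  have \<sigma>: "\<sigma> \<in> uhp" unfolding \<sigma>_def by (rule moebius_act_in_uhp[OF \<gamma> \<tau>])
  have j: "j \<noteq> 0" using aut_factor_nonzero[OF \<gamma>] \<tau> by (simp add: j_def uhp_def)
  have hol_sum: "hol_fun (sum g A) z = (\<Sum>i\<in>A. hol_fun (g i) z)" for g :: "nat \<Rightarrow> uhp_hol" and A z
    by (induction A rule: infinite_finite_induct) simp_all
  have "coeff (monom (hol_of xP_fun) 2 ^ i * P i) k = hol_of xP_fun ^ i * f k i" for i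
    by (simp add: monom_power coeff_monom_mult f_def)
  then have "(\<Sum>i<4. hol_of xP_fun ^ i * f k i) = 0"
    using arg_cong[OF rel, of "\<lambda>p. coeff p k"] by (simp add: coeff_sum)
  then have "0 = hol_fun (\<Sum>i<4. hol_of xP_fun ^ i * f k i) \<sigma>" by simp
  also have "\<dots> = (\<Sum>i<4. xP_fun \<sigma> ^ i * hol_fun (f k i) \<sigma>)"
    using \<sigma> by (simp add: hol_sum hol_fun_power hol_fun_xP)
  also have "\<dots> = (\<Sum>i<4. j ^ k * (slash 2 xP_fun \<gamma> \<tau> ^ i * hol_fun (f k i) \<tau>))"
  proof (rule sum.cong[OF refl])
    fix i :: nat assume i: "i \<in> {..<4}"
    show "xP_fun \<sigma> ^ i * hol_fun (f k i) \<sigma> = j ^ k * (slash 2 xP_fun \<gamma> \<tau> ^ i * hol_fun (f k i) \<tau>)"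
    proof (cases "k < 2 * i")
      case False
      have "f k i \<in> modular_forms SL2Z (k - 2 * i)"
        using P[of i] i False by (simp add: f_def modular_ring_def)
      then have "slash (k - 2 * i) (hol_fun (f k i)) \<gamma> \<tau> = hol_fun (f k i) \<tau>"
        using \<gamma> \<tau> by (simp add: modular_forms_def)
      then have "hol_fun (f k i) \<sigma> = j ^ (k - 2 * i) * hol_fun (f k i) \<tau>"
        using j by (simp add: slash_def \<sigma>_def[symmetric] j_def[symmetric] field_simps)
      moreover have "xP_fun \<sigma> = j ^ 2 * slash 2 xP_fun \<gamma> \<tau>"
        using j by (simp add: slash_def \<sigma>_def[symmetric] j_def[symmetric])
      moreover have "(j ^ 2) ^ i * j ^ (k - 2 * i) = j ^ k"
        using False by (simp flip: power_mult power_add)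
      ultimately show ?thesis by (simp add: power_mult_distrib mult_ac)
    qed (simp add: f_def)
  qed
  also have "\<dots> = j ^ k * hol_fun (\<Sum>i<4. hol_of (slash 2 xP_fun \<gamma>) ^ i * f k i) \<tau>"
    using \<tau> by (simp add: hol_sum hol_fun_power hol_fun_hol_of slash_xP_fun_holomorphic[OF \<gamma>] sum_distrib_left)
  finally show "hol_fun (\<Sum>i<4. hol_of (slash 2 xP_fun \<gamma>) ^ i * f k i) \<tau> = hol_fun 0 \<tau>"
    using j by simp
qed

lemma mat_1_in_SL2Z: "mat 1 \<in> SL2Z"
  by (simp add: SL2Z_def)

lemma slash_mat_1: "slash k f (mat 1) = f"
  by (simp add: slash_def fun_eq_iff moebius_act_def aut_factor_def mat_def)

lemma four_conjugates:
  "\<exists>S. card S = 4 \<and> (\<forall>y\<in>S. \<exists>\<gamma>\<in>SL2Z. y = hol_of (slash 2 xP_fun \<gamma>))"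
proof -
  define Y where "Y j = hol_of (slash 2 xP_fun (cusp_rep j))" for j
  define X where "X = hol_of xP_fun"
  have eval: "hol_fun (Y j) \<tau> = slash 2 xP_fun (cusp_rep j) \<tau>" if "\<tau> \<in> uhp" for j \<tau>
    using that by (simp add: Y_def hol_fun_hol_of slash_xP_fun_holomorphic cusp_rep_in_SL2Z)
  have "X \<noteq> Y j" for j
  proof
    assume "X = Y j"
    then have "slash 2 xP_fun (cusp_rep j) \<tau> = xP_fun \<tau>" if "\<tau> \<in> uhp" for \<tau>
      using eval[OF that, of j] hol_fun_xP[OF that] by (simp add: X_def)
    then show False using conjugate_neq_xP[of j] by blast
  qed
  moreover have "3 dvd i - j" if "Y i = Y j" for i j
    using conjugates_distinct[of i j] eval[of _ i] eval[of _ j] that by (simp add: nome_third_eq_iff)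
  from this[of 0 1] this[of 0 2] this[of 1 2] have "Y 0 \<noteq> Y 1" "Y 0 \<noteq> Y 2" "Y 1 \<noteq> Y 2" by auto
  ultimately have "card {X, Y 0, Y 1, Y 2} = 4" by simp
  moreover have "\<exists>\<gamma>\<in>SL2Z. y = hol_of (slash 2 xP_fun \<gamma>)" if "y \<in> {X, Y 0, Y 1, Y 2}" for y
  proof -
    have "X = hol_of (slash 2 xP_fun (mat 1))" by (simp add: X_def slash_mat_1)
    then show ?thesis using that mat_1_in_SL2Z cusp_rep_in_SL2Z unfolding Y_def by blast
  qed
  ultimately show ?thesis by blast
qed

text \<open>
  In each degree the coefficients form a polynomial of degree at most three, of which the four conjugates of
  \<open>x\<^sub>P\<close> are roots.
\<close>

lemma modular_relation_trivial:
  assumes P: "\<And>i. i < 4 \<Longrightarrow> P i \<in> modular_ring SL2Z"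
    and rel: "(\<Sum>i<4. monom (hol_of xP_fun) 2 ^ i * P i) = 0"
    and i: "i < 4"
  shows "P i = 0"
proof (rule poly_eqI)
  fix n
  define k where "k = n + 2 * i"
  define f where "f i = (if k < 2 * i then 0 else coeff (P i) (k - 2 * i))" for i
  define p where "p = (\<Sum>i<4. monom (f i) i)"
  obtain S where S: "card S = 4" "\<And>y. y \<in> S \<Longrightarrow> \<exists>\<gamma>\<in>SL2Z. y = hol_of (slash 2 xP_fun \<gamma>)"
    using four_conjugates by blast
  have root: "poly p y = 0" if y: "y \<in> S" for y
  proof -
    obtain \<gamma> where "\<gamma> \<in> SL2Z" "y = hol_of (slash 2 xP_fun \<gamma>)" using S(2)[OF y] by blast
    then show ?thesis
      using conjugate_root[OF P rel, of \<gamma> k] by (simp add: p_def poly_sum poly_monom f_def mult.commute)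
  qed
  have "degree p \<le> 3" unfolding p_def
    by (intro degree_sum_le) (auto intro: order_trans[OF degree_monom_le])
  have "p = 0"
  proof (rule ccontr)
    assume "p \<noteq> 0"
    then have "card S \<le> card {y. poly p y = 0}"
      using root by (intro card_mono poly_roots_finite) auto
    also have "\<dots> \<le> degree p" by (rule card_poly_roots_bound[OF \<open>p \<noteq> 0\<close>])
    finally show False using S(1) \<open>degree p \<le> 3\<close> by simp
  qed
  then have "coeff p i = 0" by simp
  moreover have "coeff p i = f i" using i by (simp add: p_def coeff_sum)
  ultimately show "coeff (P i) n = coeff 0 n" by (simp add: f_def k_def)
qed

lemma mf_xP_eq: "mf_xP = to_fract (monom (hol_of xP_fun) 2)"
  by (simp only: mf_xP_def form_def xP_fun_def[abs_def])

text \<open>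
  A common denominator reduces a relation over the field to one over the graded ring.
\<close>

lemma power_basis_independent:
  assumes d: "\<And>i. i < 4 \<Longrightarrow> d i \<in> modular_field SL2Z"
    and rel: "(\<Sum>i<4. d i * mf_xP ^ i) = 0"
    and i: "i < (4::nat)"
  shows "d i = 0"
proof -
  have "\<exists>p q. d i = Fract p q \<and> p \<in> modular_ring SL2Z \<and> q \<in> modular_ring SL2Z \<and> q \<noteq> 0" if "i < 4" for i
    using d[OF that] unfolding modular_field_def by blast
  then obtain p q where pq: "\<And>i. i < 4 \<Longrightarrow> d i = Fract (p i) (q i) \<and> p i \<in> modular_ring SL2Z \<and> q i \<in> modular_ring SL2Z \<and> q i \<noteq> 0"
    by metis
  define P where "P i = p i * prod q ({..<4} - {i})" for i
  define Q where "Q = to_fract (prod q {..<4})"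
  have prod_ring: "prod q A \<in> modular_ring SL2Z" if "A \<subseteq> {..<4}" for A
    using finite_subset[OF that finite_lessThan] that
    by (induction A rule: finite_induct) (auto intro: modular_ring_1 modular_ring_mult simp: pq)
  have P: "P i \<in> modular_ring SL2Z" if "i < 4" for i
    unfolding P_def using pq[OF that] by (intro modular_ring_mult prod_ring) auto
  have dQ: "d i * Q = to_fract (P i)" if "i < 4" for i
  proof -
    have "prod q {..<4} = q i * prod q ({..<4} - {i})" using that by (intro prod.remove) auto
    then show ?thesis using pq[OF that] by (simp add: Q_def P_def Fract_conv_to_fract)
  qed
  have xpow: "mf_xP ^ n = to_fract (monom (hol_of xP_fun) 2 ^ n)" for n
    by (induction n) (simp_all add: mf_xP_eq)
  have "to_fract (\<Sum>i<4. monom (hol_of xP_fun) 2 ^ i * P i) = (\<Sum>i<4. d i * mf_xP ^ i) * Q"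
    unfolding sum_distrib_right by (simp add: xpow dQ[symmetric] mult_ac)
  also have "\<dots> = 0" by (simp only: rel mult_zero_left)
  finally have "(\<Sum>i<4. monom (hol_of xP_fun) 2 ^ i * P i) = 0" by (simp only: to_fract_eq_0_iff)
  then have "P i = 0" using P i modular_relation_trivial[of P i] by simp
  then have "p i = 0" using pq by (auto simp: P_def)
  then show ?thesis using pq[OF i] by (simp add: Fract_conv_to_fract)
qed

section \<open>The regular representation\<close>

lemma vector_4_nth [simp]:
  "(vector [a, b, c, d] :: 'a::zero ^ 4) $ 1 = a" "(vector [a, b, c, d] :: 'a ^ 4) $ 2 = b"
  "(vector [a, b, c, d] :: 'a ^ 4) $ 3 = c" "(vector [a, b, c, d] :: 'a ^ 4) $ 4 = d"
  by (simp_all add: vector_def)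

lemma coordinates_power_basis:
  assumes w: "w = c1 + c2 * mf_xP + c3 * mf_xP ^ 2 + c4 * mf_xP ^ 3"
    and K: "c1 \<in> modular_field SL2Z" "c2 \<in> modular_field SL2Z"
      "c3 \<in> modular_field SL2Z" "c4 \<in> modular_field SL2Z"
  shows "coordinates (modular_field SL2Z) (vector [1, mf_xP, mf_xP ^ 2, mf_xP ^ 3] :: _ ^ 4) w =
    vector [c1, c2, c3, c4]"
  unfolding coordinates_def
proof (rule the_equality)
  let ?c = "vector [c1, c2, c3, c4] :: uhp_hol poly fract ^ 4"
  show "(\<forall>i. ?c $ i \<in> modular_field SL2Z) \<and>
      w = (\<Sum>i\<in>UNIV. ?c $ i * (vector [1, mf_xP, mf_xP ^ 2, mf_xP ^ 3] :: _ ^ 4) $ i)"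
    using w K by (simp add: sum_4 forall_4)
next
  fix c'
  assume c': "(\<forall>i. c' $ i \<in> modular_field SL2Z) \<and>
      w = (\<Sum>i\<in>UNIV. c' $ i * (vector [1, mf_xP, mf_xP ^ 2, mf_xP ^ 3] :: _ ^ 4) $ i)"
  define d where "d = (\<lambda>n::nat. [c' $ 1 - c1, c' $ 2 - c2, c' $ 3 - c3, c' $ 4 - c4] ! n)"
  have lt4: "{..<4::nat} = {0, 1, 2, 3}" by auto
  have dK: "d i \<in> modular_field SL2Z" if "i < 4" for i
  proof -
    have "i \<in> {0, 1, 2, 3}" using that by auto
    then show ?thesis using K c' by (auto simp: d_def intro!: modular_field_diff)
  qed
  have "c1 + c2 * mf_xP + c3 * mf_xP ^ 2 + c4 * mf_xP ^ 3 =
      c' $ 1 + c' $ 2 * mf_xP + c' $ 3 * mf_xP ^ 2 + c' $ 4 * mf_xP ^ 3"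
    using w c' by (simp add: sum_4)
  moreover have "(\<Sum>i<4. d i * mf_xP ^ i) = (c' $ 1 + c' $ 2 * mf_xP + c' $ 3 * mf_xP ^ 2 + c' $ 4 * mf_xP ^ 3)
      - (c1 + c2 * mf_xP + c3 * mf_xP ^ 2 + c4 * mf_xP ^ 3)"
    by (simp add: lt4 d_def algebra_simps)
  ultimately have rel: "(\<Sum>i<4. d i * mf_xP ^ i) = 0" by simp
  have d0: "d i = 0" if "i < 4" for i
    by (rule power_basis_independent[OF _ rel that]) (rule dK)
  have "d 0 = 0" "d 1 = 0" "d 2 = 0" "d 3 = 0" by (rule d0; simp)+
  then show "c' = vector [c1, c2, c3, c4]" by (simp add: vec_eq_iff forall_4 d_def)
qed

lemma mf_homog:
  "mf_a = homog 4 (hol_of a_fun)" "mf_b = homog 6 (hol_of b_fun)" "mf_xP = homog 2 (hol_of xP_fun)"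
  by (simp_all only: mf_a_def mf_b_def mf_xP_eq form_def homog_def)

lemma three_times_holomorphic:
  assumes "f holomorphic_on uhp"
  shows "(\<lambda>\<tau>. c * f (3 * \<tau>)) holomorphic_on uhp"
proof -
  have "(f \<circ> (\<lambda>\<tau>. 3 * \<tau>)) holomorphic_on uhp"
    by (rule holomorphic_on_compose_gen[OF _ assms]) (auto intro!: holomorphic_intros simp: uhp_def)
  then show ?thesis by (intro holomorphic_intros) (simp add: o_def)
qed

lemma
  shows mf_a'_eq: "mf_a' = - 9 * mf_a - 30 * mf_xP ^ 2"
    and mf_b'_eq: "mf_b' = - 27 * mf_b - 42 * mf_a * mf_xP - 70 * mf_xP ^ 3"
    and mf_quartic: "3 * mf_xP ^ 4 = - 6 * mf_a * mf_xP ^ 2 - 12 * mf_b * mf_xP + mf_a ^ 2"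
proof -
  define A B X where "A = hol_of a_fun" and "B = hol_of b_fun" and "X = hol_of xP_fun"
  note eval = A_def B_def X_def hol_fun_a hol_fun_b hol_fun_xP hol_fun_power hol_fun_numeral hol_fun_hol_of
    three_times_holomorphic[OF a_fun_holomorphic] three_times_holomorphic[OF b_fun_holomorphic]
  have "hol_of (\<lambda>\<tau>. 3 ^ 4 * a_fun (3 * \<tau>)) = - (9 * A) - 30 * X ^ 2"
  proof (rule uhp_hol_eqI)
    fix \<tau> assume \<tau>: "\<tau> \<in> uhp"
    then have "3 ^ 4 * a_fun (3 * \<tau>) = - 9 * a_fun \<tau> - 30 * xP_fun \<tau> ^ 2"
      by (intro isogenous_forms) (simp add: uhp_def)
    then show "hol_fun (hol_of (\<lambda>\<tau>. 3 ^ 4 * a_fun (3 * \<tau>))) \<tau> = hol_fun (- (9 * A) - 30 * X ^ 2) \<tau>"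
      using \<tau> by (simp add: eval)
  qed
  then show "mf_a' = - 9 * mf_a - 30 * mf_xP ^ 2"
    unfolding mf_a'_def form_def homog_def[symmetric]
    by (simp add: mf_homog A_def X_def homog_power homog_numeral homog_minus homog_diff)
  have "hol_of (\<lambda>\<tau>. 3 ^ 6 * b_fun (3 * \<tau>)) = - (27 * B) - 42 * (A * X) - 70 * X ^ 3"
  proof (rule uhp_hol_eqI)
    fix \<tau> assume \<tau>: "\<tau> \<in> uhp"
    then have "3 ^ 6 * b_fun (3 * \<tau>) = - 27 * b_fun \<tau> - 42 * a_fun \<tau> * xP_fun \<tau> - 70 * xP_fun \<tau> ^ 3"
      by (intro isogenous_forms) (simp add: uhp_def)
    then show "hol_fun (hol_of (\<lambda>\<tau>. 3 ^ 6 * b_fun (3 * \<tau>))) \<tau> =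
        hol_fun (- (27 * B) - 42 * (A * X) - 70 * X ^ 3) \<tau>"
      using \<tau> by (simp add: eval)
  qed
  then show "mf_b' = - 27 * mf_b - 42 * mf_a * mf_xP - 70 * mf_xP ^ 3"
    unfolding mf_b'_def form_def homog_def[symmetric]
    by (simp add: mf_homog A_def B_def X_def homog_power homog_numeral homog_minus homog_diff homog_mult mult.assoc)
  have "3 * X ^ 4 = - (6 * (A * X ^ 2)) - 12 * (B * X) + A ^ 2"
  proof (rule uhp_hol_eqI)
    fix \<tau> assume \<tau>: "\<tau> \<in> uhp"
    then have \<tau>': "Im \<tau> > 0" by (simp add: uhp_def)
    have "3 * xP_fun \<tau> ^ 4 = - 6 * a_fun \<tau> * xP_fun \<tau> ^ 2 - 12 * b_fun \<tau> * xP_fun \<tau> + a_fun \<tau> ^ 2"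
      using x_torsion_relations(3)[OF \<tau>' one_third_notin[OF \<tau>'] three_thirds_mem] by (simp only: xP_fun_eq[OF \<tau>'])
    then show "hol_fun (3 * X ^ 4) \<tau> = hol_fun (- (6 * (A * X ^ 2)) - 12 * (B * X) + A ^ 2) \<tau>"
      using \<tau> by (simp add: eval)
  qed
  then show "3 * mf_xP ^ 4 = - 6 * mf_a * mf_xP ^ 2 - 12 * mf_b * mf_xP + mf_a ^ 2"
    by (simp add: mf_homog A_def B_def X_def homog_power homog_numeral homog_minus homog_diff homog_mult homog_add mult.assoc)
qed

lemma mf'_in_modular_field:
  "mf_a' \<in> modular_field (Gamma0 3)" "mf_b' \<in> modular_field (Gamma0 3)"
proof -
  have ab: "mf_a \<in> modular_field (Gamma0 3)" "mf_b \<in> modular_field (Gamma0 3)"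
    using mf_in_modular_field modular_field_mono[OF Gamma0_subset] by blast+
  then show "mf_a' \<in> modular_field (Gamma0 3)" "mf_b' \<in> modular_field (Gamma0 3)"
    unfolding mf_a'_eq mf_b'_eq
    by (intro modular_field_intros ab mf_in_modular_field(3) Gamma0_subset)+
qed

text \<open>
  The variable \<open>r\<close> stands for \<open>a\<^sup>2/3\<close>, which keeps the reduction modulo the quartic free of division.
\<close>

lemma quartic_ring_products:
  fixes x a b r :: "'a :: comm_ring_1"
  assumes x4: "x ^ 4 = r - 2 * a * x ^ 2 - 4 * b * x"
  shows "(- 9 * a - 30 * x ^ 2) * x ^ 2 = - 30 * r + 120 * b * x + 51 * a * x ^ 2"
    and "(- 9 * a - 30 * x ^ 2) * x ^ 3 = - 30 * r * x + 120 * b * x ^ 2 + 51 * a * x ^ 3"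
    and "(- 27 * b - 42 * a * x - 70 * x ^ 3) * x = - 70 * r + 253 * b * x + 98 * a * x ^ 2"
    and "(- 27 * b - 42 * a * x - 70 * x ^ 3) * x ^ 2 = - 70 * r * x + 253 * b * x ^ 2 + 98 * a * x ^ 3"
    and "(- 27 * b - 42 * a * x - 70 * x ^ 3) * x ^ 3 =
      98 * a * r + - 392 * a * b * x + (- 70 * r - 196 * a ^ 2) * x ^ 2 + 253 * b * x ^ 3"
proof -
  have r: "r = x ^ 4 + 2 * a * x ^ 2 + 4 * b * x" using x4 by (simp add: algebra_simps)
  show "(- 9 * a - 30 * x ^ 2) * x ^ 2 = - 30 * r + 120 * b * x + 51 * a * x ^ 2"
    "(- 9 * a - 30 * x ^ 2) * x ^ 3 = - 30 * r * x + 120 * b * x ^ 2 + 51 * a * x ^ 3"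
    "(- 27 * b - 42 * a * x - 70 * x ^ 3) * x = - 70 * r + 253 * b * x + 98 * a * x ^ 2"
    "(- 27 * b - 42 * a * x - 70 * x ^ 3) * x ^ 2 = - 70 * r * x + 253 * b * x ^ 2 + 98 * a * x ^ 3"
    "(- 27 * b - 42 * a * x - 70 * x ^ 3) * x ^ 3 =
      98 * a * r + - 392 * a * b * x + (- 70 * r - 196 * a ^ 2) * x ^ 2 + 253 * b * x ^ 3"
    unfolding r by (simp_all add: algebra_simps power_numeral_reduce)
qed

theorem theorem5p1:
  fixes a b :: "uhp_hol poly fract"
    and \<rho> :: "uhp_hol poly fract \<Rightarrow> uhp_hol poly fract ^ 4 ^ 4"
  defines "a \<equiv> mf_a" and "b \<equiv> mf_b"
  defines "\<rho> \<equiv> regular_rep (modular_field (Gamma0 3)) (modular_field SL2Z)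
                   (vector [1, mf_xP, mf_xP ^ 2, mf_xP ^ 3])"
  shows "\<rho> mf_a' = vector
           [vector [- 9 * a, 0,       - 10 * a^2, 0],
            vector [0,       - 9 * a, 120 * b,    - 10 * a^2],
            vector [- 30,    0,       51 * a,     120 * b],
            vector [0,       - 30,    0,          51 * a]]
       \<and> \<rho> mf_b' = vector
           [vector [- 27 * b, - 70 * a^2 / 3, 0,              98 * a^3 / 3],
            vector [- 42 * a, 253 * b,        - 70 * a^2 / 3, - 392 * a * b],
            vector [0,        98 * a,         253 * b,        - 658 * a^2 / 3],
            vector [- 70,     0,              98 * a,         253 * b]]"
proof
  define x where "x = mf_xP"
  let ?K = "modular_field SL2Z" and ?v = "vector [1, x, x ^ 2, x ^ 3] :: uhp_hol poly fract ^ 4"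
  have ab: "a \<in> ?K" "b \<in> ?K" using mf_in_modular_field by (simp_all add: a_def b_def)
  have three: "(3 :: uhp_hol poly fract) \<noteq> 0"
  proof
    assume "(3 :: uhp_hol poly fract) = 0"
    then have "(3 :: uhp_hol poly) = 0" by (simp flip: to_fract_numeral)
    then have "(3 :: uhp_hol) = 0" by (simp add: numeral_poly)
    then show False using hol_fun_numeral[OF ii_in_uhp, of "num.Bit1 num.One"] by simp
  qed
  have a': "mf_a' = - 9 * a - 30 * x ^ 2" and b': "mf_b' = - 27 * b - 42 * a * x - 70 * x ^ 3"
    by (simp_all only: mf_a'_eq mf_b'_eq a_def b_def x_def)
  define r where "r = a ^ 2 / 3"
  have a_sq: "a ^ 2 = 3 * r" using three by (simp add: r_def)
  have "3 * x ^ 4 = 3 * (r - 2 * a * x ^ 2 - 4 * b * x)"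
    using mf_quartic a_sq by (simp add: a_def b_def x_def algebra_simps)
  then have x4: "x ^ 4 = r - 2 * a * x ^ 2 - 4 * b * x"
    unfolding mult_cancel_left using three by simp
  have r: "- 70 * a ^ 2 / 3 = - 70 * r" "98 * a ^ 3 / 3 = 98 * a * r" "- 658 * a ^ 2 / 3 = - 658 * r"
    "- 10 * a ^ 2 = - 30 * r"
    using three by (simp_all add: r_def power2_eq_square power3_eq_cube)
  have rK: "r \<in> ?K" unfolding r_def by (intro modular_field_intros ab order_refl)
  note K = modular_field_intros ab rK order_refl
  have coord: "coordinates ?K ?v w = vector [c1, c2, c3, c4]"
    if "w = c1 + c2 * x + c3 * x ^ 2 + c4 * x ^ 3" "c1 \<in> ?K" "c2 \<in> ?K" "c3 \<in> ?K" "c4 \<in> ?K" for w c1 c2 c3 c4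
    using that unfolding x_def by (rule coordinates_power_basis)
  note a'x = quartic_ring_products(1-2)[OF x4, folded a'] and b'x = quartic_ring_products(3-5)[OF x4, folded b']
  have a1: "coordinates ?K ?v (mf_a' * 1) = vector [- 9 * a, 0, - 30, 0]"
    by (rule coord) (simp add: a', (intro K)+)
  have a2: "coordinates ?K ?v (mf_a' * x) = vector [0, - 9 * a, 0, - 30]"
    by (rule coord) (simp add: a' algebra_simps power3_eq_cube power2_eq_square, (intro K)+)
  have a3: "coordinates ?K ?v (mf_a' * x ^ 2) = vector [- 30 * r, 120 * b, 51 * a, 0]"
    by (rule coord) (simp add: a'x, (intro K)+)
  have a4: "coordinates ?K ?v (mf_a' * x ^ 3) = vector [0, - 30 * r, 120 * b, 51 * a]"
    by (rule coord) (simp add: a'x, (intro K)+)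
  have b1: "coordinates ?K ?v (mf_b' * 1) = vector [- 27 * b, - 42 * a, 0, - 70]"
    by (rule coord) (simp add: b', (intro K)+)
  have b2: "coordinates ?K ?v (mf_b' * x) = vector [- 70 * r, 253 * b, 98 * a, 0]"
    by (rule coord) (simp add: b'x, (intro K)+)
  have b3: "coordinates ?K ?v (mf_b' * x ^ 2) = vector [0, - 70 * r, 253 * b, 98 * a]"
    by (rule coord) (simp add: b'x, (intro K)+)
  have b4: "coordinates ?K ?v (mf_b' * x ^ 3) = vector [98 * a * r, - 392 * a * b, - 658 * r, 253 * b]"
    by (rule coord) (simp add: b'x a_sq, (intro K)+)
  show "\<rho> mf_a' = vector
           [vector [- 9 * a, 0,       - 10 * a^2, 0],
            vector [0,       - 9 * a, 120 * b,    - 10 * a^2],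
            vector [- 30,    0,       51 * a,     120 * b],
            vector [0,       - 30,    0,          51 * a]]"
    unfolding r using a1 a2 a3 a4
    by (simp add: \<rho>_def regular_rep_def mf'_in_modular_field vec_eq_iff forall_4 x_def)
  show "\<rho> mf_b' = vector
           [vector [- 27 * b, - 70 * a^2 / 3, 0,              98 * a^3 / 3],
            vector [- 42 * a, 253 * b,        - 70 * a^2 / 3, - 392 * a * b],
            vector [0,        98 * a,         253 * b,        - 658 * a^2 / 3],
            vector [- 70,     0,              98 * a,         253 * b]]"
    unfolding r using b1 b2 b3 b4
    by (simp add: \<rho>_def regular_rep_def mf'_in_modular_field vec_eq_iff forall_4 x_def)
qed

end
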